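(* Let $p\ge2$ be an integer. 1. The following recurrence relation holds for all partitions $\lambda$ and all $n,k\ge1$: $$\beta_\lambda^{n,k}-\beta_\lambda^{n,k-1}=(-1)^{p-1}\beta_\lambda^{n-1,k}.$$ 2. We have $\beta_\lambda^{n,k}=0$ whenever $l(\lambda)>p-1$ or $|\lambda|>n(p-1)$. Furthermore, $\beta_\lambda^{n,0}\equiv0\pmod p$ if $n>\lambda_1$. 3. For $\lambda\vdash pn+k$ with $pn+k\ge1$, we have $\alpha_\lambda^{n,k}=\sum_i\beta_{\lambda\setminus i}^{n,k}$, where the summation ranges over all distinct parts $i$ of $\lambda$. If $\lambda$ is a partition (with $|\lambda|\le pn+k$) and $n+k>\lambda_1$, then $\alpha_{\lambda\cup(pn+k-|\lambda|)}^{n,k}=\beta_\lambda^{n,k}$.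
   Context: $p\ge2$ is an arbitrary integer (not necessarily prime); $n,k\ge0$. For a partition $\lambda=(\lambda_1\ge\lambda_2\ge\cdots>0)$, $l(\lambda)$ is the number of parts, $|\lambda|$ the sum of the parts, and $\lambda_1=0$ if $\lambda=\emptyset$. $\lambda\setminus i$ is $\lambda$ with one part $i$ removed; $\lambda\cup(j)$ is $\lambda$ with a part $j$ added (nothing is added if $j=0$). $m_\lambda,e_\lambda,h_\lambda$ are the monomial, elementary and complete homogeneous symmetric functions. The integers $\alpha_\lambda^{n,k}$ are defined by $$m_{(1^kp^n)}=\sum_{\lambda\vdash pn+k}\alpha_\lambda^{n,k}\,e_\lambda .$$ Consider two sets of variables $x,y$ and the ring $\mathbb{Z}[e_1,e_2,\ldots;\overline{e}_1,\overline{e}_2,\ldots]$ with $e_n:=e_n(x)$, $\overline{e}_n:=e_n(y)$, $e_0=\overline{e}_0=1$. Let $H_1^\perp$ be the Hammond operator of $H_1:=h_1(x,y)=h_1(x)+h_1(y)$ (the adjoint of multiplication by $H_1$ for the standard scalar product); explicitly it is the derivation with $H_1^\perp e_n=e_{n-1}$ and $H_1^\perp\overline{e}_n=\overline{e}_{n-1}$ for $n\ge1$. Define $$\overline{m}_{(1^kp^n)}:=\sum_{\lambda\vdash pn+k}\alpha_\lambda^{n,k}\,e_{\lambda\setminus\lambda_1}\,\overline{e}_{\lambda_1}\ \text{ if }k\ge n(p-2),\qquad \overline{m}_{(1^kp^n)}:=(H_1^\perp)^{n(p-2)-k}\,\overline{m}_{(1^{n(p-2)}p^n)}\ \text{ otherwise}$$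 (for $n=k=0$ this is $1$). The integers $\beta_\lambda^{n,k}$ are defined by the expansion $$\overline{m}_{(1^kp^n)}=\sum_\lambda\beta_\lambda^{n,k}\,e_\lambda\,\overline{e}_{pn+k-|\lambda|},$$ with $\beta_\lambda^{n,k}=0$ if $|\lambda|>pn+k$. *)

theory Defs
  imports "HOL-Library.Poly_Mapping" "HOL-Library.Multiset" "HOL-Number_Theory.Cong"
begin

type_synonym 'v poly_ring = "('v \<Rightarrow>\<^sub>0 nat) \<Rightarrow>\<^sub>0 int"

definition var :: "'v \<Rightarrow> 'v poly_ring" where
  "var v = Poly_Mapping.single (Poly_Mapping.single v 1) 1"


subsection \<open>Partitions\<close>

definition is_partition :: "nat multiset \<Rightarrow> bool" where
  "is_partition \<mu> \<longleftrightarrow> 0 \<notin># \<mu>"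

definition partitions_of :: "nat \<Rightarrow> nat multiset set" where
  "partitions_of d = {\<mu>. is_partition \<mu> \<and> sum_mset \<mu> = d}"

definition largest_part :: "nat multiset \<Rightarrow> nat" where
  "largest_part \<mu> = Max (insert 0 (set_mset \<mu>))"

definition add_part :: "nat multiset \<Rightarrow> nat \<Rightarrow> nat multiset" where
  "add_part \<mu> j = (if j = 0 then \<mu> else add_mset j \<mu>)"

text \<open>If \<open>i\<close> is not a part (in particular for \<open>i = 0\<close>), nothing is removed.\<close>

definition remove_part :: "nat multiset \<Rightarrow> nat \<Rightarrow> nat multiset" where
  "remove_part \<mu> i = \<mu> - {#i#}"

lemma finite_partitions_of: "finite (partitions_of d)"
proof -
  have "partitions_of d \<subseteq> mset ` {xs. set xs \<subseteq> {..d} \<and> length xs \<le> d}"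
  proof
    fix l assume l: "l \<in> partitions_of d"
    obtain xs where xs: "l = mset xs" by (metis ex_mset)
    have pos: "0 \<notin> set xs" and s: "sum_list xs = d"
      using l unfolding partitions_of_def is_partition_def xs
      by (simp_all add: sum_mset_sum_list)
    have "\<forall>x\<in>set xs. x \<le> d" unfolding s[symmetric] by (simp add: member_le_sum_list)
    moreover have "length xs \<le> sum_list xs"
      using pos by (induction xs) (simp_all add: Suc_le_eq)
    ultimately show "l \<in> mset ` {xs. set xs \<subseteq> {..d} \<and> length xs \<le> d}"
      by (simp add: xs s subset_iff)
  qed
  then show ?thesis
    by (rule finite_subset) (intro finite_imageI finite_lists_length_le, simp)
qed


subsection \<open>Symmetric functions\<close>

text \<open>
  A symmetric function is given by its restrictions to the variables \<open>x\<^sub>0, \<dots>, x\<^sub>N\<^sub>-\<^sub>1\<close> for all \<open>N\<close>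
  (the ring of symmetric functions as a graded inverse limit); an identity between
  symmetric functions is an identity between the restrictions for every \<open>N\<close>.
\<close>

definition elem_sym :: "nat \<Rightarrow> nat \<Rightarrow> nat poly_ring" where
  "elem_sym N n = (\<Sum>A | A \<subseteq> {..<N} \<and> card A = n. \<Prod>i\<in>A. var i)"

definition elem_sym_part :: "nat \<Rightarrow> nat multiset \<Rightarrow> nat poly_ring" where
  "elem_sym_part N \<mu> = (\<Prod>i\<in>#\<mu>. elem_sym N i)"

definition exponents :: "(nat \<Rightarrow>\<^sub>0 nat) \<Rightarrow> nat multiset" where
  "exponents a = image_mset (Poly_Mapping.lookup a) (mset_set (Poly_Mapping.keys a))"

definition monomial_sym :: "nat \<Rightarrow> nat multiset \<Rightarrow> nat poly_ring" where
  "monomial_sym N \<mu> =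
     (\<Sum>a | Poly_Mapping.keys a \<subseteq> {..<N} \<and> exponents a = \<mu>. Poly_Mapping.single a 1)"

lemma finite_monomials_with_exponents:
  "finite {a :: nat \<Rightarrow>\<^sub>0 nat. Poly_Mapping.keys a \<subseteq> {..<N} \<and> exponents a = \<mu>}"
    (is "finite ?S")
proof (rule finite_imageD)
  let ?T = "{f. \<forall>i. (i \<in> {..<N} \<longrightarrow> f i \<in> insert 0 (set_mset \<mu>)) \<and> (i \<notin> {..<N} \<longrightarrow> f i = 0)}"
  have "Poly_Mapping.lookup a \<in> ?T"
    if a: "Poly_Mapping.keys a \<subseteq> {..<N}" "exponents a = \<mu>" for a :: "nat \<Rightarrow>\<^sub>0 nat"
  proof (rule CollectI, intro allI conjI impI)
    fix i
    show "Poly_Mapping.lookup a i \<in> insert 0 (set_mset \<mu>)"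
    proof (cases "i \<in> Poly_Mapping.keys a")
      case True
      then show ?thesis unfolding a(2)[symmetric] exponents_def by simp
    qed (simp add: in_keys_iff)
    show "Poly_Mapping.lookup a i = 0" if "i \<notin> {..<N}"
    proof (rule ccontr)
      assume "Poly_Mapping.lookup a i \<noteq> 0"
      then have "i \<in> Poly_Mapping.keys a" by (simp add: in_keys_iff)
      with a(1) have "i \<in> {..<N}" by (rule subsetD)
      with that show False by (rule notE)
    qed
  qed
  then have "Poly_Mapping.lookup ` ?S \<subseteq> ?T"
    by (intro image_subsetI) simp
  moreover have "finite ?T" by (rule finite_set_of_finite_funs) simp_all
  ultimately show "finite (Poly_Mapping.lookup ` ?S)" by (rule finite_subset)
  show "inj_on Poly_Mapping.lookup ?S" by (rule inj_onI) (rule poly_mapping_eqI, simp)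
qed

text \<open>The partition \<open>(1\<^sup>k p\<^sup>n)\<close>.\<close>

definition ones_ps :: "nat \<Rightarrow> nat \<Rightarrow> nat \<Rightarrow> nat multiset" where
  "ones_ps p n k = replicate_mset k 1 + replicate_mset n p"

definition alpha :: "nat \<Rightarrow> nat \<Rightarrow> nat \<Rightarrow> nat multiset \<Rightarrow> int" where
  "alpha p n k = (THE a.
     (\<forall>\<mu>. \<mu> \<notin> partitions_of (p * n + k) \<longrightarrow> a \<mu> = 0) \<and>
     (\<forall>N. monomial_sym N (ones_ps p n k) =
        (\<Sum>\<mu>\<in>partitions_of (p * n + k). of_int (a \<mu>) * elem_sym_part N \<mu>)))"


subsection \<open>The polynomial ring in the elementary symmetric functions of two alphabets\<close>

text \<open>
  The functions \<open>e\<^sub>n(x)\<close>, \<open>e\<^sub>n(y)\<close> for \<open>n \<ge> 1\<close> are algebraically independent, so the ring they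
  generate is the free one. The indeterminate \<open>Inl n\<close> stands for \<open>e\<^sub>n\<^sub>+\<^sub>1(x)\<close> and \<open>Inr n\<close> for
  \<open>e\<^sub>n\<^sub>+\<^sub>1(y)\<close>, as \<open>e\<^sub>0 = 1\<close> is not a generator.
\<close>

type_synonym two_sym = "(nat + nat) poly_ring"

fun e_x :: "nat \<Rightarrow> two_sym" where
  "e_x 0 = 1"
| "e_x (Suc n) = var (Inl n)"

fun e_y :: "nat \<Rightarrow> two_sym" where
  "e_y 0 = 1"
| "e_y (Suc n) = var (Inr n)"

definition e_x_part :: "nat multiset \<Rightarrow> two_sym" where
  "e_x_part \<mu> = (\<Prod>i\<in>#\<mu>. e_x i)"

text \<open>
  The Hammond operator of \<open>h\<^sub>1(x,y)\<close>, as the derivation \<open>P \<mapsto> \<Sum>\<^sub>v \<partial>P/\<partial>v \<cdot> H1_perp v\<close>, the sum being over all indeterminates \<open>v\<close>; it is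
  characterised by the lemmas \<open>H1_perp_add\<close>, \<open>H1_perp_mult\<close>, \<open>H1_perp_e_x\<close> and \<open>H1_perp_e_y\<close>.
\<close>

definition H1_perp_gen :: "nat + nat \<Rightarrow> two_sym" where
  "H1_perp_gen v = (case v of Inl n \<Rightarrow> e_x n | Inr n \<Rightarrow> e_y n)"

definition H1_perp_mon :: "(nat + nat \<Rightarrow>\<^sub>0 nat) \<Rightarrow> int \<Rightarrow> two_sym" where
  "H1_perp_mon m c = (\<Sum>v\<in>Poly_Mapping.keys m.
     Poly_Mapping.single (m - Poly_Mapping.single v 1) (c * int (Poly_Mapping.lookup m v))
       * H1_perp_gen v)"

definition H1_perp :: "two_sym \<Rightarrow> two_sym" where
  "H1_perp P = (\<Sum>m\<in>Poly_Mapping.keys P. H1_perp_mon m (Poly_Mapping.lookup P m))"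

lemma H1_perp_mon_0 [simp]: "H1_perp_mon m 0 = 0"
  by (simp add: H1_perp_mon_def)

lemma H1_perp_mon_add: "H1_perp_mon m (c + d) = H1_perp_mon m c + H1_perp_mon m d"
  by (simp add: H1_perp_mon_def single_add distrib_right sum.distrib)

lemma H1_perp_single: "H1_perp (Poly_Mapping.single m c) = H1_perp_mon m c"
  by (simp add: H1_perp_def)

lemma H1_perp_add: "H1_perp (P + Q) = H1_perp P + H1_perp Q"
  unfolding H1_perp_def
  by (rule setsum_keys_plus_distrib) (simp_all add: H1_perp_mon_add)

lemma H1_perp_e_x: "H1_perp (e_x (Suc n)) = e_x n"
  by (simp add: var_def H1_perp_single H1_perp_mon_def H1_perp_gen_def)

lemma H1_perp_e_y: "H1_perp (e_y (Suc n)) = e_y n"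
  by (simp add: var_def H1_perp_single H1_perp_mon_def H1_perp_gen_def)

lemma H1_perp_mon_superset:
  assumes "finite V" "Poly_Mapping.keys m \<subseteq> V"
  shows "H1_perp_mon m c = (\<Sum>v\<in>V.
     Poly_Mapping.single (m - Poly_Mapping.single v 1) (c * int (Poly_Mapping.lookup m v))
       * H1_perp_gen v)"
  unfolding H1_perp_mon_def using assms
  by (intro sum.mono_neutral_left) (auto simp: in_keys_iff)

lemma single_lookup_diff_add:
  fixes m m' :: "'v \<Rightarrow>\<^sub>0 nat"
  assumes "Poly_Mapping.lookup m v \<noteq> 0"
  shows "m - Poly_Mapping.single v 1 + m' = m + m' - Poly_Mapping.single v 1"
proof (rule poly_mapping_eqI)
  fix k
  show "Poly_Mapping.lookup (m - Poly_Mapping.single v 1 + m') k =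
        Poly_Mapping.lookup (m + m' - Poly_Mapping.single v 1) k"
    using assms by (cases "k = v") (auto simp: lookup_add lookup_minus lookup_single_not_eq)
qed

lemma single_derivative_add:
  fixes m m' :: "'v \<Rightarrow>\<^sub>0 nat" and c c' :: int and v :: 'v
  defines "\<delta> \<equiv> Poly_Mapping.single v (1 :: nat)"
  shows "Poly_Mapping.single (m + m' - \<delta>) (c * c' * int (Poly_Mapping.lookup (m + m') v)) =
     Poly_Mapping.single (m - \<delta>) (c * int (Poly_Mapping.lookup m v)) * Poly_Mapping.single m' c' +
     Poly_Mapping.single m c * Poly_Mapping.single (m' - \<delta>) (c' * int (Poly_Mapping.lookup m' v))"
proof -
  have 1: "Poly_Mapping.single (m - \<delta>) (c * int (Poly_Mapping.lookup m v)) * Poly_Mapping.single m' c'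
      = Poly_Mapping.single (m + m' - \<delta>) (c * c' * int (Poly_Mapping.lookup m v))"
  proof (cases "Poly_Mapping.lookup m v = 0")
    case False
    then have "m - \<delta> + m' = m + m' - \<delta>"
      using single_lookup_diff_add[of m v m'] unfolding \<delta>_def by simp
    then show ?thesis by (simp add: mult_single mult.assoc mult.commute[of c'])
  qed simp
  have 2: "Poly_Mapping.single m c * Poly_Mapping.single (m' - \<delta>) (c' * int (Poly_Mapping.lookup m' v))
      = Poly_Mapping.single (m + m' - \<delta>) (c * c' * int (Poly_Mapping.lookup m' v))"
  proof (cases "Poly_Mapping.lookup m' v = 0")
    case False
    then have "m + (m' - \<delta>) = m + m' - \<delta>"
      using single_lookup_diff_add[of m' v m] unfolding \<delta>_def by (simp add: add.commute)
    then show ?thesis by (simp add: mult_single mult.assoc)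
  qed simp
  show ?thesis unfolding 1 2
    by (simp add: lookup_add distrib_left flip: single_add)
qed

lemma H1_perp_mult_single:
  "H1_perp (Poly_Mapping.single m c * Poly_Mapping.single m' c') =
     H1_perp (Poly_Mapping.single m c) * Poly_Mapping.single m' c' +
     Poly_Mapping.single m c * H1_perp (Poly_Mapping.single m' c')"
proof -
  let ?V = "Poly_Mapping.keys m \<union> Poly_Mapping.keys m'"
  have V: "finite ?V" "Poly_Mapping.keys m \<subseteq> ?V" "Poly_Mapping.keys m' \<subseteq> ?V"
    "Poly_Mapping.keys (m + m') \<subseteq> ?V"
    using keys_add[of m m'] by auto
  show ?thesis
    unfolding mult_single[of m c m' c'] H1_perp_single
      H1_perp_mon_superset[OF V(1) V(2)] H1_perp_mon_superset[OF V(1) V(3)]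
      H1_perp_mon_superset[OF V(1) V(4)]
      single_derivative_add
    by (simp only: sum_distrib_left sum_distrib_right distrib_left distrib_right
      sum.distrib mult_ac)
qed

lemma poly_mapping_additive_induct:
  fixes P :: "'k \<Rightarrow>\<^sub>0 'b::comm_monoid_add"
  assumes zero: "R 0" and add: "\<And>P m c. R P \<Longrightarrow> R (P + Poly_Mapping.single m c)"
  shows "R P"
proof (induction P rule: update_induct)
  case const
  show ?case by (rule zero)
next
  case (update f a b)
  have "Poly_Mapping.update a b f = f + Poly_Mapping.single a b"
    using update by (intro poly_mapping_eqI)
      (auto simp: lookup_update lookup_add lookup_single in_keys_iff)
  then show ?case using add[OF update.IH] by simp
qed

lemma H1_perp_mult: "H1_perp (P * Q) = H1_perp P * Q + P * H1_perp Q"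
proof -
  have 0: "H1_perp 0 = 0" by (simp add: H1_perp_def)
  have *: "H1_perp (P * Poly_Mapping.single m c) =
      H1_perp P * Poly_Mapping.single m c + P * H1_perp (Poly_Mapping.single m c)" for m c
    by (induction P rule: poly_mapping_additive_induct)
      (simp_all add: 0 H1_perp_add H1_perp_mult_single algebra_simps)
  show ?thesis
    by (induction Q rule: poly_mapping_additive_induct)
      (simp_all add: 0 * H1_perp_add algebra_simps)
qed


subsection \<open>The elements \<open>m_bar\<close> and their coefficients\<close>

definition m_bar_direct :: "nat \<Rightarrow> nat \<Rightarrow> nat \<Rightarrow> two_sym" where
  "m_bar_direct p n k = (\<Sum>\<mu>\<in>partitions_of (p * n + k).
     of_int (alpha p n k \<mu>) * e_x_part (remove_part \<mu> (largest_part \<mu>)) * e_y (largest_part \<mu>))"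

text \<open>All subtractions below are exact for \<open>p \<ge> 2\<close>.\<close>

definition m_bar :: "nat \<Rightarrow> nat \<Rightarrow> nat \<Rightarrow> two_sym" where
  "m_bar p n k =
     (if k \<ge> n * (p - 2) then m_bar_direct p n k
      else (H1_perp ^^ (n * (p - 2) - k)) (m_bar_direct p n (n * (p - 2))))"

definition beta :: "nat \<Rightarrow> nat \<Rightarrow> nat \<Rightarrow> nat multiset \<Rightarrow> int" where
  "beta p n k = (THE b.
     (\<forall>\<mu>. \<not> (is_partition \<mu> \<and> sum_mset \<mu> \<le> p * n + k) \<longrightarrow> b \<mu> = 0) \<and>
     m_bar p n k = (\<Sum>\<mu> | is_partition \<mu> \<and> sum_mset \<mu> \<le> p * n + k.
        of_int (b \<mu>) * e_x_part \<mu> * e_y (p * n + k - sum_mset \<mu>)))"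

lemma finite_partitions_le: "finite {\<mu>. is_partition \<mu> \<and> sum_mset \<mu> \<le> d}"
proof -
  have "{\<mu>. is_partition \<mu> \<and> sum_mset \<mu> \<le> d} = (\<Union>j\<le>d. partitions_of j)"
    by (auto simp: partitions_of_def)
  then show ?thesis using finite_partitions_of by simp
qed

end

theory Submission
  imports Defs "HOL-Library.FuncSet" "HOL-Computational_Algebra.Fundamental_Theorem_Algebra"
begin

text \<open>
  Write \<open>m\<^sub>\<mu> = \<Sum>\<^sub>\<nu> c\<^sub>\<mu>\<^sub>\<nu> e\<^sub>\<nu>\<close>. The matrix \<open>c\<close> is symmetric, being the inverse of the matrix that counts
  0-1 matrices with given row and column sums, so \<open>\<alpha>\<^sub>\<lambda>\<close> is the coefficient of \<open>e\<^sub>1\<^sup>k e\<^sub>p\<^sup>n\<close> in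
  \<open>m\<^sub>\<lambda>\<close>. It is read off by evaluating \<open>m\<^sub>\<lambda>\<close> at the roots of \<open>x\<^sup>p - x\<^sup>p\<^sup>-\<^sup>1 - S\<close>, for which
  \<open>e\<^sub>1 = 1\<close>, \<open>e\<^sub>p = \<plusminus>S\<close> and all other \<open>e\<^sub>i\<close> vanish. Splitting off the variable that carries the largest
  part \<open>a\<close> of \<open>\<lambda> = \<mu> \<union> (a)\<close> gives \<open>m\<^sub>\<lambda> = \<Sum>\<^sub>j r\<^sub>j\<^sup>a m\<^sub>\<mu>(r without r\<^sub>j)\<close>, and expanding \<open>m\<^sub>\<mu>\<close> expresses
  \<open>\<alpha>\<^sub>\<lambda>\<close> through power sums of the roots. The resulting expression in \<open>\<mu>\<close> makes sense for all \<open>n\<close>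
  and \<open>k\<close>, satisfies the recurrence and the vanishing and divisibility statements, and the operator
  \<open>H\<^sub>1\<^sup>\<bottom>\<close> lowers its \<open>k\<close> by one. It agrees with the coefficients of \<open>m_bar\<close> for \<open>k > n(p - 2)\<close>, hence
  for all \<open>k\<close>. The formula for \<open>\<alpha>\<close> as a sum of values of \<open>\<beta>\<close> is trivial for \<open>k > n(p - 2)\<close> and descends
  to all \<open>k\<close>, because the substitution \<open>y \<mapsto> x\<close> commutes with \<open>H\<^sub>1\<^sup>\<bottom>\<close> and \<open>H\<^sub>1\<^sup>\<bottom>\<close> maps
  \<open>m\<^bsub>(1\<^sup>k p\<^sup>n)\<^esub>\<close> to \<open>m\<^bsub>(1\<^sup>k\<^sup>-\<^sup>1 p\<^sup>n)\<^esub>\<close>.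
\<close>

subsection \<open>Elementary in terms of monomial symmetric functions\<close>

text \<open>In fixed degree d the exponent of e_p determines that of e_1, so e_1 may be set to 1 and
  \<open>S\<close> alone records n; p variables suffice, since only e_1 and e_p are to survive.
  Roots exist for every complex \<open>S\<close>, and an identity valid for all \<open>S\<close> is
  compared coefficientwise. The relation r^(p-1) (r - 1) = \<open>S\<close> turns each (r - 1)^l
  r^(d-l) into a power of \<open>S\<close> times a simpler sum. The obstacle: the split-off part
  must exceed \<mu>_1, and terms with l > n vanish only if l < n + k. When |\<mu>| <= n(p - 1), both
  follow from \<mu>_1 < n + k, because m_\<mu> involves only products of at most \<mu>_1 elementary
  functions. This bound is therefore carried through the construction of the expansion; its
  transpose limits the number of parts. In the direct definition of \<open>m_bar\<close>, \<mu>_1 is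
  at most |\<mu>| and at most pn + k - |\<mu>|, so 2 \<mu>_1 <= pn + k, which is below 2(n + k)
  exactly for k > n(p - 2): the origin of the threshold. The sum formula for \<alpha> is proved for
  the explicit formula before \<open>m_bar\<close> is identified, as the boundary case k = n(p - 2)
  relies on it.\<close>

definition indicator_exponent :: "nat set \<Rightarrow> nat \<Rightarrow>\<^sub>0 nat" where
  "indicator_exponent A = (\<Sum>i\<in>A. Poly_Mapping.single i 1)"

lemma lookup_indicator_exponent:
  "finite A \<Longrightarrow> Poly_Mapping.lookup (indicator_exponent A) i = (if i \<in> A then 1 else 0)"
  by (simp add: indicator_exponent_def lookup_sum lookup_single when_def)

lemma prod_single_one:
  "(\<Prod>i\<in>I. Poly_Mapping.single (g i) (1::int)) = Poly_Mapping.single (\<Sum>i\<in>I. g i) 1"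
  by (induction I rule: infinite_finite_induct) (simp_all add: mult_single)

lemma elem_sym_eq_sum_single:
  "elem_sym N n = (\<Sum>A | A \<subseteq> {..<N} \<and> card A = n. Poly_Mapping.single (indicator_exponent A) 1)"
  by (simp add: elem_sym_def var_def prod_single_one indicator_exponent_def)

lemma elem_sym_0 [simp]: "elem_sym N 0 = 1"
proof -
  have "{A. A \<subseteq> {..<N} \<and> card A = 0} = {{}}"
    using finite_subset[of _ "{..<N}"] by auto
  then show ?thesis by (simp add: elem_sym_def)
qed

lemma elem_sym_part_exponents:
  assumes "Poly_Mapping.keys b \<subseteq> {..<L}"
  shows "elem_sym_part N (exponents b) = (\<Prod>i<L. elem_sym N (Poly_Mapping.lookup b i))"
proof -
  have "elem_sym_part N (exponents b) = (\<Prod>i\<in>Poly_Mapping.keys b. elem_sym N (Poly_Mapping.lookup b i))"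
    by (simp add: elem_sym_part_def exponents_def prod_unfold_prod_mset multiset.map_comp comp_def)
  also have "\<dots> = (\<Prod>i<L. elem_sym N (Poly_Mapping.lookup b i))"
    using assms by (intro prod.mono_neutral_left) (auto simp: in_keys_iff)
  finally show ?thesis .
qed

section \<open>0-1 matrices with prescribed row and column sums\<close>

definition zero_one_matrices ::
  "nat \<Rightarrow> (nat \<Rightarrow>\<^sub>0 nat) \<Rightarrow> nat \<Rightarrow> (nat \<Rightarrow>\<^sub>0 nat) \<Rightarrow> (nat \<times> nat) set set" where
  "zero_one_matrices L b N a = {R. R \<subseteq> {..<L} \<times> {..<N} \<and>
     (\<forall>i<L. card (R `` {i}) = Poly_Mapping.lookup b i) \<and>
     (\<forall>j<N. card (R\<inverse> `` {j}) = Poly_Mapping.lookup a j)}"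

lemma card_zero_one_matrices_transpose:
  "card (zero_one_matrices L b N a) = card (zero_one_matrices N a L b)"
  by (rule bij_betw_same_card[of converse], rule bij_betw_byWitness[where f' = converse])
    (auto simp: zero_one_matrices_def)

text \<open>Expanding the product picks for each row i a set of \<open>lookup b i\<close> columns,
  the support of that row; the picked monomials multiply to the one whose exponents are the column
  sums.\<close>

lemma lookup_elem_sym_part_exponents:
  assumes b: "Poly_Mapping.keys b \<subseteq> {..<L}" and a: "Poly_Mapping.keys a \<subseteq> {..<N}"
  shows "Poly_Mapping.lookup (elem_sym_part N (exponents b)) a = int (card (zero_one_matrices L b N a))"
proof -
  define \<F> where "\<F> = PiE {..<L} (\<lambda>i. {A. A \<subseteq> {..<N} \<and> card A = Poly_Mapping.lookup b i})"
  have fin: "finite \<F>" unfolding \<F>_def by (intro finite_PiE) auto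
  have finA: "f \<in> \<F> \<Longrightarrow> i < L \<Longrightarrow> finite (f i)" for f i
    unfolding \<F>_def by (auto simp: PiE_iff intro: finite_subset)
  have "elem_sym_part N (exponents b) =
      (\<Sum>f\<in>\<F>. Poly_Mapping.single (\<Sum>i<L. indicator_exponent (f i)) 1)"
    unfolding elem_sym_part_exponents[OF b] elem_sym_eq_sum_single \<F>_def
    by (subst prod_sum_PiE) (auto simp: prod_single_one)
  then have "Poly_Mapping.lookup (elem_sym_part N (exponents b)) a =
      (\<Sum>f\<in>\<F>. if (\<Sum>i<L. indicator_exponent (f i)) = a then 1 else 0)"
    by (simp add: lookup_sum lookup_single when_def) (intro sum.cong, auto)
  also have "\<dots> = int (card {f\<in>\<F>. (\<Sum>i<L. indicator_exponent (f i)) = a})"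
    using fin by (simp add: sum.If_cases Int_def)
  also have "card {f\<in>\<F>. (\<Sum>i<L. indicator_exponent (f i)) = a} = card (zero_one_matrices L b N a)"
  proof (rule bij_betw_same_card[of "\<lambda>f. Sigma {..<L} f"],
      rule bij_betw_byWitness[where f' = "\<lambda>R. \<lambda>i\<in>{..<L}. R `` {i}"])
    have col: "card ((Sigma {..<L} f)\<inverse> `` {j}) = Poly_Mapping.lookup (\<Sum>i<L. indicator_exponent (f i)) j"
      if "f \<in> \<F>" for f j
    proof -
      have "(Sigma {..<L} f)\<inverse> `` {j} = {i\<in>{..<L}. j \<in> f i}" by auto
      then show ?thesis using finA[OF that]
        by (simp add: lookup_sum lookup_indicator_exponent Int_def sum.If_cases)
    qed
    show "\<forall>f\<in>{f\<in>\<F>. (\<Sum>i<L. indicator_exponent (f i)) = a}. (\<lambda>i\<in>{..<L}. Sigma {..<L} f `` {i}) = f"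
      by (auto simp: \<F>_def PiE_iff extensional_def fun_eq_iff)
    show "\<forall>R\<in>zero_one_matrices L b N a. Sigma {..<L} (\<lambda>i\<in>{..<L}. R `` {i}) = R"
      by (auto simp: zero_one_matrices_def)
    show "(\<lambda>f. Sigma {..<L} f) ` {f\<in>\<F>. (\<Sum>i<L. indicator_exponent (f i)) = a} \<subseteq> zero_one_matrices L b N a"
    proof (intro image_subsetI, unfold zero_one_matrices_def, intro CollectI conjI allI impI)
      fix f assume f: "f \<in> {f\<in>\<F>. (\<Sum>i<L. indicator_exponent (f i)) = a}"
      show "Sigma {..<L} f \<subseteq> {..<L} \<times> {..<N}" using f by (auto simp: \<F>_def PiE_iff)
      show "card (Sigma {..<L} f `` {i}) = Poly_Mapping.lookup b i" if "i < L" for i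
      proof -
        have "Sigma {..<L} f `` {i} = f i" using that by auto
        then show ?thesis using f that by (auto simp: \<F>_def PiE_iff)
      qed
      show "card ((Sigma {..<L} f)\<inverse> `` {j}) = Poly_Mapping.lookup a j" for j
        using f col by auto
    qed
    show "(\<lambda>R. \<lambda>i\<in>{..<L}. R `` {i}) ` zero_one_matrices L b N a \<subseteq>
        {f\<in>\<F>. (\<Sum>i<L. indicator_exponent (f i)) = a}"
    proof (intro image_subsetI CollectI conjI)
      fix R assume R: "R \<in> zero_one_matrices L b N a"
      let ?f = "\<lambda>i\<in>{..<L}. R `` {i}"
      show F: "?f \<in> \<F>" using R by (auto simp: \<F>_def zero_one_matrices_def)
      have S: "Sigma {..<L} ?f = R" using R by (auto simp: zero_one_matrices_def)
      show "(\<Sum>i<L. indicator_exponent (?f i)) = a"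
      proof (rule poly_mapping_eqI)
        fix j
        show "Poly_Mapping.lookup (\<Sum>i<L. indicator_exponent (?f i)) j = Poly_Mapping.lookup a j"
        proof (cases "j < N")
          case True
          then show ?thesis using col[OF F, of j] R unfolding S by (auto simp: zero_one_matrices_def)
        next
          case False
          then have "R\<inverse> `` {j} = {}" using R by (auto simp: zero_one_matrices_def)
          moreover have "Poly_Mapping.lookup a j = 0" using a False by (auto simp: in_keys_iff)
          ultimately show ?thesis using col[OF F, of j] unfolding S by simp
        qed
      qed
    qed
  qed
  finally show ?thesis .
qed

text \<open>Transposing the matrices exchanges the roles of the two exponent vectors.\<close>

lemma lookup_elem_sym_part_swap:
  assumes "Poly_Mapping.keys b \<subseteq> {..<L}" "Poly_Mapping.keys a \<subseteq> {..<N}"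
  shows "Poly_Mapping.lookup (elem_sym_part N (exponents b)) a =
         Poly_Mapping.lookup (elem_sym_part L (exponents a)) b"
  using assms lookup_elem_sym_part_exponents card_zero_one_matrices_transpose by metis

lemma is_partition_exponents [simp]: "is_partition (exponents a)"
  by (auto simp: is_partition_def exponents_def in_keys_iff)

lemma size_exponents: "size (exponents a) = card (Poly_Mapping.keys a)"
  by (simp add: exponents_def)

lemma sum_mset_exponents: "sum_mset (exponents a) = (\<Sum>i\<in>Poly_Mapping.keys a. Poly_Mapping.lookup a i)"
  by (simp add: exponents_def sum_unfold_sum_mset)

lemma ex_exponents:
  assumes "is_partition \<mu>" "size \<mu> \<le> N"
  shows "\<exists>a. Poly_Mapping.keys a \<subseteq> {..<N} \<and> exponents a = \<mu>"
  using assms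
proof (induction \<mu> arbitrary: N)
  case empty
  show ?case by (rule exI[of _ 0]) (simp add: exponents_def)
next
  case (add x \<mu>)
  then obtain N' where N: "N = Suc N'" and "size \<mu> \<le> N'" and x: "x \<noteq> 0" and "is_partition \<mu>"
    by (cases N) (auto simp: is_partition_def)
  then obtain a where a: "Poly_Mapping.keys a \<subseteq> {..<N'}" "exponents a = \<mu>" using add.IH by blast
  have k: "Poly_Mapping.keys (a + Poly_Mapping.single N' x) = insert N' (Poly_Mapping.keys a)"
    using a x by (auto simp: in_keys_iff lookup_add lookup_single when_def split: if_splits)
  have n: "N' \<notin> Poly_Mapping.keys a" using a by auto
  have "image_mset (Poly_Mapping.lookup (a + Poly_Mapping.single N' x)) (mset_set (Poly_Mapping.keys a))
      = image_mset (Poly_Mapping.lookup a) (mset_set (Poly_Mapping.keys a))"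
    using n by (intro image_mset_cong) (auto simp: lookup_add lookup_single when_def)
  then have "exponents (a + Poly_Mapping.single N' x) = add_mset x \<mu>"
    unfolding exponents_def k using n a by (simp add: exponents_def lookup_add in_keys_iff)
  moreover have "Poly_Mapping.keys (a + Poly_Mapping.single N' x) \<subseteq> {..<N}"
    unfolding k N using a by auto
  ultimately show ?case by blast
qed

section \<open>Homogeneous polynomials and their coordinates in the monomial basis\<close>

definition homogeneous :: "nat \<Rightarrow> nat \<Rightarrow> nat poly_ring \<Rightarrow> bool" where
  "homogeneous N d P \<longleftrightarrow>
     (\<forall>m\<in>Poly_Mapping.keys P. Poly_Mapping.keys m \<subseteq> {..<N} \<and> sum_mset (exponents m) = d)"

lemma keys_add_nat: "Poly_Mapping.keys (a + b :: 'v \<Rightarrow>\<^sub>0 nat) = Poly_Mapping.keys a \<union> Poly_Mapping.keys b"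
  by (auto simp: in_keys_iff lookup_add)

lemma sum_mset_exponents_superset:
  assumes "finite V" "Poly_Mapping.keys a \<subseteq> V"
  shows "sum_mset (exponents a) = (\<Sum>i\<in>V. Poly_Mapping.lookup a i)"
  unfolding sum_mset_exponents using assms
  by (intro sum.mono_neutral_left) (auto simp: in_keys_iff)

lemma sum_mset_exponents_add: "sum_mset (exponents (a + b)) = sum_mset (exponents a) + sum_mset (exponents b)"
  by (simp add: sum_mset_exponents_superset[of "Poly_Mapping.keys a \<union> Poly_Mapping.keys b"]
    keys_add_nat lookup_add sum.distrib)

lemma homogeneous_mult:
  assumes "homogeneous N d P" "homogeneous N e Q"
  shows "homogeneous N (d + e) (P * Q)"
  unfolding homogeneous_def
proof
  fix m assume "m \<in> Poly_Mapping.keys (P * Q)"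
  then obtain a b where "m = a + b" "a \<in> Poly_Mapping.keys P" "b \<in> Poly_Mapping.keys Q"
    using keys_mult[of P Q] by auto
  then show "Poly_Mapping.keys m \<subseteq> {..<N} \<and> sum_mset (exponents m) = d + e"
    using assms by (auto simp: homogeneous_def keys_add_nat sum_mset_exponents_add)
qed

lemma homogeneous_sum:
  assumes "\<And>i. i \<in> I \<Longrightarrow> homogeneous N d (P i)"
  shows "homogeneous N d (\<Sum>i\<in>I. P i)"
  unfolding homogeneous_def
proof
  fix m assume "m \<in> Poly_Mapping.keys (\<Sum>i\<in>I. P i)"
  then obtain i where "i \<in> I" "Poly_Mapping.lookup (P i) m \<noteq> 0"
    by (auto simp: in_keys_iff lookup_sum dest: sum.not_neutral_contains_not_neutral)
  then show "Poly_Mapping.keys m \<subseteq> {..<N} \<and> sum_mset (exponents m) = d"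
    using assms[of i] by (auto simp: homogeneous_def in_keys_iff)
qed

lemma lookup_of_int_mult:
  "Poly_Mapping.lookup (of_int k * P :: 'v poly_ring) a = k * Poly_Mapping.lookup P a"
proof -
  have "of_int k * P = Poly_Mapping.map ((*) k) P"
    using single_of_int[of k, where 'b = int and 'a = "'v \<Rightarrow>\<^sub>0 nat"] mult_map_scale_conv_mult[of k P] by simp
  then show ?thesis by (simp add: Poly_Mapping.map.rep_eq when_def)
qed

lemma homogeneous_of_int_mult:
  "homogeneous N d P \<Longrightarrow> homogeneous N d (of_int k * P)"
  by (auto simp: homogeneous_def in_keys_iff lookup_of_int_mult)

lemma keys_indicator_exponent: "finite A \<Longrightarrow> Poly_Mapping.keys (indicator_exponent A) = A"
  by (auto simp: in_keys_iff lookup_indicator_exponent split: if_splits)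

lemma sum_mset_exponents_indicator: "finite A \<Longrightarrow> sum_mset (exponents (indicator_exponent A)) = card A"
  by (simp add: sum_mset_exponents keys_indicator_exponent lookup_indicator_exponent)

lemma homogeneous_elem_sym: "homogeneous N n (elem_sym N n)"
  unfolding elem_sym_eq_sum_single
proof (rule homogeneous_sum)
  fix A assume "A \<in> {A. A \<subseteq> {..<N} \<and> card A = n}"
  moreover from this have "finite A" using finite_subset by blast
  ultimately show "homogeneous N n (Poly_Mapping.single (indicator_exponent A) 1)"
    by (auto simp: homogeneous_def keys_indicator_exponent sum_mset_exponents_indicator)
qed

lemma elem_sym_part_add_mset: "elem_sym_part N (add_mset i \<mu>) = elem_sym N i * elem_sym_part N \<mu>"
  by (simp add: elem_sym_part_def)

lemma elem_sym_part_empty [simp]: "elem_sym_part N {#} = 1"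
  by (simp add: elem_sym_part_def)

lemma exponents_0 [simp]: "exponents 0 = {#}"
  by (simp add: exponents_def)

lemma homogeneous_elem_sym_part: "homogeneous N (sum_mset \<mu>) (elem_sym_part N \<mu>)"
proof (induction \<mu>)
  case empty
  show ?case by (simp add: homogeneous_def)
next
  case (add i \<mu>)
  then show ?case
    using homogeneous_mult[OF homogeneous_elem_sym add.IH] by (simp add: elem_sym_part_add_mset)
qed

lemma lookup_monomial_sym:
  "Poly_Mapping.lookup (monomial_sym N \<mu>) a =
     (if Poly_Mapping.keys a \<subseteq> {..<N} \<and> exponents a = \<mu> then 1 else 0)"
  unfolding monomial_sym_def lookup_sum lookup_single when_def
  by (subst sum.delta) (auto simp: finite_monomials_with_exponents)

lemma homogeneous_monomial_sym: "homogeneous N (sum_mset \<mu>) (monomial_sym N \<mu>)"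
  unfolding homogeneous_def by (auto simp: in_keys_iff[of _ "monomial_sym N \<mu>"] lookup_monomial_sym split: if_splits)

lemma lookup_sum_monomial_sym:
  assumes "Poly_Mapping.keys a \<subseteq> {..<N}" "sum_mset (exponents a) = d"
  shows "Poly_Mapping.lookup (\<Sum>\<mu>\<in>partitions_of d. of_int (K \<mu>) * monomial_sym N \<mu>) a = K (exponents a)"
  using assms finite_partitions_of[of d]
  by (simp add: lookup_sum lookup_of_int_mult lookup_monomial_sym if_distrib sum.delta
    partitions_of_def cong: if_cong)

text \<open>The hypothesis on the coefficients expresses symmetry without any action of
  permutations; both sides then have the same coefficients in degree d and none elsewhere.\<close>

lemma eq_sum_monomial_sym:
  assumes "homogeneous N d P"
    and "\<And>a. \<lbrakk>Poly_Mapping.keys a \<subseteq> {..<N}; sum_mset (exponents a) = d\<rbrakk>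
      \<Longrightarrow> Poly_Mapping.lookup P a = K (exponents a)"
  shows "P = (\<Sum>\<mu>\<in>partitions_of d. of_int (K \<mu>) * monomial_sym N \<mu>)"
proof (rule poly_mapping_eqI)
  let ?Q = "\<Sum>\<mu>\<in>partitions_of d. of_int (K \<mu>) * monomial_sym N \<mu>"
  have Q: "homogeneous N d ?Q"
  proof (intro homogeneous_sum homogeneous_of_int_mult)
    fix \<mu> assume "\<mu> \<in> partitions_of d"
    then show "homogeneous N d (monomial_sym N \<mu>)"
      using homogeneous_monomial_sym[of N \<mu>] by (simp add: partitions_of_def)
  qed
  fix a
  show "Poly_Mapping.lookup P a = Poly_Mapping.lookup ?Q a"
  proof (cases "Poly_Mapping.keys a \<subseteq> {..<N} \<and> sum_mset (exponents a) = d")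
    case True
    then show ?thesis using assms(2)[of a] lookup_sum_monomial_sym[of a N d K] by simp
  next
    case False
    then have "a \<notin> Poly_Mapping.keys P" "a \<notin> Poly_Mapping.keys ?Q"
      using assms(1) Q by (auto simp: homogeneous_def)
    then show ?thesis by (simp add: in_keys_iff)
  qed
qed

text \<open>A chosen monomial of type \<mu>; \<open>size \<mu>\<close> variables are the fewest that
  can carry one.\<close>

definition monomial_exponent :: "nat multiset \<Rightarrow> nat \<Rightarrow>\<^sub>0 nat" where
  "monomial_exponent \<mu> = (SOME a. Poly_Mapping.keys a \<subseteq> {..<size \<mu>} \<and> exponents a = \<mu>)"

lemma monomial_exponent:
  assumes "is_partition \<mu>"
  shows "Poly_Mapping.keys (monomial_exponent \<mu>) \<subseteq> {..<size \<mu>}" "exponents (monomial_exponent \<mu>) = \<mu>"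
  using someI_ex[OF ex_exponents[OF assms order_refl]] unfolding monomial_exponent_def by blast+

definition elem_monomial_coeff :: "nat multiset \<Rightarrow> nat multiset \<Rightarrow> int" where
  "elem_monomial_coeff \<mu> \<nu> = Poly_Mapping.lookup (elem_sym_part (size \<nu>) \<mu>) (monomial_exponent \<nu>)"

text \<open>This is the symmetry of e_\<mu>. Transposing once trades the vector \<open>a\<close> for
  its multiset of exponents, and transposing back puts any other vector with the same exponents in
  its place.\<close>

lemma lookup_elem_sym_part:
  assumes "is_partition \<mu>" "Poly_Mapping.keys a \<subseteq> {..<N}"
  shows "Poly_Mapping.lookup (elem_sym_part N \<mu>) a = elem_monomial_coeff \<mu> (exponents a)"
proof -
  define b where "b = monomial_exponent \<mu>"
  define a' where "a' = monomial_exponent (exponents a)"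
  have b: "Poly_Mapping.keys b \<subseteq> {..<size \<mu>}" "exponents b = \<mu>"
    unfolding b_def using monomial_exponent[OF assms(1)] by auto
  have a': "Poly_Mapping.keys a' \<subseteq> {..<size (exponents a)}" "exponents a' = exponents a"
    unfolding a'_def using monomial_exponent[of "exponents a"] by auto
  have "Poly_Mapping.lookup (elem_sym_part N \<mu>) a = Poly_Mapping.lookup (elem_sym_part (size \<mu>) (exponents a)) b"
    using lookup_elem_sym_part_swap[OF b(1) assms(2)] b(2) by simp
  also have "\<dots> = Poly_Mapping.lookup (elem_sym_part (size (exponents a)) \<mu>) a'"
    using lookup_elem_sym_part_swap[OF b(1) a'(1)] b(2) a'(2) by simp
  finally show ?thesis unfolding elem_monomial_coeff_def a'_def .
qed

lemma elem_monomial_coeff_commute: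
  assumes "is_partition \<mu>" "is_partition \<nu>"
  shows "elem_monomial_coeff \<mu> \<nu> = elem_monomial_coeff \<nu> \<mu>"
  unfolding elem_monomial_coeff_def
  using lookup_elem_sym_part_swap[of "monomial_exponent \<mu>" "size \<mu>" "monomial_exponent \<nu>" "size \<nu>"]
    monomial_exponent assms by simp

lemma elem_sym_part_eq_sum_monomial_sym:
  assumes "\<mu> \<in> partitions_of d"
  shows "elem_sym_part N \<mu> = (\<Sum>\<nu>\<in>partitions_of d. of_int (elem_monomial_coeff \<mu> \<nu>) * monomial_sym N \<nu>)"
  using assms homogeneous_elem_sym_part[of N \<mu>]
  by (intro eq_sum_monomial_sym) (auto simp: partitions_of_def lookup_elem_sym_part)

subsection \<open>Monomial in terms of elementary symmetric functions\<close>

text \<open>Subtraction of exponents is truncated, hence the divisibility test.\<close>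

lemma lookup_single_mult:
  fixes Q :: "'v poly_ring"
  shows "Poly_Mapping.lookup (Poly_Mapping.single m 1 * Q) b =
    (if \<forall>i. Poly_Mapping.lookup m i \<le> Poly_Mapping.lookup b i then Poly_Mapping.lookup Q (b - m) else 0)"
proof (induction Q rule: poly_mapping_additive_induct)
  case (2 Q m' c)
  have "(m + m' = b) = ((\<forall>i. Poly_Mapping.lookup m i \<le> Poly_Mapping.lookup b i) \<and> m' = b - m)"
  proof
    assume *: "(\<forall>i. Poly_Mapping.lookup m i \<le> Poly_Mapping.lookup b i) \<and> m' = b - m"
    show "m + m' = b" by (rule poly_mapping_eqI) (use * in \<open>simp add: lookup_add lookup_minus\<close>)
  qed (auto simp: lookup_add)
  then show ?case
    by (auto simp: distrib_left lookup_add 2 mult_single lookup_single when_def)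
qed simp

lemma lookup_elem_sym_mult:
  "Poly_Mapping.lookup (elem_sym N k * Q) b =
    (\<Sum>A | A \<subseteq> {..<N} \<and> card A = k \<and> A \<subseteq> Poly_Mapping.keys b. Poly_Mapping.lookup Q (b - indicator_exponent A))"
proof -
  have "Poly_Mapping.lookup (elem_sym N k * Q) b = (\<Sum>A | A \<subseteq> {..<N} \<and> card A = k.
      if A \<subseteq> Poly_Mapping.keys b then Poly_Mapping.lookup Q (b - indicator_exponent A) else 0)"
    unfolding elem_sym_eq_sum_single sum_distrib_right lookup_sum lookup_single_mult
  proof (intro sum.cong refl if_cong)
    fix A assume "A \<in> {A. A \<subseteq> {..<N} \<and> card A = k}"
    then have "finite A" using finite_subset by blast
    then show "(\<forall>i. Poly_Mapping.lookup (indicator_exponent A) i \<le> Poly_Mapping.lookup b i) = (A \<subseteq> Poly_Mapping.keys b)"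
      by (auto simp: lookup_indicator_exponent in_keys_iff subset_iff Suc_le_eq)
  qed
  then show ?thesis
    by (subst (asm) sum.inter_filter[symmetric]) (auto simp: conj_assoc)
qed

lemma exponents_superset:
  assumes "finite V" "Poly_Mapping.keys a \<subseteq> V"
  shows "exponents a = {#x \<in># image_mset (Poly_Mapping.lookup a) (mset_set V). x \<noteq> 0#}"
proof -
  have "{i \<in> V. Poly_Mapping.lookup a i \<noteq> 0} = Poly_Mapping.keys a"
    using assms by (auto simp: in_keys_iff)
  then show ?thesis using assms by (simp add: exponents_def filter_mset_image_mset)
qed

text \<open>The multisets can differ only in the number of zeros, which the sizes fix. This undoes
  the dropping of zeros in \<open>decrement_parts\<close>.\<close>

lemma filter_nonzero_mset_inject:
  fixes A B :: "nat multiset"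
  assumes "{#x \<in># A. x \<noteq> 0#} = {#x \<in># B. x \<noteq> 0#}" "size A = size B"
  shows "A = B"
proof -
  have *: "Z = {#x \<in># Z. x \<noteq> 0#} + replicate_mset (size Z - size {#x \<in># Z. x \<noteq> 0#}) 0" for Z :: "nat multiset"
    by (induction Z) (auto simp: Suc_diff_le size_filter_mset_lesseq)
  have "A = {#x \<in># A. x \<noteq> 0#} + replicate_mset (size A - size {#x \<in># A. x \<noteq> 0#}) 0" by (rule *)
  also have "\<dots> = B" unfolding assms by (rule *[symmetric])
  finally show ?thesis .
qed

text \<open>Removal of the first column of the Young diagram.\<close>

definition decrement_parts :: "nat multiset \<Rightarrow> nat multiset" where
  "decrement_parts \<mu> = {#x \<in># image_mset (\<lambda>x. x - 1) \<mu>. x \<noteq> 0#}"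

lemma exponents_diff_keys:
  "exponents (b - indicator_exponent (Poly_Mapping.keys b)) = decrement_parts (exponents b)"
proof -
  have "exponents (b - indicator_exponent (Poly_Mapping.keys b)) =
    {#x \<in># image_mset (Poly_Mapping.lookup (b - indicator_exponent (Poly_Mapping.keys b))) (mset_set (Poly_Mapping.keys b)). x \<noteq> 0#}"
    by (rule exponents_superset) (auto simp: in_keys_iff lookup_minus)
  also have "image_mset (Poly_Mapping.lookup (b - indicator_exponent (Poly_Mapping.keys b))) (mset_set (Poly_Mapping.keys b))
      = image_mset (\<lambda>x. x - 1) (exponents b)"
    unfolding exponents_def multiset.map_comp
    by (intro image_mset_cong) (simp add: lookup_minus lookup_indicator_exponent)
  finally show ?thesis by (simp add: decrement_parts_def)
qed

lemma eq_indicator_add_diff: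
  assumes "finite A" "A \<subseteq> Poly_Mapping.keys b"
  shows "b = indicator_exponent A + (b - indicator_exponent A)"
  by (rule poly_mapping_eqI)
    (use assms in \<open>auto simp: lookup_add lookup_minus lookup_indicator_exponent in_keys_iff Suc_le_eq subset_iff\<close>)

lemma largest_part_le_iff: "largest_part \<mu> \<le> b \<longleftrightarrow> (\<forall>x\<in>#\<mu>. x \<le> b)"
  by (simp add: largest_part_def)

lemma largest_part_ge: "x \<in># \<mu> \<Longrightarrow> x \<le> largest_part \<mu>"
  by (simp add: largest_part_def)

text \<open>
  Multiplying \<open>m\<^sub>\<mu>\<^sub>-\<^sub>1\<close> (all parts of \<open>\<mu>\<close> lowered by one) by \<open>e\<^sub>l\<close> with \<open>l = l(\<mu>)\<close> yields \<open>m\<^sub>\<mu>\<close> and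
  monomial functions with more parts, none of them larger than \<open>\<mu>\<^sub>1\<close>.
\<close>

lemma lookup_elem_sym_mult_monomial_sym_self:
  assumes "exponents b = \<mu>" "Poly_Mapping.keys b \<subseteq> {..<N}"
  shows "Poly_Mapping.lookup (elem_sym N (size \<mu>) * monomial_sym N (decrement_parts \<mu>)) b = 1"
proof -
  have k: "card (Poly_Mapping.keys b) = size \<mu>" using assms size_exponents by metis
  have "{A. A \<subseteq> {..<N} \<and> card A = size \<mu> \<and> A \<subseteq> Poly_Mapping.keys b} = {Poly_Mapping.keys b}"
    using assms(2) k card_subset_eq[of "Poly_Mapping.keys b"] by auto
  moreover have "Poly_Mapping.keys (b - indicator_exponent (Poly_Mapping.keys b)) \<subseteq> {..<N}"
    using assms(2) by (auto simp: in_keys_iff lookup_minus subset_iff)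
  ultimately show ?thesis
    by (simp add: lookup_elem_sym_mult lookup_monomial_sym exponents_diff_keys assms(1))
qed

lemma lookup_elem_sym_mult_monomial_sym_nonzero:
  assumes "Poly_Mapping.lookup (elem_sym N (size \<mu>) * monomial_sym N (decrement_parts \<mu>)) b \<noteq> 0"
    and "is_partition \<mu>" "exponents b \<noteq> \<mu>"
  shows "size \<mu> < size (exponents b)" "largest_part (exponents b) \<le> largest_part \<mu>"
proof -
  from assms(1) have "\<exists>A\<in>{A. A \<subseteq> {..<N} \<and> card A = size \<mu> \<and> A \<subseteq> Poly_Mapping.keys b}.
      Poly_Mapping.lookup (monomial_sym N (decrement_parts \<mu>)) (b - indicator_exponent A) \<noteq> 0"
    unfolding lookup_elem_sym_mult by (rule contrapos_np) (intro sum.neutral, blast)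
  then obtain A where "A \<in> {A. A \<subseteq> {..<N} \<and> card A = size \<mu> \<and> A \<subseteq> Poly_Mapping.keys b}"
    and n0: "Poly_Mapping.lookup (monomial_sym N (decrement_parts \<mu>)) (b - indicator_exponent A) \<noteq> 0"
    by blast
  then have A: "A \<subseteq> {..<N}" "card A = size \<mu>" "A \<subseteq> Poly_Mapping.keys b"
    by blast+
  have a: "exponents (b - indicator_exponent A) = decrement_parts \<mu>"
    using n0 unfolding lookup_monomial_sym by presburger
  have fA: "finite A" using A finite_subset by blast
  let ?a = "b - indicator_exponent A"
  have la: "Poly_Mapping.lookup b i = Poly_Mapping.lookup ?a i + (if i \<in> A then 1 else 0)" for i
    by (subst eq_indicator_add_diff[OF fA A(3)]) (simp only: lookup_add lookup_indicator_exponent[OF fA] add.commute)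
  \<comment> \<open>Otherwise lowering all parts gives the same result for
    \<open>exponents b\<close> and for \<mu>; both have the same number of parts, so raising them
    again gives \<open>exponents b\<close> = \<mu>.\<close>
  have "A \<noteq> Poly_Mapping.keys b"
  proof
    assume eq: "A = Poly_Mapping.keys b"
    have "decrement_parts (exponents b) = decrement_parts \<mu>" using a eq exponents_diff_keys by simp
    then have "image_mset (\<lambda>x. x - 1) (exponents b) = image_mset (\<lambda>x. x - 1) \<mu>"
      unfolding decrement_parts_def using A(2) eq size_exponents[of b]
      by - (rule filter_nonzero_mset_inject, auto)
    then have "image_mset Suc (image_mset (\<lambda>x. x - 1) (exponents b)) = image_mset Suc (image_mset (\<lambda>x. x - 1) \<mu>)"
      by simp
    moreover have "image_mset Suc (image_mset (\<lambda>x. x - 1) \<nu>) = \<nu>" if "is_partition \<nu>" for \<nu>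
    proof -
      have "image_mset Suc (image_mset (\<lambda>x. x - 1) \<nu>) = image_mset id \<nu>"
        unfolding multiset.map_comp comp_def
        using that by (intro image_mset_cong) (auto simp: is_partition_def intro!: Suc_pred gr0I)
      then show ?thesis by simp
    qed
    ultimately show False using assms(2,3) by simp
  qed
  then have "card A < card (Poly_Mapping.keys b)" using A(3) by (intro psubset_card_mono) auto
  then show "size \<mu> < size (exponents b)" by (simp add: size_exponents A)
  have *: "Poly_Mapping.lookup ?a i \<le> largest_part \<mu> - 1" for i
  proof (cases "i \<in> Poly_Mapping.keys ?a")
    case True
    then have "Poly_Mapping.lookup ?a i \<in># decrement_parts \<mu>"
      unfolding a[symmetric] exponents_def by simp
    then show ?thesis unfolding decrement_parts_def using largest_part_ge[of _ \<mu>] by (auto intro!: diff_le_mono)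
  qed (simp add: in_keys_iff)
  have pos: "largest_part \<mu> \<ge> 1" if "A \<noteq> {}"
  proof -
    have "\<mu> \<noteq> {#}" using that A(2) fA by auto
    then obtain x where "x \<in># \<mu>" by blast
    then show ?thesis using largest_part_ge[of x \<mu>] assms(2) by (auto simp: is_partition_def Suc_le_eq intro: gr0I)
  qed
  have "Poly_Mapping.lookup b i \<le> largest_part \<mu>" for i
  proof (cases "i \<in> A")
    case True
    then have "A \<noteq> {}" by blast
    then show ?thesis using *[of i] la[of i] pos True by simp
  qed (use *[of i] la[of i] in simp)
  then show "largest_part (exponents b) \<le> largest_part \<mu>"
    unfolding largest_part_le_iff by (auto simp: exponents_def)
qed

text \<open>The coefficients must not depend on \<open>N\<close>, since an identity of symmetric
  functions is meant; \<open>b\<close> bounds the number of factors, and this bound for m_\<mu>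
  later limits the supports of \<alpha> and \<beta>.\<close>

definition e_expandable :: "nat \<Rightarrow> nat \<Rightarrow> (nat \<Rightarrow> nat poly_ring) \<Rightarrow> bool" where
  "e_expandable d b F \<longleftrightarrow> (\<exists>c. (\<forall>\<nu>. c \<nu> \<noteq> 0 \<longrightarrow> \<nu> \<in> partitions_of d \<and> size \<nu> \<le> b) \<and>
     (\<forall>N. F N = (\<Sum>\<nu>\<in>partitions_of d. of_int (c \<nu>) * elem_sym_part N \<nu>)))"

lemma e_expandable_mono: "e_expandable d b F \<Longrightarrow> b \<le> b' \<Longrightarrow> e_expandable d b' F"
  unfolding e_expandable_def by (meson order_trans)

lemma e_expandable_0: "e_expandable d b (\<lambda>N. 0)"
  unfolding e_expandable_def by (rule exI[of _ "\<lambda>_. 0"]) simp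

lemma e_expandable_add:
  assumes "e_expandable d b F" "e_expandable d b G"
  shows "e_expandable d b (\<lambda>N. F N + G N)"
proof -
  from assms obtain c c' where
    c: "\<forall>\<nu>. c \<nu> \<noteq> 0 \<longrightarrow> \<nu> \<in> partitions_of d \<and> size \<nu> \<le> b"
      "\<forall>N. F N = (\<Sum>\<nu>\<in>partitions_of d. of_int (c \<nu>) * elem_sym_part N \<nu>)"
    and c': "\<forall>\<nu>. c' \<nu> \<noteq> 0 \<longrightarrow> \<nu> \<in> partitions_of d \<and> size \<nu> \<le> b"
      "\<forall>N. G N = (\<Sum>\<nu>\<in>partitions_of d. of_int (c' \<nu>) * elem_sym_part N \<nu>)"
    unfolding e_expandable_def by blast
  have "c \<nu> + c' \<nu> \<noteq> 0 \<longrightarrow> \<nu> \<in> partitions_of d \<and> size \<nu> \<le> b" for \<nu>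
    using c(1)[rule_format, of \<nu>] c'(1)[rule_format, of \<nu>] by (cases "c \<nu> = 0") auto
  then show ?thesis unfolding e_expandable_def
    using c(2) c'(2) by (intro exI[of _ "\<lambda>\<nu>. c \<nu> + c' \<nu>"]) (simp add: distrib_right sum.distrib)
qed

lemma e_expandable_scale:
  assumes "e_expandable d b F"
  shows "e_expandable d b (\<lambda>N. of_int k * F N)"
proof -
  from assms obtain c where
    c: "\<forall>\<nu>. c \<nu> \<noteq> 0 \<longrightarrow> \<nu> \<in> partitions_of d \<and> size \<nu> \<le> b"
      "\<forall>N. F N = (\<Sum>\<nu>\<in>partitions_of d. of_int (c \<nu>) * elem_sym_part N \<nu>)"
    unfolding e_expandable_def by blast
  then show ?thesis unfolding e_expandable_def
    by (intro exI[of _ "\<lambda>\<nu>. k * c \<nu>"]) (simp add: sum_distrib_left mult.assoc)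
qed

lemma e_expandable_sum:
  assumes "\<And>i. i \<in> I \<Longrightarrow> e_expandable d b (F i)"
  shows "e_expandable d b (\<lambda>N. \<Sum>i\<in>I. F i N)"
  using assms
  by (induction I rule: infinite_finite_induct) (auto intro: e_expandable_0 e_expandable_add)

lemma e_expandable_elem_sym_part:
  assumes "\<nu> \<in> partitions_of d" "size \<nu> \<le> b"
  shows "e_expandable d b (\<lambda>N. elem_sym_part N \<nu>)"
  unfolding e_expandable_def
  by (rule exI[of _ "\<lambda>\<nu>'. if \<nu>' = \<nu> then 1 else 0"])
    (use assms in \<open>auto simp: if_distrib if_distribR finite_partitions_of sum.delta cong: if_cong\<close>)

lemma e_expandable_elem_sym_mult:
  assumes "e_expandable d b F" "k \<ge> 1"
  shows "e_expandable (d + k) (b + 1) (\<lambda>N. elem_sym N k * F N)"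
proof -
  from assms(1) obtain c where
    c: "\<forall>\<nu>. c \<nu> \<noteq> 0 \<longrightarrow> \<nu> \<in> partitions_of d \<and> size \<nu> \<le> b"
      "\<forall>N. F N = (\<Sum>\<nu>\<in>partitions_of d. of_int (c \<nu>) * elem_sym_part N \<nu>)"
    unfolding e_expandable_def by blast
  have "e_expandable (d + k) (b + 1)
      (\<lambda>N. \<Sum>\<nu>\<in>partitions_of d. of_int (c \<nu>) * elem_sym_part N (add_mset k \<nu>))"
  proof (rule e_expandable_sum)
    fix \<nu> assume \<nu>: "\<nu> \<in> partitions_of d"
    show "e_expandable (d + k) (b + 1) (\<lambda>N. of_int (c \<nu>) * elem_sym_part N (add_mset k \<nu>))"
    proof (cases "c \<nu> = 0")
      case False
      then have "size \<nu> \<le> b" using c(1) by simp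
      then show ?thesis using \<nu> assms(2)
        by (intro e_expandable_scale e_expandable_elem_sym_part) (auto simp: partitions_of_def is_partition_def)
    qed (simp add: e_expandable_0)
  qed
  then show ?thesis using c(2) by (simp add: elem_sym_part_add_mset sum_distrib_left mult_ac)
qed

lemma sum_elem_sym_part_eq:
  "(\<Sum>\<nu>\<in>partitions_of d. of_int (a \<nu>) * elem_sym_part N \<nu>) =
   (\<Sum>\<mu>\<in>partitions_of d. of_int (\<Sum>\<nu>\<in>partitions_of d. a \<nu> * elem_monomial_coeff \<nu> \<mu>) * monomial_sym N \<mu>)"
proof -
  have "(\<Sum>\<nu>\<in>partitions_of d. of_int (a \<nu>) * elem_sym_part N \<nu>) =
      (\<Sum>\<nu>\<in>partitions_of d. \<Sum>\<mu>\<in>partitions_of d. of_int (a \<nu> * elem_monomial_coeff \<nu> \<mu>) * monomial_sym N \<mu>)"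
    by (auto simp: elem_sym_part_eq_sum_monomial_sym sum_distrib_left mult.assoc intro!: sum.cong)
  also have "\<dots> = (\<Sum>\<mu>\<in>partitions_of d. \<Sum>\<nu>\<in>partitions_of d.
        of_int (a \<nu> * elem_monomial_coeff \<nu> \<mu>) * monomial_sym N \<mu>)"
    by (rule sum.swap)
  finally show ?thesis by (simp add: sum_distrib_right)
qed

lemma e_expandable_imp_monomial_expansion:
  assumes "e_expandable d b F"
  shows "\<exists>K. \<forall>N. F N = (\<Sum>\<mu>\<in>partitions_of d. of_int (K \<mu>) * monomial_sym N \<mu>)"
proof -
  from assms obtain c where
    "\<forall>N. F N = (\<Sum>\<nu>\<in>partitions_of d. of_int (c \<nu>) * elem_sym_part N \<nu>)"
    unfolding e_expandable_def by blast
  then show ?thesis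
    by (intro exI[of _ "\<lambda>\<mu>. \<Sum>\<nu>\<in>partitions_of d. c \<nu> * elem_monomial_coeff \<nu> \<mu>"] allI)
      (simp only: sum_elem_sym_part_eq)
qed

lemma size_le_sum_mset: "is_partition \<mu> \<Longrightarrow> size \<mu> \<le> sum_mset \<mu>"
  by (induction \<mu>) (auto simp: is_partition_def Suc_le_eq add_le_mono[of 1, simplified] intro: Suc_leI)

lemma sum_mset_decrement_parts:
  "is_partition \<mu> \<Longrightarrow> sum_mset (decrement_parts \<mu>) + size \<mu> = sum_mset \<mu>"
  by (induction \<mu>) (auto simp: is_partition_def decrement_parts_def)

text \<open>Lowering all parts decreases the largest one by 1, and undoing it costs one elementary
  factor, so \<mu>_1 bounds the number of factors. The correction terms have the same degree but
  more parts, hence the lexicographic measure.\<close>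

lemma e_expandable_monomial_sym:
  assumes "is_partition \<mu>"
  shows "e_expandable (sum_mset \<mu>) (largest_part \<mu>) (\<lambda>N. monomial_sym N \<mu>)"
  using assms
proof (induction \<mu> rule: wf_induct_rule[OF wf_measures[of "[sum_mset, \<lambda>\<mu>. sum_mset \<mu> - size \<mu>]"], consumes 0, case_names less])
  case (less \<mu>)
  let ?d = "sum_mset \<mu>" and ?b = "largest_part \<mu>" and ?\<mu>' = "decrement_parts \<mu>"
  note part = \<open>is_partition \<mu>\<close>
  show ?case
  proof (cases "\<mu> = {#}")
    case True
    have "monomial_sym N {#} = elem_sym_part N {#}" for N
      by (rule poly_mapping_eqI) (auto simp: lookup_monomial_sym exponents_def lookup_one when_def mset_set_empty_iff)
    then show ?thesis using e_expandable_elem_sym_part[of "{#}" 0 0] True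
      by (simp add: partitions_of_def is_partition_def largest_part_def)
  next
    case False
    define k where "k = size \<mu>"
    have k: "k \<ge> 1" using False unfolding k_def by (simp add: Suc_le_eq nonempty_has_size)
    have sum': "sum_mset ?\<mu>' + k = ?d" using sum_mset_decrement_parts[OF part] by (simp add: k_def)
    obtain x where x: "x \<in># \<mu>" using False by blast
    have b1: "?b \<ge> 1" using largest_part_ge[OF x] x part by (auto simp: is_partition_def Suc_le_eq intro: gr0I)
    have b': "largest_part ?\<mu>' + 1 \<le> ?b"
    proof -
      have "largest_part ?\<mu>' \<le> ?b - 1" unfolding largest_part_le_iff decrement_parts_def
        using largest_part_ge[of _ \<mu>] by (auto intro!: diff_le_mono)
      then show ?thesis using b1 by linarith
    qed
    define F where "F = (\<lambda>N. elem_sym N k * monomial_sym N ?\<mu>')"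
    have "e_expandable (sum_mset ?\<mu>') (largest_part ?\<mu>') (\<lambda>N. monomial_sym N ?\<mu>')"
      using less.IH[of ?\<mu>'] sum' k by (auto simp: is_partition_def decrement_parts_def)
    from e_expandable_elem_sym_mult[OF this k] have F: "e_expandable ?d ?b F"
      unfolding F_def sum' by (rule e_expandable_mono[OF _ b'])
    obtain K where K: "\<And>N. F N = (\<Sum>\<rho>\<in>partitions_of ?d. of_int (K \<rho>) * monomial_sym N \<rho>)"
      using e_expandable_imp_monomial_expansion[OF F] by blast
    have K_lookup: "K \<rho> = Poly_Mapping.lookup (F (size \<rho>)) (monomial_exponent \<rho>)" if "\<rho> \<in> partitions_of ?d" for \<rho>
    proof -
      have "is_partition \<rho>" "sum_mset \<rho> = ?d" using that by (auto simp: partitions_of_def)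
      with monomial_exponent[of \<rho>] show ?thesis unfolding K by (simp add: lookup_sum_monomial_sym)
    qed
    have \<mu>: "\<mu> \<in> partitions_of ?d" using part by (simp add: partitions_of_def)
    \<comment> \<open>Since this coefficient is 1, solving for m_\<mu> keeps all coefficients
      integral.\<close>
    have K1: "K \<mu> = 1"
      unfolding K_lookup[OF \<mu>] F_def k_def
      by (rule lookup_elem_sym_mult_monomial_sym_self) (use monomial_exponent[OF part] in auto)
    have "e_expandable ?d ?b (\<lambda>N. F N + of_int (- 1) * (\<Sum>\<rho>\<in>partitions_of ?d - {\<mu>}. of_int (K \<rho>) * monomial_sym N \<rho>))"
    proof (rule e_expandable_add[OF F], rule e_expandable_scale, rule e_expandable_sum)
      fix \<rho> assume \<rho>: "\<rho> \<in> partitions_of ?d - {\<mu>}"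
      show "e_expandable ?d ?b (\<lambda>N. of_int (K \<rho>) * monomial_sym N \<rho>)"
      proof (cases "K \<rho> = 0")
        case False
        have p: "is_partition \<rho>" "sum_mset \<rho> = ?d" using \<rho> by (auto simp: partitions_of_def)
        have "Poly_Mapping.lookup (elem_sym (size \<rho>) (size \<mu>) * monomial_sym (size \<rho>) (decrement_parts \<mu>)) (monomial_exponent \<rho>) \<noteq> 0"
          using False K_lookup \<rho> unfolding F_def k_def by auto
        from lookup_elem_sym_mult_monomial_sym_nonzero[OF this part] monomial_exponent[OF p(1)] \<rho>
        have *: "size \<mu> < size \<rho>" "largest_part \<rho> \<le> ?b" by auto
        have "e_expandable (sum_mset \<rho>) (largest_part \<rho>) (\<lambda>N. monomial_sym N \<rho>)"
          using less.IH[of \<rho>] p * size_le_sum_mset[OF p(1)] by simp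
        then show ?thesis unfolding p(2) using *(2) by (intro e_expandable_scale) (rule e_expandable_mono)
      qed (simp add: e_expandable_0)
    qed
    moreover have "F N + of_int (- 1) * (\<Sum>\<rho>\<in>partitions_of ?d - {\<mu>}. of_int (K \<rho>) * monomial_sym N \<rho>) = monomial_sym N \<mu>" for N
      unfolding K by (subst sum.remove[OF finite_partitions_of \<mu>]) (simp add: K1)
    ultimately show ?thesis by simp
  qed
qed

section \<open>Inversion and symmetry of the transition matrix\<close>

definition monomial_elem_coeff :: "nat multiset \<Rightarrow> nat multiset \<Rightarrow> int" where
  "monomial_elem_coeff \<mu> = (SOME c.
     (\<forall>\<nu>. c \<nu> \<noteq> 0 \<longrightarrow> \<nu> \<in> partitions_of (sum_mset \<mu>) \<and> size \<nu> \<le> largest_part \<mu>) \<and>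
     (\<forall>N. monomial_sym N \<mu> = (\<Sum>\<nu>\<in>partitions_of (sum_mset \<mu>). of_int (c \<nu>) * elem_sym_part N \<nu>)))"

lemma monomial_elem_coeff_nonzero:
  assumes "is_partition \<mu>" "monomial_elem_coeff \<mu> \<nu> \<noteq> 0"
  shows "\<nu> \<in> partitions_of (sum_mset \<mu>)" "size \<nu> \<le> largest_part \<mu>"
  using someI_ex[OF e_expandable_monomial_sym[OF assms(1), unfolded e_expandable_def]] assms(2)
  unfolding monomial_elem_coeff_def[symmetric] by blast+

lemma monomial_sym_eq_sum_elem_sym_part:
  assumes "\<mu> \<in> partitions_of d"
  shows "monomial_sym N \<mu> = (\<Sum>\<nu>\<in>partitions_of d. of_int (monomial_elem_coeff \<mu> \<nu>) * elem_sym_part N \<nu>)"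
proof -
  have "is_partition \<mu>" "sum_mset \<mu> = d" using assms by (auto simp: partitions_of_def)
  then show ?thesis
    using someI_ex[OF e_expandable_monomial_sym[of \<mu>, unfolded e_expandable_def]]
    unfolding monomial_elem_coeff_def[symmetric] by blast
qed

text \<open>With \<open>size \<mu>\<close> variables there is a monomial of type \<mu>, and its
  coefficient isolates \<open>a \<mu>\<close>.\<close>

lemma monomial_sym_independent:
  assumes "\<And>N. (\<Sum>\<mu>\<in>partitions_of d. of_int (a \<mu>) * monomial_sym N \<mu>) =
      (\<Sum>\<mu>\<in>partitions_of d. of_int (b \<mu>) * monomial_sym N \<mu>)"
    and "\<mu> \<in> partitions_of d"
  shows "a \<mu> = b \<mu>"
proof -
  have \<mu>: "is_partition \<mu>" "sum_mset \<mu> = d" using assms(2) by (auto simp: partitions_of_def)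
  note m = monomial_exponent[OF \<mu>(1)]
  show ?thesis
    using arg_cong[OF assms(1)[of "size \<mu>"], of "\<lambda>P. Poly_Mapping.lookup P (monomial_exponent \<mu>)"] m \<mu>(2)
    by (simp add: lookup_sum_monomial_sym)
qed

lemma monomial_elem_coeff_inverse:
  assumes "\<mu> \<in> partitions_of d" "\<rho> \<in> partitions_of d"
  shows "(\<Sum>\<nu>\<in>partitions_of d. monomial_elem_coeff \<mu> \<nu> * elem_monomial_coeff \<nu> \<rho>) = (if \<rho> = \<mu> then 1 else 0)"
proof (rule monomial_sym_independent[OF _ assms(2), where b = "\<lambda>\<rho>. if \<rho> = \<mu> then 1 else 0"])
  fix N
  have "(\<Sum>\<rho>\<in>partitions_of d. of_int (if \<rho> = \<mu> then 1 else 0) * monomial_sym N \<rho>) = monomial_sym N \<mu>"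
    using assms(1) finite_partitions_of by (simp add: if_distrib if_distribR sum.delta cong: if_cong)
  then show "(\<Sum>\<rho>\<in>partitions_of d. of_int (\<Sum>\<nu>\<in>partitions_of d. monomial_elem_coeff \<mu> \<nu> * elem_monomial_coeff \<nu> \<rho>) * monomial_sym N \<rho>)
      = (\<Sum>\<rho>\<in>partitions_of d. of_int (if \<rho> = \<mu> then 1 else 0) * monomial_sym N \<rho>)"
    using sum_elem_sym_part_eq[of "monomial_elem_coeff \<mu>" N d] monomial_sym_eq_sum_elem_sym_part[OF assms(1), of N]
    by simp
qed

lemma elem_monomial_coeff_commute':
  "\<mu> \<in> partitions_of d \<Longrightarrow> \<nu> \<in> partitions_of d \<Longrightarrow> elem_monomial_coeff \<mu> \<nu> = elem_monomial_coeff \<nu> \<mu>"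
  by (simp add: partitions_of_def elem_monomial_coeff_commute)

text \<open>Since \<open>elem_monomial_coeff\<close> is symmetric, the one-sided inverse also undoes
  the passage from e-coordinates to m-coordinates; independence of the elementary products is a
  consequence.\<close>

lemma sum_monomial_elem_coeff_inverse:
  assumes "\<mu> \<in> partitions_of d"
  shows "(\<Sum>\<rho>\<in>partitions_of d. monomial_elem_coeff \<mu> \<rho> * (\<Sum>\<nu>\<in>partitions_of d. a \<nu> * elem_monomial_coeff \<nu> \<rho>)) = a \<mu>"
proof -
  have "(\<Sum>\<rho>\<in>partitions_of d. monomial_elem_coeff \<mu> \<rho> * (\<Sum>\<nu>\<in>partitions_of d. a \<nu> * elem_monomial_coeff \<nu> \<rho>)) =
     (\<Sum>\<rho>\<in>partitions_of d. \<Sum>\<nu>\<in>partitions_of d. a \<nu> * (monomial_elem_coeff \<mu> \<rho> * elem_monomial_coeff \<rho> \<nu>))"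
    by (auto simp: sum_distrib_left elem_monomial_coeff_commute'[of _ d] mult_ac intro!: sum.cong)
  also have "\<dots> = (\<Sum>\<nu>\<in>partitions_of d. a \<nu> * (\<Sum>\<rho>\<in>partitions_of d. monomial_elem_coeff \<mu> \<rho> * elem_monomial_coeff \<rho> \<nu>))"
    by (subst sum.swap) (simp add: sum_distrib_left)
  also have "\<dots> = (\<Sum>\<nu>\<in>partitions_of d. if \<nu> = \<mu> then a \<nu> else 0)"
    using assms by (intro sum.cong) (auto simp: monomial_elem_coeff_inverse)
  also have "\<dots> = a \<mu>" using assms finite_partitions_of by simp
  finally show ?thesis .
qed

text \<open>The matrix of the coefficients is the inverse of a symmetric matrix.\<close>

lemma monomial_elem_coeff_commute:
  assumes "\<mu> \<in> partitions_of d" "\<rho> \<in> partitions_of d"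
  shows "monomial_elem_coeff \<mu> \<rho> = monomial_elem_coeff \<rho> \<mu>"
proof -
  have "monomial_elem_coeff \<rho> \<mu> = (\<Sum>\<sigma>\<in>partitions_of d. monomial_elem_coeff \<mu> \<sigma> *
      (\<Sum>\<nu>\<in>partitions_of d. monomial_elem_coeff \<rho> \<nu> * elem_monomial_coeff \<nu> \<sigma>))"
    by (rule sum_monomial_elem_coeff_inverse[OF assms(1), symmetric])
  also have "\<dots> = (\<Sum>\<sigma>\<in>partitions_of d. if \<sigma> = \<rho> then monomial_elem_coeff \<mu> \<sigma> else 0)"
    using assms by (intro sum.cong) (auto simp: monomial_elem_coeff_inverse)
  also have "\<dots> = monomial_elem_coeff \<mu> \<rho>" using assms finite_partitions_of by simp
  finally show ?thesis ..
qed

lemma elem_sym_part_independent: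
  assumes "\<And>N. (\<Sum>\<nu>\<in>partitions_of d. of_int (a \<nu>) * elem_sym_part N \<nu>) =
      (\<Sum>\<nu>\<in>partitions_of d. of_int (b \<nu>) * elem_sym_part N \<nu>)"
    and "\<mu> \<in> partitions_of d"
  shows "a \<mu> = b \<mu>"
proof -
  have "(\<Sum>\<nu>\<in>partitions_of d. a \<nu> * elem_monomial_coeff \<nu> \<rho>) = (\<Sum>\<nu>\<in>partitions_of d. b \<nu> * elem_monomial_coeff \<nu> \<rho>)"
    if "\<rho> \<in> partitions_of d" for \<rho>
    by (rule monomial_sym_independent[OF _ that]) (use assms(1) in \<open>simp only: sum_elem_sym_part_eq\<close>)
  then have "(\<Sum>\<rho>\<in>partitions_of d. monomial_elem_coeff \<mu> \<rho> * (\<Sum>\<nu>\<in>partitions_of d. a \<nu> * elem_monomial_coeff \<nu> \<rho>)) =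
      (\<Sum>\<rho>\<in>partitions_of d. monomial_elem_coeff \<mu> \<rho> * (\<Sum>\<nu>\<in>partitions_of d. b \<nu> * elem_monomial_coeff \<nu> \<rho>))"
    by simp
  then show ?thesis unfolding sum_monomial_elem_coeff_inverse[OF assms(2)] .
qed

lemma ones_ps_in_partitions_of: "p \<ge> 1 \<Longrightarrow> ones_ps p n k \<in> partitions_of (p * n + k)"
  by (auto simp: ones_ps_def partitions_of_def is_partition_def sum_mset_replicate_mset)

text \<open>Uniqueness of the e-expansion settles the definite description; exchanging the indices
  then turns the expansion of one fixed m into one fixed coefficient of all m_\<mu>.\<close>

lemma alpha_eq_monomial_elem_coeff:
  assumes "p \<ge> 1"
  shows "alpha p n k \<mu> = (if \<mu> \<in> partitions_of (p * n + k) then monomial_elem_coeff \<mu> (ones_ps p n k) else 0)"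
proof -
  let ?d = "p * n + k" and ?o = "ones_ps p n k"
  note o = ones_ps_in_partitions_of[OF assms, of n k]
  have "alpha p n k = (\<lambda>\<mu>. if \<mu> \<in> partitions_of ?d then monomial_elem_coeff ?o \<mu> else 0)"
    unfolding alpha_def
  proof (rule the_equality)
    show "(\<forall>\<mu>. \<mu> \<notin> partitions_of ?d \<longrightarrow> (if \<mu> \<in> partitions_of ?d then monomial_elem_coeff ?o \<mu> else 0) = 0) \<and>
      (\<forall>N. monomial_sym N ?o = (\<Sum>\<mu>\<in>partitions_of ?d.
         of_int (if \<mu> \<in> partitions_of ?d then monomial_elem_coeff ?o \<mu> else 0) * elem_sym_part N \<mu>))"
      using monomial_sym_eq_sum_elem_sym_part[OF o] by (auto intro!: sum.cong)
  next
    fix a assume a: "(\<forall>\<mu>. \<mu> \<notin> partitions_of ?d \<longrightarrow> a \<mu> = 0) \<and>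
      (\<forall>N. monomial_sym N ?o = (\<Sum>\<mu>\<in>partitions_of ?d. of_int (a \<mu>) * elem_sym_part N \<mu>))"
    have "a \<mu> = monomial_elem_coeff ?o \<mu>" if "\<mu> \<in> partitions_of ?d" for \<mu>
      by (rule elem_sym_part_independent[OF _ that])
        (use a monomial_sym_eq_sum_elem_sym_part[OF o] in metis)
    then show "a = (\<lambda>\<mu>. if \<mu> \<in> partitions_of ?d then monomial_elem_coeff ?o \<mu> else 0)"
      using a by auto
  qed
  then show ?thesis using monomial_elem_coeff_commute[OF o] by simp
qed

section \<open>Removing a box from a partition, and multiplication by e_1\<close>

definition lower_part :: "nat multiset \<Rightarrow> nat \<Rightarrow> nat multiset" where
  "lower_part \<rho> t = add_part (remove_part \<rho> t) (t - 1)"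

text \<open>Equal parts count separately. The number is both the coefficient of e_\<mu> in the
  Hammond derivative of e_\<rho> and that of m_\<rho> in e_1 m_\<mu>: the two operators are adjoint
  in the pairing that makes the e and the m dual bases.\<close>

definition lower_multiplicity :: "nat multiset \<Rightarrow> nat multiset \<Rightarrow> nat" where
  "lower_multiplicity \<rho> \<mu> = size {#t \<in># \<rho>. lower_part \<rho> t = \<mu>#}"

lemma lower_part_in_partitions_of:
  assumes "\<rho> \<in> partitions_of (Suc d)" "t \<in># \<rho>"
  shows "lower_part \<rho> t \<in> partitions_of d"
proof -
  obtain \<sigma> where "\<rho> = add_mset t \<sigma>" using assms(2) by (metis mset_add)
  then show ?thesis using assms(1)
    by (auto simp: lower_part_def remove_part_def add_part_def partitions_of_def is_partition_def)
qed

lemma sum_mset_eq_sum_filter: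
  fixes f :: "'b \<Rightarrow> 'a::comm_semiring_1"
  assumes "finite S" "\<And>t. t \<in># \<rho> \<Longrightarrow> h t \<in> S"
  shows "(\<Sum>t\<in>#\<rho>. f (h t)) = (\<Sum>\<mu>\<in>S. of_nat (size {#t \<in># \<rho>. h t = \<mu>#}) * f \<mu>)"
  using assms(2)
proof (induction \<rho>)
  case (add t \<rho>)
  have "(\<Sum>\<mu>\<in>S. of_nat (size {#s \<in># add_mset t \<rho>. h s = \<mu>#}) * f \<mu>) =
      (\<Sum>\<mu>\<in>S. of_nat (size {#s \<in># \<rho>. h s = \<mu>#}) * f \<mu> + (if \<mu> = h t then f \<mu> else 0))"
    by (intro sum.cong) (auto simp: distrib_right add.commute)
  also have "\<dots> = (\<Sum>s\<in>#\<rho>. f (h s)) + f (h t)"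
    using add assms(1) by (simp add: sum.distrib ac_simps)
  finally show ?case by (simp add: ac_simps)
qed simp

lemma sum_mset_lower_part:
  fixes f :: "nat multiset \<Rightarrow> 'a::comm_semiring_1"
  assumes "\<rho> \<in> partitions_of (Suc d)"
  shows "(\<Sum>t\<in>#\<rho>. f (lower_part \<rho> t)) = (\<Sum>\<mu>\<in>partitions_of d. of_nat (lower_multiplicity \<rho> \<mu>) * f \<mu>)"
  unfolding lower_multiplicity_def
  by (rule sum_mset_eq_sum_filter) (use assms lower_part_in_partitions_of finite_partitions_of in auto)

lemma exponents_add_single:
  assumes "j \<notin> Poly_Mapping.keys a"
  shows "exponents (a + Poly_Mapping.single j x) = add_part (exponents a) x"
proof (cases "x = 0")
  case False
  have "Poly_Mapping.keys (a + Poly_Mapping.single j x) = insert j (Poly_Mapping.keys a)"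
    using False by (auto simp: keys_add_nat)
  moreover have "image_mset (Poly_Mapping.lookup (a + Poly_Mapping.single j x)) (mset_set (Poly_Mapping.keys a))
      = image_mset (Poly_Mapping.lookup a) (mset_set (Poly_Mapping.keys a))"
    using assms by (intro image_mset_cong) (auto simp: lookup_add lookup_single when_def)
  ultimately show ?thesis using assms False
    by (simp add: exponents_def add_part_def lookup_add in_keys_iff)
qed (simp add: add_part_def)

lemma exponents_diff_single:
  assumes "j \<in> Poly_Mapping.keys b"
  shows "exponents (b - Poly_Mapping.single j 1) = lower_part (exponents b) (Poly_Mapping.lookup b j)"
proof -
  define t where "t = Poly_Mapping.lookup b j"
  define a where "a = b - Poly_Mapping.single j t"
  have t: "t \<noteq> 0" using assms by (simp add: t_def in_keys_iff)
  have j: "j \<notin> Poly_Mapping.keys a" by (simp add: in_keys_iff a_def lookup_minus t_def)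
  have "b = a + Poly_Mapping.single j t" "b - Poly_Mapping.single j 1 = a + Poly_Mapping.single j (t - 1)"
    by (rule poly_mapping_eqI, auto simp: a_def t_def lookup_add lookup_minus lookup_single when_def)+
  then have "exponents b = add_part (exponents a) t" "exponents (b - Poly_Mapping.single j 1) = add_part (exponents a) (t - 1)"
    using exponents_add_single[OF j] by metis+
  then show ?thesis using t unfolding t_def[symmetric] lower_part_def by (simp add: add_part_def remove_part_def)
qed

lemma elem_sym_1_mult_monomial_sym:
  assumes "\<mu> \<in> partitions_of d"
  shows "elem_sym N 1 * monomial_sym N \<mu> =
    (\<Sum>\<rho>\<in>partitions_of (Suc d). of_int (int (lower_multiplicity \<rho> \<mu>)) * monomial_sym N \<rho>)"
proof (rule eq_sum_monomial_sym)
  show "homogeneous N (Suc d) (elem_sym N 1 * monomial_sym N \<mu>)"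
    using homogeneous_mult[OF homogeneous_elem_sym[of N 1] homogeneous_monomial_sym[of N \<mu>]] assms
    by (simp add: partitions_of_def)
next
  fix b :: "nat \<Rightarrow>\<^sub>0 nat"
  assume b: "Poly_Mapping.keys b \<subseteq> {..<N}"
  have "{A. A \<subseteq> {..<N} \<and> card A = 1 \<and> A \<subseteq> Poly_Mapping.keys b} = (\<lambda>j. {j}) ` Poly_Mapping.keys b"
    using b by (auto simp: card_1_singleton_iff)
  then have "Poly_Mapping.lookup (elem_sym N 1 * monomial_sym N \<mu>) b =
      (\<Sum>j\<in>Poly_Mapping.keys b. Poly_Mapping.lookup (monomial_sym N \<mu>) (b - Poly_Mapping.single j 1))"
    unfolding lookup_elem_sym_mult by (simp add: sum.reindex indicator_exponent_def)
  also have "\<dots> = (\<Sum>j\<in>Poly_Mapping.keys b. if lower_part (exponents b) (Poly_Mapping.lookup b j) = \<mu> then 1 else 0)"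
  proof (rule sum.cong[OF refl])
    fix j assume j: "j \<in> Poly_Mapping.keys b"
    have "Poly_Mapping.keys (b - Poly_Mapping.single j 1) \<subseteq> {..<N}"
      using b by (auto simp: in_keys_iff lookup_minus subset_iff)
    then show "Poly_Mapping.lookup (monomial_sym N \<mu>) (b - Poly_Mapping.single j 1) =
        (if lower_part (exponents b) (Poly_Mapping.lookup b j) = \<mu> then 1 else 0)"
      unfolding lookup_monomial_sym exponents_diff_single[OF j] by simp
  qed
  also have "\<dots> = int (lower_multiplicity (exponents b) \<mu>)"
    unfolding lower_multiplicity_def exponents_def[of b] filter_mset_image_mset
    by (simp add: exponents_def sum.If_cases Int_def comp_def conj_commute)
  finally show "Poly_Mapping.lookup (elem_sym N 1 * monomial_sym N \<mu>) b = int (lower_multiplicity (exponents b) \<mu>)" .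
qed

lemma bij_betw_add_one_part:
  "bij_betw (add_mset 1) (partitions_of d) {\<nu> \<in> partitions_of (Suc d). 1 \<in># \<nu>}"
  by (rule bij_betw_byWitness[where f' = "\<lambda>\<nu>. \<nu> - {#1#}"])
    (auto simp: partitions_of_def is_partition_def sum_mset_diff dest: in_diffD)

text \<open>Two e-expansions of e_1 m_\<mu> are compared: one passes through its m-expansion, the
  other multiplies the e-expansion of m_\<mu> by e_1, which adds a part 1 to every
  partition.\<close>

lemma sum_lower_multiplicity_monomial_elem_coeff:
  assumes "\<mu> \<in> partitions_of d" "\<nu> \<in> partitions_of (Suc d)"
  shows "(\<Sum>\<rho>\<in>partitions_of (Suc d). int (lower_multiplicity \<rho> \<mu>) * monomial_elem_coeff \<rho> \<nu>) =
    (if 1 \<in># \<nu> then monomial_elem_coeff \<mu> (\<nu> - {#1#}) else 0)"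
proof (rule elem_sym_part_independent[OF _ assms(2),
      where b = "\<lambda>\<nu>. if 1 \<in># \<nu> then monomial_elem_coeff \<mu> (\<nu> - {#1#}) else 0"])
  fix N
  let ?P = "partitions_of (Suc d)"
  have "(\<Sum>\<nu>\<in>?P. of_int (\<Sum>\<rho>\<in>?P. int (lower_multiplicity \<rho> \<mu>) * monomial_elem_coeff \<rho> \<nu>) * elem_sym_part N \<nu>)
      = (\<Sum>\<nu>\<in>?P. \<Sum>\<rho>\<in>?P. of_int (int (lower_multiplicity \<rho> \<mu>)) * (of_int (monomial_elem_coeff \<rho> \<nu>) * elem_sym_part N \<nu>))"
    by (simp add: sum_distrib_right mult.assoc)
  also have "\<dots> = (\<Sum>\<rho>\<in>?P. of_int (int (lower_multiplicity \<rho> \<mu>)) * monomial_sym N \<rho>)"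
    by (subst sum.swap) (auto simp: sum_distrib_left monomial_sym_eq_sum_elem_sym_part intro!: sum.cong)
  also have "\<dots> = elem_sym N 1 * monomial_sym N \<mu>"
    by (rule elem_sym_1_mult_monomial_sym[OF assms(1), symmetric])
  also have "\<dots> = (\<Sum>\<nu>\<in>partitions_of d. of_int (monomial_elem_coeff \<mu> (add_mset 1 \<nu> - {#1#})) * elem_sym_part N (add_mset 1 \<nu>))"
    unfolding monomial_sym_eq_sum_elem_sym_part[OF assms(1)]
    by (simp add: sum_distrib_left elem_sym_part_add_mset mult_ac)
  also have "\<dots> = (\<Sum>\<nu> | \<nu> \<in> ?P \<and> 1 \<in># \<nu>. of_int (monomial_elem_coeff \<mu> (\<nu> - {#1#})) * elem_sym_part N \<nu>)"
    by (rule sum.reindex_bij_betw[OF bij_betw_add_one_part])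
  also have "\<dots> = (\<Sum>\<nu>\<in>?P. of_int (if 1 \<in># \<nu> then monomial_elem_coeff \<mu> (\<nu> - {#1#}) else 0) * elem_sym_part N \<nu>)"
    using finite_partitions_of by (intro sum.mono_neutral_cong_left) auto
  finally show "(\<Sum>\<nu>\<in>?P. of_int (\<Sum>\<rho>\<in>?P. int (lower_multiplicity \<rho> \<mu>) * monomial_elem_coeff \<rho> \<nu>) * elem_sym_part N \<nu>)
      = (\<Sum>\<nu>\<in>?P. of_int (if 1 \<in># \<nu> then monomial_elem_coeff \<mu> (\<nu> - {#1#}) else 0) * elem_sym_part N \<nu>)" .
qed

subsection \<open>Evaluation of polynomials\<close>

definition monomial_eval :: "('v \<Rightarrow> 'a::comm_ring_1) \<Rightarrow> ('v \<Rightarrow>\<^sub>0 nat) \<Rightarrow> 'a" where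
  "monomial_eval q m = (\<Prod>i\<in>Poly_Mapping.keys m. q i ^ Poly_Mapping.lookup m i)"

text \<open>The target is an arbitrary commutative ring: the complex numbers for the roots, and
  \<open>two_sym\<close> itself for the substitution of one alphabet into the other.\<close>

definition poly_eval :: "('v \<Rightarrow> 'a::comm_ring_1) \<Rightarrow> 'v poly_ring \<Rightarrow> 'a" where
  "poly_eval q P = (\<Sum>m\<in>Poly_Mapping.keys P. of_int (Poly_Mapping.lookup P m) * monomial_eval q m)"

lemma monomial_eval_superset:
  assumes "finite V" "Poly_Mapping.keys m \<subseteq> V"
  shows "monomial_eval q m = (\<Prod>i\<in>V. q i ^ Poly_Mapping.lookup m i)"
  unfolding monomial_eval_def using assms
  by (intro prod.mono_neutral_left) (auto simp: in_keys_iff)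

lemma monomial_eval_add: "monomial_eval q (a + b) = monomial_eval q a * monomial_eval q b"
  by (simp add: monomial_eval_superset[of "Poly_Mapping.keys a \<union> Poly_Mapping.keys b"]
    keys_add_nat lookup_add power_add prod.distrib)

lemma monomial_eval_single: "monomial_eval q (Poly_Mapping.single j a) = q j ^ a"
  by (simp add: monomial_eval_def)

lemma poly_eval_0 [simp]: "poly_eval q 0 = 0"
  by (simp add: poly_eval_def)

lemma poly_eval_add: "poly_eval q (P + Q) = poly_eval q P + poly_eval q Q"
  unfolding poly_eval_def by (rule setsum_keys_plus_distrib) (simp_all add: distrib_right)

lemma poly_eval_single: "poly_eval q (Poly_Mapping.single m c) = of_int c * monomial_eval q m"
  by (simp add: poly_eval_def)

lemma poly_eval_sum: "poly_eval q (\<Sum>i\<in>I. P i) = (\<Sum>i\<in>I. poly_eval q (P i))"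
  by (induction I rule: infinite_finite_induct) (simp_all add: poly_eval_add)

lemma poly_eval_mult: "poly_eval q (P * Q) = poly_eval q P * poly_eval q Q"
proof -
  have *: "poly_eval q (P * Poly_Mapping.single m c) = poly_eval q P * poly_eval q (Poly_Mapping.single m c)" for m c
    by (induction P rule: poly_mapping_additive_induct)
      (simp_all add: poly_eval_add poly_eval_single mult_single monomial_eval_add distrib_right, (simp_all add: mult_ac)?)
  show ?thesis
    by (induction Q rule: poly_mapping_additive_induct) (simp_all add: poly_eval_add * distrib_left)
qed

lemma poly_eval_1 [simp]: "poly_eval q 1 = 1"
  using poly_eval_single[of q 0 1] by (simp add: monomial_eval_def)

lemma poly_eval_of_int [simp]:
  fixes q :: "'v \<Rightarrow> 'a::comm_ring_1"
  shows "poly_eval q (of_int k) = of_int k"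
  using poly_eval_single[of q 0 k] single_of_int[of k, where 'b = int and 'a = "'v \<Rightarrow>\<^sub>0 nat"]
  by (simp add: monomial_eval_def)

lemma poly_eval_elem_sym_part:
  "poly_eval q (elem_sym_part N \<mu>) = (\<Prod>i\<in>#\<mu>. poly_eval q (elem_sym N i))"
  by (induction \<mu>) (simp_all add: elem_sym_part_add_mset poly_eval_mult)

lemma poly_eval_elem_sym:
  "poly_eval q (elem_sym N k) = (\<Sum>A | A \<subseteq> {..<N} \<and> card A = k. \<Prod>i\<in>A. q i)"
  unfolding elem_sym_eq_sum_single poly_eval_sum poly_eval_single
proof (intro sum.cong refl)
  fix A assume "A \<in> {A. A \<subseteq> {..<N} \<and> card A = k}"
  then have "finite A" using finite_subset by blast
  then show "of_int 1 * monomial_eval q (indicator_exponent A) = (\<Prod>i\<in>A. q i)"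
    by (simp add: monomial_eval_def keys_indicator_exponent lookup_indicator_exponent)
qed

lemma poly_eval_monomial_sym:
  "poly_eval q (monomial_sym N \<mu>) =
    (\<Sum>a | Poly_Mapping.keys a \<subseteq> {..<N} \<and> exponents a = \<mu>. monomial_eval q a)"
  by (simp add: monomial_sym_def poly_eval_sum poly_eval_single)

section \<open>Vieta's formulas and removal of one variable\<close>

lemma sum_subsets_by_card:
  assumes "finite V"
  shows "(\<Sum>A\<in>Pow V. f A) = (\<Sum>k\<le>card V. \<Sum>A | A \<subseteq> V \<and> card A = k. f A)"
proof -
  have "(\<Sum>k\<in>{..card V}. \<Sum>A | A \<in> Pow V \<and> card A = k. f A) = (\<Sum>A\<in>Pow V. f A)"
    using assms by (intro sum.group) (auto simp: card_mono)
  then show ?thesis by simp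
qed

lemma prod_linear_factors:
  fixes q :: "nat \<Rightarrow> 'a::comm_ring_1"
  shows "(\<Prod>i<N. [:- q i, 1:]) = (\<Sum>k\<le>N. monom ((- 1) ^ k * poly_eval q (elem_sym N k)) (N - k))"
proof -
  have "(\<Prod>i<N. [:- q i, 1:]) = (\<Prod>i<N. [:- q i:] + [:0, 1:])"
    by simp
  also have "\<dots> = (\<Sum>A\<in>Pow {..<N}. (\<Prod>i\<in>A. [:- q i:]) * (\<Prod>i\<in>{..<N} - A. [:0, 1:]))"
    by (rule prod_add) simp
  also have "\<dots> = (\<Sum>A\<in>Pow {..<N}. monom ((- 1) ^ card A * (\<Prod>i\<in>A. q i)) (N - card A))"
  proof (intro sum.cong refl)
    fix A assume "A \<in> Pow {..<N}"
    then have A: "A \<subseteq> {..<N}" "finite A" using finite_subset by auto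
    have "(\<Prod>i\<in>A. [:- q i:]) = [:\<Prod>i\<in>A. - q i:]"
      using A(2) by induction (simp_all add: mult.commute)
    moreover have "(\<Prod>i\<in>A. - q i) = (- 1) ^ card A * (\<Prod>i\<in>A. q i)" by (rule prod_uminus)
    moreover have "card ({..<N} - A) = N - card A" using A by (simp add: card_Diff_subset)
    ultimately show "(\<Prod>i\<in>A. [:- q i:]) * (\<Prod>i\<in>{..<N} - A. [:0, 1:]) =
        monom ((- 1) ^ card A * (\<Prod>i\<in>A. q i)) (N - card A)"
      by (simp add: monom_altdef)
  qed
  also have "\<dots> = (\<Sum>k\<le>N. \<Sum>A | A \<subseteq> {..<N} \<and> card A = k. monom ((- 1) ^ card A * (\<Prod>i\<in>A. q i)) (N - card A))"
    by (subst sum_subsets_by_card) simp_all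
  also have "\<dots> = (\<Sum>k\<le>N. monom ((- 1) ^ k * poly_eval q (elem_sym N k)) (N - k))"
  proof (intro sum.cong refl)
    fix k
    have "(\<Sum>A | A \<subseteq> {..<N} \<and> card A = k. monom ((- 1) ^ card A * (\<Prod>i\<in>A. q i)) (N - card A)) =
      (\<Sum>A | A \<subseteq> {..<N} \<and> card A = k. monom ((- 1) ^ k * (\<Prod>i\<in>A. q i)) (N - k))"
      by (intro sum.cong) auto
    also have "\<dots> = monom (\<Sum>A | A \<subseteq> {..<N} \<and> card A = k. (- 1) ^ k * (\<Prod>i\<in>A. q i)) (N - k)"
      by (rule poly_eqI) (simp add: coeff_sum)
    finally show "(\<Sum>A | A \<subseteq> {..<N} \<and> card A = k. monom ((- 1) ^ card A * (\<Prod>i\<in>A. q i)) (N - card A)) =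
       monom ((- 1) ^ k * poly_eval q (elem_sym N k)) (N - k)"
      by (simp add: poly_eval_elem_sym sum_distrib_left)
  qed
  finally show ?thesis .
qed

lemma coeff_prod_linear_factors:
  fixes q :: "nat \<Rightarrow> 'a::comm_ring_1"
  assumes "k \<le> N"
  shows "coeff (\<Prod>i<N. [:- q i, 1:]) (N - k) = (- 1) ^ k * poly_eval q (elem_sym N k)"
proof -
  have "coeff (\<Prod>i<N. [:- q i, 1:]) (N - k) =
      (\<Sum>l\<le>N. if l = k then (- 1) ^ l * poly_eval q (elem_sym N l) else 0)"
    unfolding prod_linear_factors coeff_sum using assms by (intro sum.cong) auto
  then show ?thesis using assms by simp
qed

lemma poly_eval_elem_sym_delete:
  assumes "j < N"
  shows "poly_eval (r(j := 0)) (elem_sym N k) = (\<Sum>A | A \<subseteq> {..<N} - {j} \<and> card A = k. \<Prod>i\<in>A. r i)"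
  unfolding poly_eval_elem_sym
proof (rule sum.mono_neutral_cong_right)
  show "\<forall>A\<in>{A. A \<subseteq> {..<N} \<and> card A = k} - {A. A \<subseteq> {..<N} - {j} \<and> card A = k}. prod (r(j := 0)) A = 0"
  proof
    fix A assume "A \<in> {A. A \<subseteq> {..<N} \<and> card A = k} - {A. A \<subseteq> {..<N} - {j} \<and> card A = k}"
    then have "A \<subseteq> {..<N}" "j \<in> A" by auto
    moreover from this have "finite A" using finite_subset by blast
    ultimately show "prod (r(j := 0)) A = 0" by (intro prod_zero) auto
  qed
qed (auto intro!: prod.cong)

lemma poly_eval_elem_sym_Suc:
  assumes "j < N"
  shows "poly_eval r (elem_sym N (Suc k)) =
    poly_eval (r(j := 0)) (elem_sym N (Suc k)) + r j * poly_eval (r(j := 0)) (elem_sym N k)"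
proof -
  let ?V = "{..<N} - {j}"
  have fin: "finite {A. A \<subseteq> V \<and> card A = l}" if "finite V" for V :: "nat set" and l
    using that by simp
  have finA: "A \<subseteq> ?V \<Longrightarrow> finite A" for A using finite_subset by blast
  have "{A. A \<subseteq> {..<N} \<and> card A = Suc k} = {A. A \<subseteq> ?V \<and> card A = Suc k} \<union> insert j ` {A. A \<subseteq> ?V \<and> card A = k}"
  proof (rule subset_antisym; rule subsetI)
    fix A assume A: "A \<in> {A. A \<subseteq> {..<N} \<and> card A = Suc k}"
    show "A \<in> {A. A \<subseteq> ?V \<and> card A = Suc k} \<union> insert j ` {A. A \<subseteq> ?V \<and> card A = k}"
    proof (cases "j \<in> A")
      case True
      then have "A = insert j (A - {j})" "A - {j} \<subseteq> ?V" "card (A - {j}) = k"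
        using A by auto
      then show ?thesis by blast
    qed (use A in auto)
  next
    fix A assume "A \<in> {A. A \<subseteq> ?V \<and> card A = Suc k} \<union> insert j ` {A. A \<subseteq> ?V \<and> card A = k}"
    then show "A \<in> {A. A \<subseteq> {..<N} \<and> card A = Suc k}"
    proof
      assume "A \<in> insert j ` {A. A \<subseteq> ?V \<and> card A = k}"
      then obtain B where "A = insert j B" "B \<subseteq> ?V" "card B = k" by blast
      moreover from this have "j \<notin> B" by blast
      ultimately show ?thesis using assms finA[of B] by auto
    qed auto
  qed
  then have "poly_eval r (elem_sym N (Suc k)) =
      (\<Sum>A | A \<subseteq> ?V \<and> card A = Suc k. \<Prod>i\<in>A. r i) + (\<Sum>A\<in>insert j ` {A. A \<subseteq> ?V \<and> card A = k}. \<Prod>i\<in>A. r i)"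
    unfolding poly_eval_elem_sym by (simp only:, intro sum.union_disjoint) (auto simp: fin)
  also have "(\<Sum>A\<in>insert j ` {A. A \<subseteq> ?V \<and> card A = k}. \<Prod>i\<in>A. r i) = (\<Sum>A | A \<subseteq> ?V \<and> card A = k. r j * (\<Prod>i\<in>A. r i))"
  proof (subst sum.reindex)
    show "inj_on (insert j) {A. A \<subseteq> ?V \<and> card A = k}" by (rule inj_onI) blast
    show "sum ((\<lambda>A. \<Prod>i\<in>A. r i) \<circ> insert j) {A. A \<subseteq> ?V \<and> card A = k} = (\<Sum>A | A \<subseteq> ?V \<and> card A = k. r j * (\<Prod>i\<in>A. r i))"
    proof (intro sum.cong refl)
      fix A assume A: "A \<in> {A. A \<subseteq> ?V \<and> card A = k}"
      then have "finite A" "j \<notin> A" using finA by auto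
      then show "((\<lambda>A. \<Prod>i\<in>A. r i) \<circ> insert j) A = r j * (\<Prod>i\<in>A. r i)" by simp
    qed
  qed
  finally show ?thesis
    by (simp add: poly_eval_elem_sym_delete[OF assms] sum_distrib_left)
qed

text \<open>Each \<open>k\<close>-subset is avoided by N - k indices. For the roots this takes the
  place of Newton's identities.\<close>

lemma sum_poly_eval_elem_sym_delete:
  "(\<Sum>j<N. poly_eval (r(j := 0)) (elem_sym N k)) = of_nat (N - k) * poly_eval r (elem_sym N k)"
proof -
  let ?S = "{A. A \<subseteq> {..<N} \<and> card A = k}"
  have "(\<Sum>j<N. poly_eval (r(j := 0)) (elem_sym N k)) = (\<Sum>j<N. \<Sum>A\<in>?S. if j \<in> A then 0 else \<Prod>i\<in>A. r i)"
  proof (intro sum.cong refl)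
    fix j assume "j \<in> {..<N}"
    then have "poly_eval (r(j := 0)) (elem_sym N k) = (\<Sum>A | A \<subseteq> {..<N} - {j} \<and> card A = k. \<Prod>i\<in>A. r i)"
      by (intro poly_eval_elem_sym_delete) simp
    also have "\<dots> = (\<Sum>A\<in>?S. if j \<in> A then 0 else \<Prod>i\<in>A. r i)"
      by (rule sum.mono_neutral_cong_left) auto
    finally show "poly_eval (r(j := 0)) (elem_sym N k) = (\<Sum>A\<in>?S. if j \<in> A then 0 else \<Prod>i\<in>A. r i)" .
  qed
  also have "\<dots> = (\<Sum>A\<in>?S. \<Sum>j<N. if j \<in> A then 0 else \<Prod>i\<in>A. r i)" by (rule sum.swap)
  also have "\<dots> = (\<Sum>A\<in>?S. of_nat (N - k) * (\<Prod>i\<in>A. r i))"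
  proof (intro sum.cong refl)
    fix A assume A: "A \<in> ?S"
    then have fA: "finite A" using finite_subset by blast
    have "(\<Sum>j<N. if j \<in> A then 0 else \<Prod>i\<in>A. r i) = (\<Sum>j\<in>{..<N} - A. \<Prod>i\<in>A. r i)"
      by (rule sum.mono_neutral_cong_right) auto
    also have "\<dots> = of_nat (N - k) * (\<Prod>i\<in>A. r i)"
      using A fA by (simp add: card_Diff_subset)
    finally show "(\<Sum>j<N. if j \<in> A then 0 else \<Prod>i\<in>A. r i) = of_nat (N - k) * (\<Prod>i\<in>A. r i)" .
  qed
  finally show ?thesis by (simp add: poly_eval_elem_sym sum_distrib_left)
qed

text \<open>Replacing the variable \<open>r j\<close> by \<open>0\<close> amounts to removing it from the alphabet.\<close>

lemma poly_eval_monomial_sym_add_largest: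
  assumes "is_partition \<mu>" "largest_part \<mu> < a"
  shows "poly_eval r (monomial_sym N (add_mset a \<mu>)) =
    (\<Sum>j<N. r j ^ a * poly_eval (r(j := 0)) (monomial_sym N \<mu>))"
proof -
  have a: "a \<noteq> 0" "a \<notin># \<mu>" using assms largest_part_ge[of a \<mu>] by auto
  define G where "G = (\<lambda>j. {g. Poly_Mapping.keys g \<subseteq> {..<N} - {j} \<and> exponents g = \<mu>})"
  have finG: "finite (G j)" for j
    unfolding G_def by (rule finite_subset[OF _ finite_monomials_with_exponents[of N \<mu>]]) auto
  have eval: "poly_eval (r(j := 0)) (monomial_sym N \<mu>) = (\<Sum>g\<in>G j. monomial_eval r g)" for j
    unfolding poly_eval_monomial_sym
  proof (rule sum.mono_neutral_cong_right)
    show "\<forall>g\<in>{a. Poly_Mapping.keys a \<subseteq> {..<N} \<and> exponents a = \<mu>} - G j. monomial_eval (r(j := 0)) g = 0"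
    proof
      fix g assume "g \<in> {a. Poly_Mapping.keys a \<subseteq> {..<N} \<and> exponents a = \<mu>} - G j"
      then have "j \<in> Poly_Mapping.keys g" unfolding G_def by auto
      then show "monomial_eval (r(j := 0)) g = 0"
        unfolding monomial_eval_def by (intro prod_zero bexI[of _ j]) (auto simp: in_keys_iff zero_power)
    qed
  qed (auto simp: G_def finite_monomials_with_exponents monomial_eval_def intro!: prod.cong)
  have notin: "j \<notin> Poly_Mapping.keys g" if "g \<in> G j" for g j using that by (auto simp: G_def)
  \<comment> \<open>As \<open>a\<close> exceeds all parts of \<mu>, exactly one variable carries it,
    so the pair (j, g) can be recovered from the combined exponent vector.\<close>
  have lookup_lt: "Poly_Mapping.lookup g i \<noteq> a" if "g \<in> G j" for g j i
  proof
    assume *: "Poly_Mapping.lookup g i = a"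
    then have "i \<in> Poly_Mapping.keys g" using a by (simp add: in_keys_iff)
    then have "a \<in># exponents g" using * by (auto simp: exponents_def)
    then show False using that a by (simp add: G_def)
  qed
  have "(\<Sum>j<N. r j ^ a * poly_eval (r(j := 0)) (monomial_sym N \<mu>)) = (\<Sum>j<N. \<Sum>g\<in>G j. r j ^ a * monomial_eval r g)"
    by (simp add: eval sum_distrib_left)
  also have "\<dots> = (\<Sum>(j, g)\<in>Sigma {..<N} G. r j ^ a * monomial_eval r g)"
    using finG by (subst sum.Sigma) auto
  also have "\<dots> = (\<Sum>x\<in>Sigma {..<N} G. monomial_eval r ((\<lambda>(j, g). g + Poly_Mapping.single j a) x))"
    by (intro sum.cong) (auto simp: monomial_eval_add monomial_eval_single mult.commute)
  also have "\<dots> = (\<Sum>f | Poly_Mapping.keys f \<subseteq> {..<N} \<and> exponents f = add_mset a \<mu>. monomial_eval r f)"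
  proof (rule sum.reindex_bij_betw)
    show "bij_betw (\<lambda>(j, g). g + Poly_Mapping.single j a) (Sigma {..<N} G)
        {f. Poly_Mapping.keys f \<subseteq> {..<N} \<and> exponents f = add_mset a \<mu>}"
      unfolding bij_betw_def
    proof
      show "inj_on (\<lambda>(j, g). g + Poly_Mapping.single j a) (Sigma {..<N} G)"
      proof (rule inj_onI, clarify)
        fix j g j' g' assume g: "g \<in> G j" "g' \<in> G j'" and eq: "g + Poly_Mapping.single j a = g' + Poly_Mapping.single j' a"
        have "j = j'"
        proof (rule ccontr)
          assume "j \<noteq> j'"
          then have "Poly_Mapping.lookup g' j = a"
            using arg_cong[OF eq, of "\<lambda>f. Poly_Mapping.lookup f j"] notin[OF g(1)]
            by (simp add: lookup_add lookup_single_not_eq in_keys_iff)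
          then show False using lookup_lt[OF g(2)] by simp
        qed
        then show "j = j' \<and> g = g'" using eq by simp
      qed
      show "(\<lambda>(j, g). g + Poly_Mapping.single j a) ` Sigma {..<N} G =
        {f. Poly_Mapping.keys f \<subseteq> {..<N} \<and> exponents f = add_mset a \<mu>}"
      proof (rule subset_antisym)
        show "(\<lambda>(j, g). g + Poly_Mapping.single j a) ` Sigma {..<N} G \<subseteq>
          {f. Poly_Mapping.keys f \<subseteq> {..<N} \<and> exponents f = add_mset a \<mu>}"
        proof clarify
          fix j g assume j: "j < N" and g: "g \<in> G j"
          have "exponents g = \<mu>" "Poly_Mapping.keys g \<subseteq> {..<N}" using g by (auto simp: G_def)
          then show "Poly_Mapping.keys (g + Poly_Mapping.single j a) \<subseteq> {..<N} \<and>
              exponents (g + Poly_Mapping.single j a) = add_mset a \<mu>"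
            using exponents_add_single[OF notin[OF g], of a] a j by (auto simp: keys_add_nat add_part_def)
        qed
        show "{f. Poly_Mapping.keys f \<subseteq> {..<N} \<and> exponents f = add_mset a \<mu>} \<subseteq>
          (\<lambda>(j, g). g + Poly_Mapping.single j a) ` Sigma {..<N} G"
        proof clarify
          fix f assume f: "Poly_Mapping.keys f \<subseteq> {..<N}" "exponents f = add_mset a \<mu>"
          then have "a \<in># exponents f" by simp
          then obtain j where j: "j \<in> Poly_Mapping.keys f" "Poly_Mapping.lookup f j = a"
            by (auto simp: exponents_def)
          define g where "g = f - Poly_Mapping.single j a"
          have fg: "f = g + Poly_Mapping.single j a"
            by (rule poly_mapping_eqI) (auto simp: g_def j lookup_add lookup_minus lookup_single when_def)
          have jg: "j \<notin> Poly_Mapping.keys g" by (simp add: g_def in_keys_iff lookup_minus j)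
          have "exponents g = \<mu>"
            using f(2) exponents_add_single[OF jg, of a] a unfolding fg[symmetric] by (simp add: add_part_def)
          moreover have "Poly_Mapping.keys g \<subseteq> Poly_Mapping.keys f"
            by (subst fg) (simp add: keys_add_nat)
          then have "Poly_Mapping.keys g \<subseteq> {..<N} - {j}"
            using f(1) jg by auto
          ultimately have "g \<in> G j" by (simp add: G_def)
          moreover have "j < N" using j f by auto
          ultimately show "f \<in> (\<lambda>(j, g). g + Poly_Mapping.single j a) ` Sigma {..<N} G"
            using fg by (auto intro!: image_eqI[of _ _ "(j, g)"])
        qed
      qed
    qed
  qed
  finally show ?thesis unfolding poly_eval_monomial_sym ..
qed

subsection \<open>Roots of a trinomial\<close>

text \<open>Equality with the product lists the roots with multiplicity, so that Vieta also applies
  to multiple roots, as for S = 0.\<close>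

definition roots_of_trinomial :: "nat \<Rightarrow> complex \<Rightarrow> (nat \<Rightarrow> complex) \<Rightarrow> bool" where
  "roots_of_trinomial p S r \<longleftrightarrow> (\<Prod>i<p. [:- r i, 1:]) = monom 1 p - monom 1 (p - 1) - [:S:]"

lemma ex_roots_of_trinomial:
  assumes "p \<ge> 2"
  shows "\<exists>r. roots_of_trinomial p S r"
proof -
  let ?f = "monom 1 p - monom 1 (p - 1) - [:S:] :: complex poly"
  define g where "g = monom 1 (p - 1) + [:S:]"
  have deg: "degree g < p"
    unfolding g_def using assms by (intro degree_add_less) (auto simp: degree_monom_eq)
  have f: "?f = monom 1 p + - g" by (simp add: g_def)
  have deg': "degree (- g) < degree (monom (1 :: complex) p)"
    using deg by (simp add: degree_monom_eq)
  have d: "degree ?f = p" unfolding f using degree_add_eq_left[OF deg'] by (simp add: degree_monom_eq)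
  have lc: "lead_coeff ?f = 1"
    unfolding f degree_add_eq_left[OF deg'] using deg by (simp add: degree_monom_eq coeff_eq_0)
  obtain r where "smult (lead_coeff ?f) (\<Prod>i<degree ?f. [:- r i, 1:]) = ?f"
    by (rule complex_poly_decompose')
  then have "smult 1 (\<Prod>i<p. [:- r i, 1:]) = ?f" unfolding lc unfolding d .
  then show ?thesis
    unfolding roots_of_trinomial_def by (intro exI[of _ r]) simp
qed

context
  fixes p :: nat and S :: complex and r :: "nat \<Rightarrow> complex"
  assumes p: "p \<ge> 2" and r: "roots_of_trinomial p S r"
begin

lemma elem_sym_roots:
  assumes "k \<le> p"
  shows "(- 1) ^ k * poly_eval r (elem_sym p k) = coeff (monom 1 p - monom 1 (p - 1) - [:S:]) (p - k)"
  using coeff_prod_linear_factors[OF assms, of r] r unfolding roots_of_trinomial_def by simp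

lemma elem_sym_roots_1: "poly_eval r (elem_sym p (Suc 0)) = 1"
  using elem_sym_roots[of 1] p by (auto simp: coeff_pCons split: nat.splits if_splits)

lemma elem_sym_roots_eq_0: "k \<noteq> 0 \<Longrightarrow> k \<noteq> 1 \<Longrightarrow> k \<noteq> p \<Longrightarrow> poly_eval r (elem_sym p k) = 0"
proof (cases "k \<le> p")
  case True
  assume "k \<noteq> 0" "k \<noteq> 1" "k \<noteq> p"
  then show ?thesis using elem_sym_roots[OF True] True
    by (auto simp: coeff_pCons split: nat.splits if_splits)
next
  case False
  then have "{A. A \<subseteq> {..<p} \<and> card A = k} = {}"
    using card_mono[of "{..<p}"] by fastforce
  then show ?thesis by (simp only: poly_eval_elem_sym sum.empty)
qed

lemma elem_sym_roots_p: "poly_eval r (elem_sym p p) = (- 1) ^ (p - 1) * S"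
proof -
  have "(- 1) ^ p * poly_eval r (elem_sym p p) = - S"
    using elem_sym_roots[of p] p by simp
  moreover have "(- 1 :: complex) ^ p = - ((- 1) ^ (p - 1))"
    using p by (cases p) auto
  ultimately have "(- 1) ^ (p - 1) * ((- 1) ^ (p - 1) * poly_eval r (elem_sym p p)) = (- 1) ^ (p - 1) * S"
    by simp
  then show ?thesis by (simp flip: mult.assoc power_add)
qed

lemma root_power_p:
  assumes "j < p"
  shows "r j ^ p = r j ^ (p - 1) + S"
proof -
  have "poly (\<Prod>i<p. [:- r i, 1:]) (r j) = 0"
    using assms by (auto simp: poly_prod)
  then have "poly (monom 1 p - monom 1 (p - 1) - [:S:]) (r j) = 0"
    using r by (simp only: roots_of_trinomial_def)
  then have "r j ^ p - r j ^ (p - 1) - S = 0" by (simp add: poly_monom)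
  then show ?thesis by (simp add: algebra_simps)
qed

text \<open>Splitting e_(k+1) of all roots by whether r_j occurs gives 0 for 1 < k + 1 < p. Hence
  each step multiplies by - r_j, starting from e_1 = 1 - r_j.\<close>

lemma elem_sym_roots_delete:
  assumes "j < p" "k \<ge> 1" "k < p"
  shows "poly_eval (r(j := 0)) (elem_sym p k) = (- 1) ^ k * ((r j - 1) * r j ^ (k - 1))"
  using assms(2,3)
proof (induction k rule: dec_induct)
  case base
  have "poly_eval (r(j := 0)) (elem_sym p (Suc 0)) = 1 - r j"
    using poly_eval_elem_sym_Suc[OF assms(1), of r 0] elem_sym_roots_1 by (simp add: eq_diff_eq)
  then show ?case by (simp add: fun_upd_def)
next
  case (step k)
  then have "poly_eval r (elem_sym p (Suc k)) = 0" using elem_sym_roots_eq_0 by auto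
  then have "poly_eval (r(j := 0)) (elem_sym p (Suc k)) = - r j * poly_eval (r(j := 0)) (elem_sym p k)"
    using poly_eval_elem_sym_Suc[OF assms(1), of r k] by (simp add: add_eq_0_iff)
  also have "\<dots> = (- 1) ^ Suc k * ((r j - 1) * (r j * r j ^ (k - 1)))"
    using step by (simp add: fun_upd_def)
  also have "r j * r j ^ (k - 1) = r j ^ k" using step by (simp flip: power_Suc)
  finally show ?case by simp
qed

lemma elem_sym_roots_delete_eq_0:
  assumes "j < p" "k \<ge> p"
  shows "poly_eval (r(j := 0)) (elem_sym p k) = 0"
proof -
  have "card A \<noteq> k" if "A \<subseteq> {..<p} - {j}" for A
    using card_mono[OF _ that] assms by simp
  then have "{A. A \<subseteq> {..<p} - {j} \<and> card A = k} = {}" by blast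
  then show ?thesis by (simp only: poly_eval_elem_sym_delete[OF assms(1)] sum.empty)
qed

text \<open>The sum over j of e_k without r_j is (p - k) e_k. Inserting the closed form of e_k
  without r_j, the case k = 1 gives the first power sum, and 1 < k < p gives equality of consecutive
  ones.\<close>

lemma power_sum_roots_less:
  assumes "m \<ge> 1" "m < p"
  shows "(\<Sum>j<p. r j ^ m) = 1"
  using assms
proof (induction m rule: dec_induct)
  case base
  have "(\<Sum>j<p. poly_eval (r(j := 0)) (elem_sym p 1)) = (\<Sum>j<p. 1 - r j)"
    using p by (intro sum.cong) (auto simp: elem_sym_roots_delete[of _ 1, simplified])
  then show ?case
    using sum_poly_eval_elem_sym_delete[where N = p and r = r and k = 1] p elem_sym_roots_1
    by (simp add: sum_subtractf of_nat_diff)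
next
  case (step m)
  have "(\<Sum>j<p. poly_eval (r(j := 0)) (elem_sym p (Suc m))) = 0"
    using sum_poly_eval_elem_sym_delete[where N = p and r = r and k = "Suc m"] elem_sym_roots_eq_0[of "Suc m"] step by simp
  moreover have "(\<Sum>j<p. poly_eval (r(j := 0)) (elem_sym p (Suc m))) = (\<Sum>j<p. (- 1) ^ Suc m * (r j ^ Suc m - r j ^ m))"
    using step by (intro sum.cong) (auto simp: elem_sym_roots_delete algebra_simps)
  ultimately have "(- 1) ^ Suc m * ((\<Sum>j<p. r j ^ Suc m) - (\<Sum>j<p. r j ^ m)) = 0"
    by (simp only: sum_distrib_left[symmetric] sum_subtractf)
  then show ?case using step by simp
qed

lemma power_sum_roots_rec:
  "(\<Sum>j<p. r j ^ (m + p)) = (\<Sum>j<p. r j ^ (m + p - 1)) + S * (\<Sum>j<p. r j ^ m)"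
proof -
  have "r j ^ (m + p) = r j ^ (m + p - 1) + S * r j ^ m" if "j < p" for j
  proof -
    have "r j ^ (m + p) = r j ^ m * (r j ^ (p - 1) + S)" using root_power_p[OF that] by (simp add: power_add)
    also have "\<dots> = r j ^ (m + p - 1) + S * r j ^ m" using p by (simp add: algebra_simps flip: power_add)
    finally show ?thesis .
  qed
  then show ?thesis by (simp add: sum.distrib sum_distrib_left)
qed

end

text \<open>
  The power sum of degree \<open>m\<close> of the roots of \<open>x\<^sup>p - x\<^sup>p\<^sup>-\<^sup>1 - S\<close>, as a polynomial in \<open>S\<close>: it is \<open>1\<close> for
  \<open>0 < m < p\<close> by Newton's identities, and a root satisfies \<open>r\<^sup>m = r\<^sup>m\<^sup>-\<^sup>1 + S r\<^sup>m\<^sup>-\<^sup>p\<close>.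
\<close>

function power_sum_poly :: "nat \<Rightarrow> nat \<Rightarrow> complex poly" where
  "power_sum_poly p m =
     (if p = 0 \<or> m < p then (if m = 0 then [:of_nat p:] else 1)
      else power_sum_poly p (m - 1) + [:0, 1:] * power_sum_poly p (m - p))"
  by auto
text \<open>The test \<open>p = 0\<close> in the equation is what makes m - p smaller than m in the
  recursive branch.\<close>

termination by (relation "measure snd") auto

declare power_sum_poly.simps [simp del]

lemma power_sum_poly_add:
  "p \<ge> 1 \<Longrightarrow> power_sum_poly p (m + p) = power_sum_poly p (m + p - 1) + [:0, 1:] * power_sum_poly p m"
  by (subst power_sum_poly.simps) simp

lemma poly_power_sum_poly:
  assumes "p \<ge> 2" "roots_of_trinomial p S r"
  shows "poly (power_sum_poly p m) S = (\<Sum>j<p. r j ^ m)"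
proof (induction m rule: less_induct)
  case (less m)
  show ?case
  proof (cases "m < p")
    case True
    then show ?thesis using power_sum_roots_less[OF assms, of m]
      by (subst power_sum_poly.simps) auto
  next
    case False
    then obtain m' where m: "m = m' + p" by (metis add.commute le_Suc_ex not_less)
    show ?thesis
      using power_sum_roots_rec[OF assms, of m'] less[of "m' + p - 1"] less[of m'] assms(1)
      unfolding m by (simp add: power_sum_poly_add)
  qed
qed

text \<open>
  The coefficient of \<open>S\<^sup>n\<close> in the power sum of degree \<open>p n + k\<close>, except that for \<open>n = k = 0\<close> the value
  is \<open>1\<close> and not \<open>p\<close>; this is what makes the recurrence for \<open>\<beta>\<close> and \<open>\<beta>\<^sup>0\<^sup>,\<^sup>0 = 1\<close> hold.
\<close>

fun power_sum_coeff :: "nat \<Rightarrow> nat \<Rightarrow> nat \<Rightarrow> int" where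
  "power_sum_coeff p 0 k = 1"
| "power_sum_coeff p (Suc n) 0 = int p"
| "power_sum_coeff p (Suc n) (Suc k) = power_sum_coeff p (Suc n) k + power_sum_coeff p n (Suc k)"

text \<open>The degree in S is at most m / p, since each factor S in the recursion costs p.\<close>

lemma coeff_power_sum_poly_eq_0:
  assumes "p \<ge> 1" "m < p * N"
  shows "coeff (power_sum_poly p m) N = 0"
  using assms(2)
proof (induction m arbitrary: N rule: less_induct)
  case (less m)
  then obtain N' where N: "N = Suc N'" by (cases N) auto
  show ?case
  proof (cases "m < p")
    case True
    then show ?thesis by (subst power_sum_poly.simps) (simp add: N)
  next
    case False
    then obtain m' where m: "m = m' + p" by (metis add.commute le_Suc_ex not_less)
    show ?thesis
      using less.IH[of "m' + p - 1" N] less.IH[of m' N'] less.prems assms(1)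
      unfolding m N by (simp add: power_sum_poly_add)
  qed
qed

text \<open>At S = 0 the roots are 1 and p - 1 times 0.\<close>

lemma coeff_0_power_sum_poly:
  assumes "p \<ge> 2" "m \<ge> 1"
  shows "coeff (power_sum_poly p m) 0 = 1"
  using assms(2)
proof (induction m rule: less_induct)
  case (less m)
  show ?case
  proof (cases "m < p")
    case True
    then show ?thesis using less.prems by (subst power_sum_poly.simps) simp
  next
    case False
    then obtain m' where m: "m = m' + p" by (metis add.commute le_Suc_ex not_less)
    show ?thesis
      using less.IH[of "m' + p - 1"] assms(1)
      unfolding m by (simp add: power_sum_poly_add)
  qed
qed

text \<open>For degree reasons only the term with the factor S reaches the top coefficient, so the
  value p of the zeroth power sum is passed on.\<close>

lemma coeff_power_sum_poly_p_mult:
  assumes "p \<ge> 1"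
  shows "coeff (power_sum_poly p (p * N)) N = of_nat p"
proof (induction N)
  case 0
  show ?case using assms by (subst power_sum_poly.simps) simp
next
  case (Suc N)
  have "coeff (power_sum_poly p (p * N + p - 1)) (Suc N) = 0"
    using assms by (intro coeff_power_sum_poly_eq_0) auto
  then show ?case using power_sum_poly_add[OF assms, of "p * N"] Suc by (simp add: add.commute)
qed

text \<open>The excluded pair N = k = 0 is where \<open>power_sum_coeff\<close> is 1 although the
  zeroth power sum is p.\<close>

lemma coeff_power_sum_poly:
  assumes "p \<ge> 2" "N + k \<ge> 1"
  shows "coeff (power_sum_poly p (p * N + k)) N = of_int (power_sum_coeff p N k)"
  using assms
proof (induction p N k rule: power_sum_coeff.induct)
  case (1 p k)
  then show ?case using coeff_0_power_sum_poly[of p k] by simp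
next
  case (2 p n)
  then show ?case using coeff_power_sum_poly_p_mult[of p "Suc n"] by simp
next
  case (3 p n k)
  have eq: "p * Suc n + Suc k = (p * n + Suc k) + p" "p * n + Suc k + p - 1 = p * Suc n + k" by auto
  have "p \<ge> 1" using 3(3) by simp
  then have "power_sum_poly p (p * Suc n + Suc k) = power_sum_poly p (p * Suc n + k) + [:0, 1:] * power_sum_poly p (p * n + Suc k)"
    using power_sum_poly_add[of p "p * n + Suc k"] by (simp only: eq)
  then show ?case using 3 by simp
qed

text \<open>The sum of (r - 1)^l r^b over the roots r, as a polynomial in S, by the binomial
  theorem.\<close>

definition shifted_power_sum_poly :: "nat \<Rightarrow> nat \<Rightarrow> nat \<Rightarrow> complex poly" where
  "shifted_power_sum_poly p l b =
     (\<Sum>i\<le>l. smult (of_nat (l choose i) * (- 1) ^ (l - i)) (power_sum_poly p (i + b)))"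

lemma poly_shifted_power_sum_poly:
  assumes "p \<ge> 2" "roots_of_trinomial p S r"
  shows "poly (shifted_power_sum_poly p l b) S = (\<Sum>j<p. (r j - 1) ^ l * r j ^ b)"
proof -
  have "(r j - 1) ^ l * r j ^ b = (\<Sum>i\<le>l. of_nat (l choose i) * (- 1) ^ (l - i) * r j ^ (i + b))" for j
    using binomial_ring[of "r j" "- 1" l] by (simp add: sum_distrib_left power_add mult_ac)
  then have "(\<Sum>j<p. (r j - 1) ^ l * r j ^ b) = (\<Sum>i\<le>l. \<Sum>j<p. of_nat (l choose i) * (- 1) ^ (l - i) * r j ^ (i + b))"
    by (simp add: sum.swap[of _ "{..l}"])
  then show ?thesis
    by (simp add: shifted_power_sum_poly_def poly_sum poly_power_sum_poly[OF assms] sum_distrib_left)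
qed

text \<open>At S = 0 the roots are 0 and 1, and (r - 1)^l r^b vanishes at both. In coefficients:
  every power sum involved has constant term 1, which leaves (1 - 1)^l.\<close>

lemma coeff_0_shifted_power_sum_poly:
  assumes "p \<ge> 2" "l \<ge> 1" "b \<ge> 1"
  shows "coeff (shifted_power_sum_poly p l b) 0 = 0"
proof -
  have "coeff (shifted_power_sum_poly p l b) 0 = (\<Sum>i\<le>l. of_nat (l choose i) * 1 ^ i * (- 1) ^ (l - i))"
    using assms by (simp add: shifted_power_sum_poly_def coeff_sum coeff_0_power_sum_poly)
  also have "\<dots> = (1 + - 1) ^ l" by (rule binomial_ring[symmetric])
  finally show ?thesis using assms by simp
qed

subsection \<open>The explicit formula\<close>

text \<open>
  If the roots other than \<open>r\<close> form the alphabet, then \<open>e\<^sub>i = (-1)\<^sup>i (r - 1) r\<^sup>i\<^sup>-\<^sup>1\<close> for \<open>0 < i < p\<close> and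
  \<open>e\<^sub>i = 0\<close> for \<open>i \<ge> p\<close>. Hence, up to the sign \<open>(-1)\<^sup>|\<^sup>\<mu>\<^sup>|\<close>, this is the coefficient of
  \<open>(r - 1)\<^sup>l r\<^sup>|\<^sup>\<mu>\<^sup>|\<^sup>-\<^sup>l\<close> in the value of \<open>m\<^sub>\<mu>\<close>.
\<close>

definition bounded_coeff_sum :: "nat \<Rightarrow> nat multiset \<Rightarrow> nat \<Rightarrow> int" where
  "bounded_coeff_sum p \<mu> l =
     (\<Sum>\<nu> | \<nu> \<in> partitions_of (sum_mset \<mu>) \<and> largest_part \<nu> < p \<and> size \<nu> = l. monomial_elem_coeff \<mu> \<nu>)"

text \<open>For |\<mu>| <= pn + k and \<mu>_1 < n + k this is, up to the sign (-1)^((p-1)n) that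
  stems from e_p, the coefficient of S^n in the sum of r^a m_\<mu>(other roots) over the roots r,
  where a = pn + k - |\<mu>|. The index l belongs to (r - 1)^l r^(pn+k-l).\<close>

definition beta_formula :: "nat \<Rightarrow> nat \<Rightarrow> nat \<Rightarrow> nat multiset \<Rightarrow> int" where
  "beta_formula p n k \<mu> = (- 1) ^ ((p - 1) * n + sum_mset \<mu>) *
     (\<Sum>l\<le>n. bounded_coeff_sum p \<mu> l * power_sum_coeff p (n - l) k)"

lemma sum_mset_le_size_mult:
  fixes \<mu> :: "nat multiset"
  shows "(\<And>x. x \<in># \<mu> \<Longrightarrow> x \<le> b) \<Longrightarrow> sum_mset \<mu> \<le> b * size \<mu>"
proof (induction \<mu>)
  case (add x \<mu>)
  then have "x \<le> b" "sum_mset \<mu> \<le> b * size \<mu>" by auto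
  then show ?case by simp
qed simp

text \<open>Some \<nu> contributes. The support bound for m_\<mu> gives l <= \<mu>_1; the same bound
  with the indices exchanged limits the number of parts of \<mu> by \<nu>_1 < p; the other two
  compare the degree of \<nu> with its number of parts.\<close>

lemma bounded_coeff_sum_nonzero:
  assumes "is_partition \<mu>" "bounded_coeff_sum p \<mu> l \<noteq> 0"
  shows "l \<le> largest_part \<mu>" "l \<le> sum_mset \<mu>" "sum_mset \<mu> \<le> (p - 1) * l" "size \<mu> \<le> p - 1"
proof -
  from assms(2) obtain \<nu> where \<nu>: "\<nu> \<in> partitions_of (sum_mset \<mu>)" "largest_part \<nu> < p" "size \<nu> = l"
    and c: "monomial_elem_coeff \<mu> \<nu> \<noteq> 0"
    unfolding bounded_coeff_sum_def by (blast elim: sum.not_neutral_contains_not_neutral)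
  have part: "is_partition \<nu>" "sum_mset \<nu> = sum_mset \<mu>" using \<nu>(1) by (auto simp: partitions_of_def)
  show "l \<le> largest_part \<mu>" using monomial_elem_coeff_nonzero(2)[OF assms(1) c] \<nu>(3) by simp
  show "l \<le> sum_mset \<mu>" using size_le_sum_mset[OF part(1)] part(2) \<nu>(3) by simp
  have "x \<le> p - 1" if "x \<in># \<nu>" for x using largest_part_ge[OF that] \<nu>(2) by simp
  then show "sum_mset \<mu> \<le> (p - 1) * l" using sum_mset_le_size_mult[of \<nu> "p - 1"] part(2) \<nu>(3) by simp
  have "monomial_elem_coeff \<nu> \<mu> \<noteq> 0"
    using c monomial_elem_coeff_commute[of \<mu> "sum_mset \<mu>" \<nu>] \<nu>(1) assms(1) by (simp add: partitions_of_def)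
  from monomial_elem_coeff_nonzero(2)[OF part(1) this] show "size \<mu> \<le> p - 1" using \<nu>(2) by simp
qed

lemma poly_eval_monomial_sym_expand:
  assumes "\<mu> \<in> partitions_of d"
  shows "poly_eval q (monomial_sym N \<mu>) =
    (\<Sum>\<nu>\<in>partitions_of d. of_int (monomial_elem_coeff \<mu> \<nu>) * (\<Prod>i\<in>#\<nu>. poly_eval q (elem_sym N i)))"
  by (simp add: monomial_sym_eq_sum_elem_sym_part[OF assms] poly_eval_sum poly_eval_mult poly_eval_elem_sym_part)

lemma prod_mset_eq_0: "x \<in># \<mu> \<Longrightarrow> f x = 0 \<Longrightarrow> (\<Prod>x\<in>#\<mu>. f x) = (0 :: 'a::comm_semiring_1)"
  by (metis image_mset_add_mset mult_zero_left mset_add prod_mset.add_mset)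

text \<open>At the roots other than r_j, e_\<nu> vanishes if a part reaches p and otherwise depends
  only on the degree and the number of parts; grouping by the latter produces
  \<open>bounded_coeff_sum\<close>.\<close>

lemma poly_eval_monomial_sym_roots_delete:
  assumes "p \<ge> 2" "roots_of_trinomial p S r" "j < p" "is_partition \<mu>"
  shows "poly_eval (r(j := 0)) (monomial_sym p \<mu>) = (- 1) ^ sum_mset \<mu> *
    (\<Sum>l\<le>sum_mset \<mu>. of_int (bounded_coeff_sum p \<mu> l) * ((r j - 1) ^ l * r j ^ (sum_mset \<mu> - l)))"
proof -
  let ?d = "sum_mset \<mu>" and ?q = "r(j := 0)"
  let ?P = "{\<nu> \<in> partitions_of ?d. largest_part \<nu> < p}"
  have small: "(\<Prod>i\<in>#\<nu>. poly_eval ?q (elem_sym p i)) = (- 1) ^ sum_mset \<nu> * ((r j - 1) ^ size \<nu> * r j ^ (sum_mset \<nu> - size \<nu>))"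
    if "is_partition \<nu>" "largest_part \<nu> < p" for \<nu>
    using that
  proof (induction \<nu>)
    case (add x \<nu>)
    have x: "x \<ge> 1" "x < p" and \<nu>: "is_partition \<nu>" "largest_part \<nu> < p"
      using add.prems by (auto simp: is_partition_def largest_part_def Suc_le_eq)
    have "r j ^ (x + sum_mset \<nu> - Suc (size \<nu>)) = r j ^ (x - 1) * r j ^ (sum_mset \<nu> - size \<nu>)"
      using x size_le_sum_mset[OF \<nu>(1)] by (simp flip: power_add)
    then show ?case using add.IH[OF \<nu>] elem_sym_roots_delete[OF assms(1,2,3) x]
      by (simp add: fun_upd_def power_add mult_ac)
  qed simp
  have big: "(\<Prod>i\<in>#\<nu>. poly_eval ?q (elem_sym p i)) = 0" if \<nu>: "\<not> largest_part \<nu> < p" for \<nu>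
  proof -
    obtain x where "x \<in># \<nu>" "x \<ge> p" using \<nu> assms(1) by (auto simp: largest_part_def not_less Max_ge_iff)
    then show ?thesis by (intro prod_mset_eq_0 elem_sym_roots_delete_eq_0[OF assms(1,2,3)])
  qed
  have "poly_eval ?q (monomial_sym p \<mu>) = (\<Sum>\<nu>\<in>partitions_of ?d. of_int (monomial_elem_coeff \<mu> \<nu>) * (\<Prod>i\<in>#\<nu>. poly_eval ?q (elem_sym p i)))"
    using assms(4) by (intro poly_eval_monomial_sym_expand) (simp add: partitions_of_def)
  also have "\<dots> = (\<Sum>\<nu>\<in>?P. of_int (monomial_elem_coeff \<mu> \<nu>) * ((- 1) ^ ?d * ((r j - 1) ^ size \<nu> * r j ^ (?d - size \<nu>))))"
    using finite_partitions_of big small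
    by (intro sum.mono_neutral_cong_right) (auto simp: partitions_of_def)
  also have "\<dots> = (\<Sum>l\<le>?d. \<Sum>\<nu> | \<nu> \<in> ?P \<and> size \<nu> = l. of_int (monomial_elem_coeff \<mu> \<nu>) * ((- 1) ^ ?d * ((r j - 1) ^ size \<nu> * r j ^ (?d - size \<nu>))))"
  proof (rule sum.group[symmetric])
    show "size ` ?P \<subseteq> {..?d}"
    proof (rule image_subsetI)
      fix \<nu> assume "\<nu> \<in> ?P"
      then show "size \<nu> \<in> {..?d}" using size_le_sum_mset[of \<nu>] by (simp add: partitions_of_def)
    qed
  qed (simp_all add: finite_partitions_of)
  also have "\<dots> = (\<Sum>l\<le>?d. (- 1) ^ ?d * (of_int (bounded_coeff_sum p \<mu> l) * ((r j - 1) ^ l * r j ^ (?d - l))))"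
    unfolding bounded_coeff_sum_def
    by (intro sum.cong refl) (simp add: sum_distrib_right sum_distrib_left conj_assoc mult_ac)
  finally show ?thesis by (simp add: sum_distrib_left)
qed

lemma partitions_into_1_p:
  assumes "p \<ge> 2"
  shows "{\<nu> \<in> partitions_of d. set_mset \<nu> \<subseteq> {1, p}} = (\<lambda>m. ones_ps p m (d - p * m)) ` {..d div p}"
proof (rule subset_antisym; rule subsetI)
  fix \<nu> assume \<nu>: "\<nu> \<in> {\<nu> \<in> partitions_of d. set_mset \<nu> \<subseteq> {1, p}}"
  have eq: "\<nu> = ones_ps p (count \<nu> p) (count \<nu> 1)"
  proof (rule multiset_eqI)
    fix x show "count \<nu> x = count (ones_ps p (count \<nu> p) (count \<nu> 1)) x"
      using \<nu> assms by (cases "x \<in># \<nu>") (auto simp: ones_ps_def not_in_iff)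
  qed
  then have "sum_mset \<nu> = count \<nu> 1 + p * count \<nu> p"
    using ones_ps_in_partitions_of[of p "count \<nu> p" "count \<nu> 1"] assms by (simp add: partitions_of_def)
  then have "d = count \<nu> 1 + p * count \<nu> p" using \<nu> by (simp add: partitions_of_def)
  moreover from this have "count \<nu> p \<le> d div p" using assms by (simp add: less_eq_div_iff_mult_less_eq)
  ultimately show "\<nu> \<in> (\<lambda>m. ones_ps p m (d - p * m)) ` {..d div p}"
    using eq by (intro image_eqI[of _ _ "count \<nu> p"]) auto
next
  fix \<nu> assume "\<nu> \<in> (\<lambda>m. ones_ps p m (d - p * m)) ` {..d div p}"
  then obtain m where "m \<le> d div p" and \<nu>: "\<nu> = ones_ps p m (d - p * m)" by blast
  then have "p * m + (d - p * m) = d" using assms by (simp add: less_eq_div_iff_mult_less_eq mult.commute)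
  then show "\<nu> \<in> {\<nu> \<in> partitions_of d. set_mset \<nu> \<subseteq> {1, p}}"
    using ones_ps_in_partitions_of[of p m "d - p * m"] assms \<nu> by (auto simp: ones_ps_def split: if_splits)
qed

text \<open>Only the e_\<nu> with parts 1 and p survive. The factors e_1 = 1 leave no trace, but the
  degree recovers their number from m.\<close>

lemma poly_eval_monomial_sym_roots:
  assumes "p \<ge> 2" "roots_of_trinomial p S r" "\<mu> \<in> partitions_of d"
  shows "poly_eval r (monomial_sym p \<mu>) =
    (\<Sum>m\<le>d div p. of_int (monomial_elem_coeff \<mu> (ones_ps p m (d - p * m))) * ((- 1) ^ (p - 1) * S) ^ m)"
proof -
  have zero: "(\<Prod>i\<in>#\<nu>. poly_eval r (elem_sym p i)) = 0" if \<nu>: "is_partition \<nu>" "\<not> set_mset \<nu> \<subseteq> {1, p}" for \<nu>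
  proof -
    obtain x where x: "x \<in># \<nu>" "x \<noteq> 1" "x \<noteq> p" using \<nu>(2) by blast
    moreover have "x \<noteq> 0" using \<nu>(1) x(1) by (cases "x = 0") (auto simp: is_partition_def)
    ultimately show ?thesis by (intro prod_mset_eq_0 elem_sym_roots_eq_0[OF assms(1,2)])
  qed
  have inj: "inj_on (\<lambda>m. ones_ps p m (d - p * m)) {..d div p}"
  proof (rule inj_onI)
    fix m m' assume "ones_ps p m (d - p * m) = ones_ps p m' (d - p * m')"
    then have "count (ones_ps p m (d - p * m)) p = count (ones_ps p m' (d - p * m')) p" by simp
    then show "m = m'" using assms(1) by (simp add: ones_ps_def)
  qed
  have "poly_eval r (monomial_sym p \<mu>) = (\<Sum>\<nu>\<in>partitions_of d. of_int (monomial_elem_coeff \<mu> \<nu>) * (\<Prod>i\<in>#\<nu>. poly_eval r (elem_sym p i)))"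
    by (rule poly_eval_monomial_sym_expand[OF assms(3)])
  also have "\<dots> = (\<Sum>\<nu>\<in>{\<nu> \<in> partitions_of d. set_mset \<nu> \<subseteq> {1, p}}. of_int (monomial_elem_coeff \<mu> \<nu>) * (\<Prod>i\<in>#\<nu>. poly_eval r (elem_sym p i)))"
    using finite_partitions_of zero by (intro sum.mono_neutral_right) (auto simp: partitions_of_def)
  also have "\<dots> = (\<Sum>m\<le>d div p. of_int (monomial_elem_coeff \<mu> (ones_ps p m (d - p * m))) *
      (\<Prod>i\<in>#ones_ps p m (d - p * m). poly_eval r (elem_sym p i)))"
    unfolding partitions_into_1_p[OF assms(1)] sum.reindex[OF inj] by simp
  also have "\<dots> = (\<Sum>m\<le>d div p. of_int (monomial_elem_coeff \<mu> (ones_ps p m (d - p * m))) * ((- 1) ^ (p - 1) * S) ^ m)"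
    using elem_sym_roots_1[OF assms(1,2)] elem_sym_roots_p[OF assms(1,2)]
    by (simp add: ones_ps_def)
  finally show ?thesis .
qed

lemma alpha_add_part_eq_beta_formula:
  assumes p: "p \<ge> 2" and part: "is_partition \<mu>" and le: "sum_mset \<mu> \<le> p * n + k"
    and less: "largest_part \<mu> < n + k"
  shows "alpha p n k (add_part \<mu> (p * n + k - sum_mset \<mu>)) = beta_formula p n k \<mu>"
proof (cases "sum_mset \<mu> \<le> (p - 1) * n")
  \<comment> \<open>Both sides vanish: the formula because no l <= n has a nonzero
    \<open>bounded_coeff_sum\<close>, and \<alpha> because all parts are smaller than n + k, the
    number of parts of (1^k p^n).\<close>
  case False
  define a where "a = p * n + k - sum_mset \<mu>"
  have "bounded_coeff_sum p \<mu> l = 0" if "l \<le> n" for l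
  proof (rule ccontr)
    assume "bounded_coeff_sum p \<mu> l \<noteq> 0"
    from bounded_coeff_sum_nonzero(3)[OF part this] have "sum_mset \<mu> \<le> (p - 1) * n"
      using mult_le_mono2[OF that, of "p - 1"] by linarith
    then show False using False by simp
  qed
  then have "beta_formula p n k \<mu> = 0" by (simp add: beta_formula_def)
  moreover have "alpha p n k (add_part \<mu> a) = 0"
  proof (rule ccontr)
    assume "alpha p n k (add_part \<mu> a) \<noteq> 0"
    then have "add_part \<mu> a \<in> partitions_of (p * n + k)"
      and "monomial_elem_coeff (add_part \<mu> a) (ones_ps p n k) \<noteq> 0"
      using p by (auto simp: alpha_eq_monomial_elem_coeff split: if_splits)
    then have "size (ones_ps p n k) \<le> largest_part (add_part \<mu> a)"
      by (intro monomial_elem_coeff_nonzero(2)) (auto simp: partitions_of_def)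
    then have "n + k \<le> largest_part (add_part \<mu> a)" by (simp add: ones_ps_def)
    moreover have "p * n = (p - 1) * n + n" using p by (cases p) auto
    then have "a < n + k" using False le unfolding a_def by linarith
    then have "largest_part (add_part \<mu> a) < n + k"
      using less by (auto simp: add_part_def largest_part_def)
    ultimately show False by simp
  qed
  ultimately show ?thesis by (simp add: a_def)
next
  case True
  define d where "d = p * n + k"
  define a where "a = d - sum_mset \<mu>"
  define sg where "sg = ((- 1) ^ (p - 1) :: complex)"
  define \<mu>' where "\<mu>' = add_mset a \<mu>"
  have sum: "sum_mset \<mu> + a = d" using le by (simp add: a_def d_def)
  have "p * n = (p - 1) * n + n" using p by (cases p) auto
  then have a: "a \<ge> n + k" using True sum unfolding d_def by linarith
  then have a_gt: "largest_part \<mu> < a" using less by simp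
  have \<mu>': "\<mu>' \<in> partitions_of d" using part sum a_gt by (auto simp: \<mu>'_def partitions_of_def is_partition_def)
  \<comment> \<open>\<open>G l\<close> stands for the sum of (r - 1)^l r^(d-l) over the roots. By S
    = r^(p-1) (r - 1), a factor S^l splits off for l <= n. For n < l < n + k only S^n is taken; the
    rest is (r - 1)^(l-n) r^(n+k-l) with positive exponents, whose sum has no constant term.\<close>
  define G where "G = (\<lambda>l. if l \<le> n then monom 1 l * power_sum_poly p (d - p * l)
    else monom 1 n * shifted_power_sum_poly p (l - n) (n + k - l))"
  have G: "poly (G l) S = (\<Sum>j<p. (r j - 1) ^ l * r j ^ (d - l))"
    if "roots_of_trinomial p S r" "l < n + k" for S r l
  proof -
    have S: "r j ^ (p - 1) * (r j - 1) = S" if "j < p" for j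
    proof -
      have "r j ^ (p - 1) * r j = r j ^ p" using p by (simp flip: power_Suc2)
      then show ?thesis using root_power_p[OF p \<open>roots_of_trinomial p S r\<close> that] by (simp add: algebra_simps)
    qed
    have split: "(r j - 1) ^ (i + m) * r j ^ ((p - 1) * m + b) = S ^ m * ((r j - 1) ^ i * r j ^ b)" if "j < p" for i b m j
    proof -
      have "S ^ m = r j ^ ((p - 1) * m) * (r j - 1) ^ m" by (simp add: S[OF that, symmetric] power_mult_distrib power_mult)
      then show ?thesis by (simp add: power_add mult_ac)
    qed
    show ?thesis
    proof (cases "l \<le> n")
      case True
      have *: "p * l \<le> p * n" using True by simp
      have "p * l = (p - 1) * l + l" using p by (cases p) auto
      then have "d - l = (p - 1) * l + (d - p * l)" using * unfolding d_def by linarith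
      then have "(r j - 1) ^ l * r j ^ (d - l) = S ^ l * r j ^ (d - p * l)" if "j < p" for j
        using split[OF that, of 0 l "d - p * l"] by simp
      then show ?thesis using True
        by (simp add: G_def poly_monom poly_power_sum_poly[OF p that(1)] sum_distrib_left)
    next
      case False
      have "p * n = (p - 1) * n + n" using p by (cases p) auto
      then have "d - l = (p - 1) * n + (n + k - l)" using that(2) unfolding d_def by linarith
      then have "(r j - 1) ^ l * r j ^ (d - l) = S ^ n * ((r j - 1) ^ (l - n) * r j ^ (n + k - l))" if "j < p" for j
        using split[OF that, of "l - n" n "n + k - l"] False by simp
      then show ?thesis using False
        by (simp add: G_def poly_monom poly_shifted_power_sum_poly[OF p that(1)] sum_distrib_left)
    qed
  qed
  have coeff_G: "coeff (G l) n = (if l \<le> n then of_int (power_sum_coeff p (n - l) k) else 0)" if "l < n + k" for l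
  proof (cases "l \<le> n")
    case True
    have "d - p * l = p * (n - l) + k" using True by (simp add: d_def diff_mult_distrib2)
    then show ?thesis using True coeff_power_sum_poly[OF p, of "n - l" k] that
      by (simp add: G_def coeff_monom_mult)
  next
    case False
    then show ?thesis using coeff_0_shifted_power_sum_poly[OF p, of "l - n" "n + k - l"] that
      by (simp add: G_def coeff_monom_mult)
  qed
  \<comment> \<open>By l <= \<mu>_1 < n + k, the indices for which \<open>G l\<close> is not known
    to be the intended sum do not contribute.\<close>
  have C0: "bounded_coeff_sum p \<mu> l = 0" if "\<not> l < n + k" for l
    using bounded_coeff_sum_nonzero(1)[OF part, of p l] that less by linarith
  have C1: "bounded_coeff_sum p \<mu> l = 0" if "\<not> l \<le> sum_mset \<mu>" for l
    using bounded_coeff_sum_nonzero(2)[OF part] that by blast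
  define A where "A = (\<Sum>m\<le>d div p. monom (of_int (monomial_elem_coeff \<mu>' (ones_ps p m (d - p * m))) * sg ^ m) m)"
  define B where "B = smult ((- 1) ^ sum_mset \<mu>) (\<Sum>l\<le>sum_mset \<mu>. smult (of_int (bounded_coeff_sum p \<mu> l)) (G l))"
  have "poly A S = poly B S" for S
  proof -
    obtain r where r: "roots_of_trinomial p S r" using ex_roots_of_trinomial[OF p] by blast
    have "poly A S = poly_eval r (monomial_sym p \<mu>')"
      unfolding A_def poly_eval_monomial_sym_roots[OF p r \<mu>']
      by (simp add: poly_sum poly_monom sg_def power_mult_distrib mult.assoc)
    also have "\<dots> = (\<Sum>j<p. r j ^ a * poly_eval (r(j := 0)) (monomial_sym p \<mu>))"
      unfolding \<mu>'_def by (rule poly_eval_monomial_sym_add_largest[OF part a_gt])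
    also have "\<dots> = (\<Sum>j<p. (- 1) ^ sum_mset \<mu> *
        (\<Sum>l\<le>sum_mset \<mu>. of_int (bounded_coeff_sum p \<mu> l) * ((r j - 1) ^ l * r j ^ (d - l))))"
    proof (rule sum.cong[OF refl])
      fix j assume "j \<in> {..<p}"
      then have j: "j < p" by simp
      have eq: "r j ^ a * (\<Sum>l\<le>sum_mset \<mu>. of_int (bounded_coeff_sum p \<mu> l) * ((r j - 1) ^ l * r j ^ (sum_mset \<mu> - l)))
          = (\<Sum>l\<le>sum_mset \<mu>. of_int (bounded_coeff_sum p \<mu> l) * ((r j - 1) ^ l * r j ^ (d - l)))"
        unfolding sum_distrib_left
      proof (rule sum.cong[OF refl])
        fix l assume "l \<in> {..sum_mset \<mu>}"
        then have "d - l = a + (sum_mset \<mu> - l)" using sum by simp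
        then show "r j ^ a * (of_int (bounded_coeff_sum p \<mu> l) * ((r j - 1) ^ l * r j ^ (sum_mset \<mu> - l))) =
            of_int (bounded_coeff_sum p \<mu> l) * ((r j - 1) ^ l * r j ^ (d - l))"
          by (simp add: power_add)
      qed
      show "r j ^ a * poly_eval (r(j := 0)) (monomial_sym p \<mu>) = (- 1) ^ sum_mset \<mu> *
        (\<Sum>l\<le>sum_mset \<mu>. of_int (bounded_coeff_sum p \<mu> l) * ((r j - 1) ^ l * r j ^ (d - l)))"
        unfolding poly_eval_monomial_sym_roots_delete[OF p r j part] 
        by (simp only: mult.left_commute[of "r j ^ a" "(- 1) ^ sum_mset \<mu>"] eq)
    qed
    also have "\<dots> = (- 1) ^ sum_mset \<mu> * (\<Sum>l\<le>sum_mset \<mu>. of_int (bounded_coeff_sum p \<mu> l) *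
        (\<Sum>j<p. (r j - 1) ^ l * r j ^ (d - l)))"
      by (simp add: sum_distrib_left sum.swap[of _ "{..<p}"])
    also have "\<dots> = (- 1) ^ sum_mset \<mu> * (\<Sum>l\<le>sum_mset \<mu>. of_int (bounded_coeff_sum p \<mu> l) * poly (G l) S)"
    proof (rule arg_cong[where f = "\<lambda>x. (- 1) ^ sum_mset \<mu> * x"], rule sum.cong[OF refl])
      fix l
      show "of_int (bounded_coeff_sum p \<mu> l) * (\<Sum>j<p. (r j - 1) ^ l * r j ^ (d - l)) = of_int (bounded_coeff_sum p \<mu> l) * poly (G l) S"
        using G[OF r, of l] C0[of l] by (cases "l < n + k") simp_all
    qed
    also have "\<dots> = poly B S" by (simp add: B_def poly_sum)
    finally show ?thesis .
  qed
  then have "A = B" by (simp only: poly_eq_poly_eq_iff[symmetric] fun_eq_iff) simp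
  then have "coeff A n = coeff B n" by simp
  moreover have "coeff A n = of_int (monomial_elem_coeff \<mu>' (ones_ps p n k)) * sg ^ n"
  proof -
    have "n \<le> d div p" using p by (simp add: d_def)
    then have "coeff A n = of_int (monomial_elem_coeff \<mu>' (ones_ps p n (d - p * n))) * sg ^ n"
      by (simp add: A_def coeff_sum sum.delta)
    then show ?thesis by (simp add: d_def)
  qed
  moreover have "coeff B n = of_int ((- 1) ^ sum_mset \<mu> * (\<Sum>l\<le>n. bounded_coeff_sum p \<mu> l * power_sum_coeff p (n - l) k))"
  proof -
    have "coeff B n = (- 1) ^ sum_mset \<mu> * (\<Sum>l\<le>sum_mset \<mu>. of_int (bounded_coeff_sum p \<mu> l) * coeff (G l) n)"
      by (simp add: B_def coeff_sum)
    also have "(\<Sum>l\<le>sum_mset \<mu>. of_int (bounded_coeff_sum p \<mu> l) * coeff (G l) n) =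
        (\<Sum>l\<in>{..sum_mset \<mu>} \<inter> {..n}. of_int (bounded_coeff_sum p \<mu> l * power_sum_coeff p (n - l) k))"
    proof (rule sum.mono_neutral_cong_right)
      show "\<forall>l\<in>{..sum_mset \<mu>} - {..sum_mset \<mu>} \<inter> {..n}. of_int (bounded_coeff_sum p \<mu> l) * coeff (G l) n = 0"
      proof
        fix l assume "l \<in> {..sum_mset \<mu>} - {..sum_mset \<mu>} \<inter> {..n}"
        then show "of_int (bounded_coeff_sum p \<mu> l) * coeff (G l) n = 0"
          using coeff_G[of l] C0[of l] by (cases "l < n + k") auto
      qed
      show "of_int (bounded_coeff_sum p \<mu> l) * coeff (G l) n = of_int (bounded_coeff_sum p \<mu> l * power_sum_coeff p (n - l) k)"
        if "l \<in> {..sum_mset \<mu>} \<inter> {..n}" for l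
        using that coeff_G[of l] C0[of l] by (cases "l < n + k") auto
    qed auto
    also have "\<dots> = (\<Sum>l\<le>n. of_int (bounded_coeff_sum p \<mu> l * power_sum_coeff p (n - l) k))"
      using C1 by (intro sum.mono_neutral_left) auto
    finally show ?thesis by simp
  qed
  ultimately have E: "of_int (monomial_elem_coeff \<mu>' (ones_ps p n k)) * sg ^ n =
      (of_int ((- 1) ^ sum_mset \<mu> * (\<Sum>l\<le>n. bounded_coeff_sum p \<mu> l * power_sum_coeff p (n - l) k)) :: complex)"
    by (simp only:)
  have "sg * sg = 1" by (simp add: sg_def flip: power_add)
  then have "sg ^ n * sg ^ n = 1" by (simp flip: power_mult_distrib)
  then have "(of_int (monomial_elem_coeff \<mu>' (ones_ps p n k)) :: complex) =
      (of_int (monomial_elem_coeff \<mu>' (ones_ps p n k)) * sg ^ n) * sg ^ n"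
    by (simp add: mult.assoc)
  also have "\<dots> = of_int (beta_formula p n k \<mu>)"
    unfolding E by (simp add: beta_formula_def sg_def power_add power_mult)
  finally have "(of_int (monomial_elem_coeff \<mu>' (ones_ps p n k)) :: complex) = of_int (beta_formula p n k \<mu>)" .
  then have "monomial_elem_coeff \<mu>' (ones_ps p n k) = beta_formula p n k \<mu>" by (simp only: of_int_eq_iff)
  moreover have "add_part \<mu> (p * n + k - sum_mset \<mu>) = \<mu>'" using a_gt by (simp add: \<mu>'_def add_part_def a_def d_def)
  ultimately show ?thesis using p \<mu>' by (simp add: alpha_eq_monomial_elem_coeff d_def)
qed

section \<open>Support, recurrence, divisibility and lowering for the explicit formula\<close>

lemma beta_formula_nonzero:
  assumes "is_partition \<mu>" "beta_formula p n k \<mu> \<noteq> 0"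
  shows "sum_mset \<mu> \<le> n * (p - 1)" "size \<mu> \<le> p - 1"
proof -
  have "\<exists>l\<in>{..n}. bounded_coeff_sum p \<mu> l \<noteq> 0"
    using assms(2) unfolding beta_formula_def by (intro ccontr[of "Bex _ _"]) simp
  then obtain l where l: "l \<le> n" "bounded_coeff_sum p \<mu> l \<noteq> 0" by auto
  show "sum_mset \<mu> \<le> n * (p - 1)"
    using order_trans[OF bounded_coeff_sum_nonzero(3)[OF assms(1) l(2)] mult_le_mono2[OF l(1)]]
    by (simp add: mult.commute)
  show "size \<mu> \<le> p - 1" by (rule bounded_coeff_sum_nonzero(4)[OF assms(1) l(2)])
qed

text \<open>The recurrence of \<open>power_sum_coeff\<close> is applied termwise. The terms l = n +
  1 cancel because \<open>power_sum_coeff p 0\<close> is constant; for k = 0 this depends on the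
  value 1, not p, at the origin.\<close>

lemma sum_power_sum_coeff_diff:
  "(\<Sum>l\<le>Suc n. c l * power_sum_coeff p (Suc n - l) (Suc k)) - (\<Sum>l\<le>Suc n. c l * power_sum_coeff p (Suc n - l) k) =
   (\<Sum>l\<le>n. c l * power_sum_coeff p (n - l) (Suc k))"
proof -
  have "(\<Sum>l\<le>Suc n. c l * power_sum_coeff p (Suc n - l) (Suc k)) - (\<Sum>l\<le>Suc n. c l * power_sum_coeff p (Suc n - l) k) =
     (\<Sum>l\<le>n. c l * power_sum_coeff p (Suc n - l) (Suc k)) - (\<Sum>l\<le>n. c l * power_sum_coeff p (Suc n - l) k)"
    by simp
  also have "\<dots> = (\<Sum>l\<le>n. c l * power_sum_coeff p (n - l) (Suc k))"
    unfolding sum_subtractf[symmetric]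
    by (intro sum.cong refl) (simp add: Suc_diff_le algebra_simps)
  finally show ?thesis .
qed

lemma beta_formula_rec:
  "beta_formula p (Suc n) (Suc k) \<mu> - beta_formula p (Suc n) k \<mu> = (- 1) ^ (p - 1) * beta_formula p n (Suc k) \<mu>"
  unfolding beta_formula_def right_diff_distrib[symmetric] sum_power_sum_coeff_diff
  by (simp add: power_add)

lemma power_sum_coeff_0: "n \<ge> 1 \<Longrightarrow> power_sum_coeff p n 0 = int p"
  by (cases n) auto

text \<open>A nonzero summand has l <= \<mu>_1 < n, so its power sum coefficient is p.\<close>

lemma dvd_beta_formula_0:
  assumes "is_partition \<mu>" "largest_part \<mu> < n"
  shows "int p dvd beta_formula p n 0 \<mu>"
  unfolding beta_formula_def
proof (rule dvd_mult, rule dvd_sum)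
  fix l
  show "int p dvd bounded_coeff_sum p \<mu> l * power_sum_coeff p (n - l) 0"
    using bounded_coeff_sum_nonzero(1)[OF assms(1), of p l] assms(2)
    by (cases "bounded_coeff_sum p \<mu> l = 0") (auto simp: power_sum_coeff_0)
qed

text \<open>Lowering selects the \<nu> that contain a part 1 and deletes it, which takes l to l - 1;
  as 1 < p, the bound on the largest part is preserved both ways.\<close>

lemma sum_lower_multiplicity_bounded_coeff_sum:
  assumes p: "p \<ge> 2" and \<mu>: "\<mu> \<in> partitions_of d"
  shows "(\<Sum>\<rho>\<in>partitions_of (Suc d). int (lower_multiplicity \<rho> \<mu>) * bounded_coeff_sum p \<rho> l) =
    (case l of 0 \<Rightarrow> 0 | Suc l' \<Rightarrow> bounded_coeff_sum p \<mu> l')"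
proof -
  let ?Q = "{\<nu> \<in> partitions_of (Suc d). largest_part \<nu> < p \<and> size \<nu> = l}"
  have d: "sum_mset \<mu> = d" using \<mu> by (simp add: partitions_of_def)
  have "(\<Sum>\<rho>\<in>partitions_of (Suc d). int (lower_multiplicity \<rho> \<mu>) * bounded_coeff_sum p \<rho> l) =
      (\<Sum>\<rho>\<in>partitions_of (Suc d). \<Sum>\<nu>\<in>?Q. int (lower_multiplicity \<rho> \<mu>) * monomial_elem_coeff \<rho> \<nu>)"
  proof (rule sum.cong[OF refl])
    fix \<rho> assume "\<rho> \<in> partitions_of (Suc d)"
    then have "sum_mset \<rho> = Suc d" by (simp add: partitions_of_def)
    then show "int (lower_multiplicity \<rho> \<mu>) * bounded_coeff_sum p \<rho> l =
        (\<Sum>\<nu>\<in>?Q. int (lower_multiplicity \<rho> \<mu>) * monomial_elem_coeff \<rho> \<nu>)"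
      by (simp add: bounded_coeff_sum_def sum_distrib_left)
  qed
  also have "\<dots> = (\<Sum>\<nu>\<in>?Q. \<Sum>\<rho>\<in>partitions_of (Suc d). int (lower_multiplicity \<rho> \<mu>) * monomial_elem_coeff \<rho> \<nu>)"
    by (rule sum.swap)
  also have "\<dots> = (\<Sum>\<nu>\<in>?Q. if 1 \<in># \<nu> then monomial_elem_coeff \<mu> (\<nu> - {#1#}) else 0)"
    by (intro sum.cong refl) (simp add: sum_lower_multiplicity_monomial_elem_coeff[OF \<mu>])
  also have "\<dots> = (\<Sum>\<nu>\<in>{\<nu> \<in> ?Q. 1 \<in># \<nu>}. monomial_elem_coeff \<mu> (\<nu> - {#1#}))"
    using finite_partitions_of[of "Suc d"] by (intro sum.mono_neutral_cong_right) auto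
  also have "\<dots> = (case l of 0 \<Rightarrow> 0 | Suc l' \<Rightarrow> bounded_coeff_sum p \<mu> l')"
  proof (cases l)
    case 0
    then have "{\<nu> \<in> ?Q. 1 \<in># \<nu>} = {}" by auto
    then show ?thesis using 0 by (simp only: sum.empty nat.case)
  next
    case (Suc l')
    have "bij_betw (add_mset 1) {\<nu> \<in> partitions_of d. largest_part \<nu> < p \<and> size \<nu> = l'} {\<nu> \<in> ?Q. 1 \<in># \<nu>}"
    proof (rule bij_betw_byWitness[where f' = "\<lambda>\<nu>. \<nu> - {#1#}"])
      show "add_mset 1 ` {\<nu> \<in> partitions_of d. largest_part \<nu> < p \<and> size \<nu> = l'} \<subseteq> {\<nu> \<in> ?Q. 1 \<in># \<nu>}"
        using p Suc by (auto simp: partitions_of_def is_partition_def largest_part_def)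
      show "(\<lambda>\<nu>. \<nu> - {#1#}) ` {\<nu> \<in> ?Q. 1 \<in># \<nu>} \<subseteq> {\<nu> \<in> partitions_of d. largest_part \<nu> < p \<and> size \<nu> = l'}"
      proof (rule image_subsetI)
        fix \<nu> assume \<nu>: "\<nu> \<in> {\<nu> \<in> ?Q. 1 \<in># \<nu>}"
        then obtain \<sigma> where "\<nu> = add_mset 1 \<sigma>" by (metis (no_types, lifting) mem_Collect_eq mset_add)
        then show "\<nu> - {#1#} \<in> {\<nu> \<in> partitions_of d. largest_part \<nu> < p \<and> size \<nu> = l'}"
          using \<nu> Suc by (auto simp: partitions_of_def is_partition_def largest_part_def)
      qed
    qed auto
    from sum.reindex_bij_betw[OF this, of "\<lambda>\<nu>. monomial_elem_coeff \<mu> (\<nu> - {#1#})"]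
    show ?thesis using Suc by (simp add: bounded_coeff_sum_def d)
  qed
  finally show ?thesis .
qed

text \<open>The sum over \<rho> shifts l by one and, as |\<rho>| = |\<mu>| + 1, changes the sign. By
  \<open>sum_power_sum_coeff_diff\<close> it is minus the difference of the values at k + 1 and
  k.\<close>

lemma beta_formula_lower:
  assumes p: "p \<ge> 2" and \<mu>: "\<mu> \<in> partitions_of d"
  shows "beta_formula p n (Suc k) \<mu> +
    (\<Sum>\<rho>\<in>partitions_of (Suc d). int (lower_multiplicity \<rho> \<mu>) * beta_formula p n (Suc k) \<rho>) = beta_formula p n k \<mu>"
proof -
  let ?C = "bounded_coeff_sum p" and ?e = "(- 1) ^ ((p - 1) * n + d) :: int"
  have d: "sum_mset \<mu> = d" using \<mu> by (simp add: partitions_of_def)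
  have "(\<Sum>\<rho>\<in>partitions_of (Suc d). int (lower_multiplicity \<rho> \<mu>) * beta_formula p n (Suc k) \<rho>) =
     (\<Sum>\<rho>\<in>partitions_of (Suc d). \<Sum>l\<le>n. - ?e * power_sum_coeff p (n - l) (Suc k) * (int (lower_multiplicity \<rho> \<mu>) * ?C \<rho> l))"
    unfolding beta_formula_def
    by (intro sum.cong refl) (simp add: partitions_of_def sum_distrib_left sum_negf mult_ac)
  also have "\<dots> = (\<Sum>l\<le>n. - ?e * power_sum_coeff p (n - l) (Suc k) * (case l of 0 \<Rightarrow> 0 | Suc l' \<Rightarrow> ?C \<mu> l'))"
    by (subst sum.swap) (simp only: sum_distrib_left[symmetric] sum_lower_multiplicity_bounded_coeff_sum[OF p \<mu>])
  also have "\<dots> = - ?e * (\<Sum>l<n. ?C \<mu> l * power_sum_coeff p (n - Suc l) (Suc k))"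
    by (cases n) (simp_all add: sum.atMost_Suc_shift sum_distrib_left sum_distrib_right sum_negf lessThan_Suc_atMost mult_ac del: sum.atMost_Suc)
  finally have sum: "(\<Sum>\<rho>\<in>partitions_of (Suc d). int (lower_multiplicity \<rho> \<mu>) * beta_formula p n (Suc k) \<rho>) =
      - ?e * (\<Sum>l<n. ?C \<mu> l * power_sum_coeff p (n - Suc l) (Suc k))" .
  show ?thesis
  proof (cases n)
    case 0
    then show ?thesis unfolding sum by (simp add: beta_formula_def)
  next
    case (Suc n')
    show ?thesis
      unfolding sum unfolding beta_formula_def d Suc lessThan_Suc_atMost diff_Suc_Suc
        sum_power_sum_coeff_diff[of "?C \<mu>" p n' k, symmetric]
      by (simp only: right_diff_distrib mult_minus_left)
  qed
qed

subsection \<open>The Hammond operator\<close>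

lemma H1_perp_0 [simp]: "H1_perp 0 = 0"
  by (simp add: H1_perp_def)

lemma H1_perp_1 [simp]: "H1_perp 1 = 0"
  using H1_perp_single[of 0 1] by (simp add: H1_perp_mon_def)

lemma H1_perp_of_int [simp]: "H1_perp (of_int c) = 0"
  using H1_perp_single[of 0 c] single_of_int[of c, where 'b = int and 'a = "nat + nat \<Rightarrow>\<^sub>0 nat"]
  by (simp add: H1_perp_mon_def)

lemma H1_perp_of_int_mult: "H1_perp (of_int c * P) = of_int c * H1_perp P"
  by (simp add: H1_perp_mult)

lemma H1_perp_sum: "H1_perp (\<Sum>i\<in>I. P i) = (\<Sum>i\<in>I. H1_perp (P i))"
  by (induction I rule: infinite_finite_induct) (simp_all add: H1_perp_add)

lemma e_x_part_empty [simp]: "e_x_part {#} = 1"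
  by (simp add: e_x_part_def)

lemma e_x_part_add_mset: "e_x_part (add_mset i \<mu>) = e_x i * e_x_part \<mu>"
  by (simp add: e_x_part_def)

lemma e_x_part_add_part: "e_x_part (add_part \<mu> i) = e_x i * e_x_part \<mu>"
  by (simp add: add_part_def e_x_part_add_mset)

lemma H1_perp_e_x_part:
  "is_partition \<mu> \<Longrightarrow> H1_perp (e_x_part \<mu>) = (\<Sum>t\<in>#\<mu>. e_x_part (lower_part \<mu> t))"
proof (induction \<mu>)
  case (add i \<mu>)
  then have i: "i \<noteq> 0" and \<mu>: "is_partition \<mu>" by (auto simp: is_partition_def)
  have "H1_perp (e_x_part (add_mset i \<mu>)) = e_x (i - 1) * e_x_part \<mu> + e_x i * (\<Sum>t\<in>#\<mu>. e_x_part (lower_part \<mu> t))"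
    using i add.IH[OF \<mu>] by (cases i) (simp_all add: e_x_part_add_mset H1_perp_mult H1_perp_e_x del: e_x.simps)
  also have "e_x i * (\<Sum>t\<in>#\<mu>. e_x_part (lower_part \<mu> t)) = (\<Sum>t\<in>#\<mu>. e_x i * e_x_part (lower_part \<mu> t))"
    by (simp add: sum_mset_distrib_left)
  also have "\<dots> = (\<Sum>t\<in>#\<mu>. e_x_part (lower_part (add_mset i \<mu>) t))"
  proof (intro arg_cong[where f = sum_mset] image_mset_cong)
    fix t assume "t \<in># \<mu>"
    then have "remove_part (add_mset i \<mu>) t = add_mset i (remove_part \<mu> t)"
      by (simp add: remove_part_def)
    then show "e_x i * e_x_part (lower_part \<mu> t) = e_x_part (lower_part (add_mset i \<mu>) t)"
      by (simp add: lower_part_def e_x_part_add_part e_x_part_add_mset mult_ac)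
  qed
  also have "e_x (i - 1) * e_x_part \<mu> = e_x_part (lower_part (add_mset i \<mu>) i)"
    by (simp add: lower_part_def e_x_part_add_part remove_part_def)
  finally show ?case by simp
qed simp

lemma H1_perp_e_x_part':
  assumes "\<rho> \<in> partitions_of (Suc d)"
  shows "H1_perp (e_x_part \<rho>) = (\<Sum>\<mu>\<in>partitions_of d. of_int (int (lower_multiplicity \<rho> \<mu>)) * e_x_part \<mu>)"
proof -
  have "is_partition \<rho>" using assms by (simp add: partitions_of_def)
  then show ?thesis using H1_perp_e_x_part[of \<rho>] sum_mset_lower_part[OF assms, of e_x_part] by simp
qed

text \<open>Grouping by j = |\<mu>| suits the Hammond operator, which lowers either j or the index d
  - j of the y-factor by one.\<close>

definition two_sym_sum :: "(nat multiset \<Rightarrow> int) \<Rightarrow> nat \<Rightarrow> two_sym" where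
  "two_sym_sum b d = (\<Sum>j\<le>d. \<Sum>\<mu>\<in>partitions_of j. of_int (b \<mu>) * (e_x_part \<mu> * e_y (d - j)))"

lemma two_sym_sum_eq:
  "two_sym_sum b d = (\<Sum>\<mu> | is_partition \<mu> \<and> sum_mset \<mu> \<le> d. of_int (b \<mu>) * e_x_part \<mu> * e_y (d - sum_mset \<mu>))"
proof -
  let ?L = "{\<mu>. is_partition \<mu> \<and> sum_mset \<mu> \<le> d}"
  have "(\<Sum>\<mu>\<in>?L. of_int (b \<mu>) * e_x_part \<mu> * e_y (d - sum_mset \<mu>)) =
      (\<Sum>j\<le>d. \<Sum>\<mu> | \<mu> \<in> ?L \<and> sum_mset \<mu> = j. of_int (b \<mu>) * e_x_part \<mu> * e_y (d - sum_mset \<mu>))"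
    by (intro sum.group[symmetric]) (auto simp: finite_partitions_le)
  also have "\<dots> = two_sym_sum b d"
    unfolding two_sym_sum_def
  proof (rule sum.cong[OF refl])
    fix j assume "j \<in> {..d}"
    then have "{\<mu>. \<mu> \<in> ?L \<and> sum_mset \<mu> = j} = partitions_of j" by (auto simp: partitions_of_def)
    then show "(\<Sum>\<mu> | \<mu> \<in> ?L \<and> sum_mset \<mu> = j. of_int (b \<mu>) * e_x_part \<mu> * e_y (d - sum_mset \<mu>)) =
        (\<Sum>\<mu>\<in>partitions_of j. of_int (b \<mu>) * (e_x_part \<mu> * e_y (d - j)))"
      by (intro sum.cong) (auto simp: partitions_of_def mult.assoc)
  qed
  finally show ?thesis ..
qed

lemma partitions_of_0: "partitions_of 0 = {{#}}"
proof -
  have "\<mu> = {#}" if "is_partition \<mu>" "sum_mset \<mu> = 0" for \<mu>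
    using size_le_sum_mset[OF that(1)] that(2) by simp
  then show ?thesis by (auto simp: partitions_of_def is_partition_def)
qed

text \<open>A product of e_\<mu> with a y-factor arises in two ways: by lowering the y-factor next
  to the same \<mu>, or by lowering a part of some \<rho> of size |\<mu>| + 1.\<close>

lemma H1_perp_two_sym_sum:
  assumes "\<And>\<mu> j. j \<le> d \<Longrightarrow> \<mu> \<in> partitions_of j \<Longrightarrow>
      b \<mu> + (\<Sum>\<rho>\<in>partitions_of (Suc j). int (lower_multiplicity \<rho> \<mu>) * b \<rho>) = b' \<mu>"
  shows "H1_perp (two_sym_sum b (Suc d)) = two_sym_sum b' d"
proof -
  have "H1_perp (two_sym_sum b (Suc d)) =
      (\<Sum>j\<le>Suc d. \<Sum>\<mu>\<in>partitions_of j. of_int (b \<mu>) * (H1_perp (e_x_part \<mu>) * e_y (Suc d - j))) +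
      (\<Sum>j\<le>Suc d. \<Sum>\<mu>\<in>partitions_of j. of_int (b \<mu>) * (e_x_part \<mu> * H1_perp (e_y (Suc d - j))))"
    unfolding two_sym_sum_def H1_perp_sum H1_perp_of_int_mult unfolding H1_perp_mult
    by (simp only: distrib_left sum.distrib)
  \<comment> \<open>Here j = d + 1 drops out because its y-factor is 1; in the next equation j = 0
    drops out because its x-factor is 1.\<close>
  also have "(\<Sum>j\<le>Suc d. \<Sum>\<mu>\<in>partitions_of j. of_int (b \<mu>) * (e_x_part \<mu> * H1_perp (e_y (Suc d - j)))) =
      (\<Sum>j\<le>d. \<Sum>\<mu>\<in>partitions_of j. of_int (b \<mu>) * (e_x_part \<mu> * e_y (d - j)))"
    by (simp add: Suc_diff_le H1_perp_e_y del: e_y.simps(2))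
  also have "(\<Sum>j\<le>Suc d. \<Sum>\<mu>\<in>partitions_of j. of_int (b \<mu>) * (H1_perp (e_x_part \<mu>) * e_y (Suc d - j))) =
      (\<Sum>j\<le>d. \<Sum>\<rho>\<in>partitions_of (Suc j). of_int (b \<rho>) * (H1_perp (e_x_part \<rho>) * e_y (d - j)))"
    by (subst sum.atMost_Suc_shift) (simp add: partitions_of_0)
  also have "\<dots> = (\<Sum>j\<le>d. \<Sum>\<mu>\<in>partitions_of j.
      of_int (\<Sum>\<rho>\<in>partitions_of (Suc j). int (lower_multiplicity \<rho> \<mu>) * b \<rho>) * (e_x_part \<mu> * e_y (d - j)))"
  proof (rule sum.cong[OF refl])
    fix j
    have "(\<Sum>\<rho>\<in>partitions_of (Suc j). of_int (b \<rho>) * (H1_perp (e_x_part \<rho>) * e_y (d - j))) =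
      (\<Sum>\<rho>\<in>partitions_of (Suc j). \<Sum>\<mu>\<in>partitions_of j.
        of_int (int (lower_multiplicity \<rho> \<mu>) * b \<rho>) * (e_x_part \<mu> * e_y (d - j)))"
      by (intro sum.cong refl) (simp add: H1_perp_e_x_part' sum_distrib_left sum_distrib_right mult_ac)
    also have "\<dots> = (\<Sum>\<mu>\<in>partitions_of j. \<Sum>\<rho>\<in>partitions_of (Suc j).
        of_int (int (lower_multiplicity \<rho> \<mu>) * b \<rho>) * (e_x_part \<mu> * e_y (d - j)))"
      by (rule sum.swap)
    also have "\<dots> = (\<Sum>\<mu>\<in>partitions_of j.
      of_int (\<Sum>\<rho>\<in>partitions_of (Suc j). int (lower_multiplicity \<rho> \<mu>) * b \<rho>) * (e_x_part \<mu> * e_y (d - j)))"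
      by (simp only: of_int_sum sum_distrib_right)
    finally show "(\<Sum>\<rho>\<in>partitions_of (Suc j). of_int (b \<rho>) * (H1_perp (e_x_part \<rho>) * e_y (d - j))) =
      (\<Sum>\<mu>\<in>partitions_of j.
        of_int (\<Sum>\<rho>\<in>partitions_of (Suc j). int (lower_multiplicity \<rho> \<mu>) * b \<rho>) * (e_x_part \<mu> * e_y (d - j)))" .
  qed
  also have "\<dots> + (\<Sum>j\<le>d. \<Sum>\<mu>\<in>partitions_of j. of_int (b \<mu>) * (e_x_part \<mu> * e_y (d - j))) =
      (\<Sum>j\<le>d. \<Sum>\<mu>\<in>partitions_of j. of_int (b \<mu> + (\<Sum>\<rho>\<in>partitions_of (Suc j). int (lower_multiplicity \<rho> \<mu>) * b \<rho>)) * (e_x_part \<mu> * e_y (d - j)))"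
    by (simp only: of_int_add distrib_right sum.distrib add.commute)
  also have "\<dots> = two_sym_sum b' d"
    unfolding two_sym_sum_def by (intro sum.cong refl) (simp only: assms atMost_iff)
  finally show ?thesis .
qed

lemma H1_perp_two_sym_sum_beta_formula:
  "p \<ge> 2 \<Longrightarrow> H1_perp (two_sym_sum (beta_formula p n (Suc k)) (Suc d)) = two_sym_sum (beta_formula p n k) d"
  by (rule H1_perp_two_sym_sum) (rule beta_formula_lower)

section \<open>Linear independence of the products in the two alphabets\<close>

definition x_exponent :: "nat multiset \<Rightarrow> nat + nat \<Rightarrow>\<^sub>0 nat" where
  "x_exponent \<mu> = (\<Sum>i\<in>#\<mu>. Poly_Mapping.single (Inl (i - 1)) 1)"

definition y_exponent :: "nat \<Rightarrow> nat + nat \<Rightarrow>\<^sub>0 nat" where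
  "y_exponent j = (if j = 0 then 0 else Poly_Mapping.single (Inr (j - 1)) 1)"

lemma e_x_part_eq_single: "is_partition \<mu> \<Longrightarrow> e_x_part \<mu> = Poly_Mapping.single (x_exponent \<mu>) 1"
proof (induction \<mu>)
  case (add i \<mu>)
  then obtain i' where i: "i = Suc i'" and "is_partition \<mu>" by (cases i) (auto simp: is_partition_def)
  with add.IH show ?case by (simp add: e_x_part_add_mset x_exponent_def var_def mult_single)
qed (simp add: x_exponent_def)

lemma e_y_eq_single: "e_y j = Poly_Mapping.single (y_exponent j) 1"
  by (cases j) (simp_all add: y_exponent_def var_def)

lemma lookup_x_exponent:
  "is_partition \<mu> \<Longrightarrow> Poly_Mapping.lookup (x_exponent \<mu>) (Inl i) = count \<mu> (Suc i)"
proof (induction \<mu>)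
  case (add j \<mu>)
  then obtain j' where j: "j = Suc j'" and "is_partition \<mu>" by (cases j) (auto simp: is_partition_def)
  with add.IH show ?case by (simp add: x_exponent_def lookup_add lookup_single when_def)
qed (simp add: x_exponent_def)

text \<open>The multiplicities in \<mu> are the exponents of the x-variables, to which
  \<open>y_exponent\<close> contributes nothing.\<close>

lemma x_exponent_inject:
  assumes "is_partition \<mu>" "is_partition \<nu>" "x_exponent \<mu> + y_exponent i = x_exponent \<nu> + y_exponent j"
  shows "\<mu> = \<nu>"
proof (rule multiset_eqI)
  fix x
  show "count \<mu> x = count \<nu> x"
  proof (cases x)
    case 0
    then show ?thesis using assms by (auto simp: is_partition_def not_in_iff)
  next
    case (Suc m)
    have "Poly_Mapping.lookup (y_exponent l) (Inl m) = 0" for l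
      by (simp add: y_exponent_def lookup_single)
    then show ?thesis
      using arg_cong[OF assms(3), of "\<lambda>f. Poly_Mapping.lookup f (Inl m)"] Suc assms(1,2)
      by (simp add: lookup_add lookup_x_exponent)
  qed
qed

lemma two_sym_sum_inject:
  assumes "two_sym_sum b d = two_sym_sum b' d" "is_partition \<mu>" "sum_mset \<mu> \<le> d"
  shows "b \<mu> = b' \<mu>"
proof -
  let ?L = "{\<mu>. is_partition \<mu> \<and> sum_mset \<mu> \<le> d}"
  let ?h = "\<lambda>\<mu>. x_exponent \<mu> + y_exponent (d - sum_mset \<mu>)"
  have "Poly_Mapping.lookup (two_sym_sum b d) (?h \<mu>) = b \<mu>" for b
  proof -
    have "Poly_Mapping.lookup (two_sym_sum b d) (?h \<mu>) = (\<Sum>\<nu>\<in>?L. if \<nu> = \<mu> then b \<nu> else 0)"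
      unfolding two_sym_sum_eq lookup_sum
    proof (rule sum.cong[OF refl])
      fix \<nu> assume \<nu>: "\<nu> \<in> ?L"
      then have "e_x_part \<nu> * e_y (d - sum_mset \<nu>) = Poly_Mapping.single (?h \<nu>) 1"
        by (simp add: e_x_part_eq_single e_y_eq_single mult_single)
      moreover have "?h \<nu> = ?h \<mu> \<longleftrightarrow> \<nu> = \<mu>"
      proof
        assume "?h \<nu> = ?h \<mu>"
        then show "\<nu> = \<mu>" by (rule x_exponent_inject[rotated 2]) (use \<nu> assms(2) in simp_all)
      qed simp
      ultimately show "Poly_Mapping.lookup (of_int (b \<nu>) * e_x_part \<nu> * e_y (d - sum_mset \<nu>)) (?h \<mu>) = (if \<nu> = \<mu> then b \<nu> else 0)"
        by (simp only: mult.assoc lookup_of_int_mult lookup_single when_def) simp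
    qed
    then show ?thesis using assms(2,3) finite_partitions_le[of d] by simp
  qed
  from this[of b] this[of b'] show ?thesis using assms(1) by simp
qed

lemma sum_e_x_part_inject:
  assumes "(\<Sum>\<mu>\<in>partitions_of d. of_int (a \<mu>) * e_x_part \<mu>) = (\<Sum>\<mu>\<in>partitions_of d. of_int (a' \<mu>) * e_x_part \<mu>)"
    and "\<mu> \<in> partitions_of d"
  shows "a \<mu> = a' \<mu>"
proof -
  have "Poly_Mapping.lookup (\<Sum>\<nu>\<in>partitions_of d. of_int (a \<nu>) * e_x_part \<nu>) (x_exponent \<mu>) = a \<mu>" for a
  proof -
    have "Poly_Mapping.lookup (\<Sum>\<nu>\<in>partitions_of d. of_int (a \<nu>) * e_x_part \<nu>) (x_exponent \<mu>) =
        (\<Sum>\<nu>\<in>partitions_of d. if \<nu> = \<mu> then a \<nu> else 0)"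
      unfolding lookup_sum
    proof (rule sum.cong[OF refl])
      fix \<nu> assume \<nu>: "\<nu> \<in> partitions_of d"
      have "x_exponent \<nu> = x_exponent \<mu> \<longleftrightarrow> \<nu> = \<mu>"
      proof
        assume "x_exponent \<nu> = x_exponent \<mu>"
        then have "x_exponent \<nu> + y_exponent 0 = x_exponent \<mu> + y_exponent 0" by simp
        then show "\<nu> = \<mu>" by (rule x_exponent_inject[rotated 2]) (use \<nu> assms(2) in \<open>simp_all add: partitions_of_def\<close>)
      qed simp
      moreover have "is_partition \<nu>" using \<nu> by (simp add: partitions_of_def)
      ultimately show "Poly_Mapping.lookup (of_int (a \<nu>) * e_x_part \<nu>) (x_exponent \<mu>) = (if \<nu> = \<mu> then a \<nu> else 0)"
        by (simp only: e_x_part_eq_single lookup_of_int_mult lookup_single when_def) simp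
    qed
    then show ?thesis using assms(2) finite_partitions_of[of d] by simp
  qed
  from this[of a] this[of a'] show ?thesis using assms(1) by simp
qed

subsection \<open>Identification of the coefficients\<close>

text \<open>The substitution \<open>y \<mapsto> x\<close>; it commutes with the derivation.\<close>

definition collapse :: "two_sym \<Rightarrow> two_sym" where
  "collapse = poly_eval (\<lambda>v. case v of Inl i \<Rightarrow> var (Inl i) | Inr i \<Rightarrow> var (Inl i))"

lemma poly_eval_var: "poly_eval q (var v) = q v"
  by (simp add: var_def poly_eval_single monomial_eval_def)

lemma collapse_e_x [simp]: "collapse (e_x i) = e_x i"
  by (cases i) (simp_all add: collapse_def poly_eval_var)

lemma collapse_e_y [simp]: "collapse (e_y i) = e_x i"
  by (cases i) (simp_all add: collapse_def poly_eval_var)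

lemma collapse_add: "collapse (P + Q) = collapse P + collapse Q"
  by (simp add: collapse_def poly_eval_add)

lemma collapse_mult: "collapse (P * Q) = collapse P * collapse Q"
  by (simp add: collapse_def poly_eval_mult)

lemma collapse_of_int [simp]: "collapse (of_int c) = of_int c"
  by (simp add: collapse_def)

lemma collapse_0 [simp]: "collapse 0 = 0"
  by (simp add: collapse_def)

lemma collapse_1 [simp]: "collapse 1 = 1"
  by (simp add: collapse_def)

lemma collapse_sum: "collapse (\<Sum>i\<in>I. P i) = (\<Sum>i\<in>I. collapse (P i))"
  by (simp add: collapse_def poly_eval_sum)

lemma collapse_e_x_part [simp]: "collapse (e_x_part \<mu>) = e_x_part \<mu>"
  by (induction \<mu>) (simp_all add: e_x_part_add_mset collapse_mult)

lemma H1_perp_collapse_e_x: "H1_perp (collapse (e_x i)) = collapse (H1_perp (e_x i))"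
  by (cases i) (simp_all add: H1_perp_e_x del: e_x.simps(2))

lemma H1_perp_collapse_e_y: "H1_perp (collapse (e_y i)) = collapse (H1_perp (e_y i))"
  by (cases i) (simp_all add: H1_perp_e_x H1_perp_e_y del: e_x.simps(2) e_y.simps(2))

lemma H1_perp_collapse_mult:
  assumes "H1_perp (collapse P) = collapse (H1_perp P)" "H1_perp (collapse Q) = collapse (H1_perp Q)"
  shows "H1_perp (collapse (P * Q)) = collapse (H1_perp (P * Q))"
  using assms by (simp add: collapse_mult H1_perp_mult collapse_add)

lemma H1_perp_collapse_e_x_part: "H1_perp (collapse (e_x_part \<mu>)) = collapse (H1_perp (e_x_part \<mu>))"
proof (induction \<mu>)
  case (add i \<mu>)
  then show ?case unfolding e_x_part_add_mset
    by (intro H1_perp_collapse_mult H1_perp_collapse_e_x)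
qed simp

text \<open>Commutation is checked on generators and extended by the product rule and
  additivity.\<close>

lemma H1_perp_collapse_two_sym_sum:
  "H1_perp (collapse (two_sym_sum b d)) = collapse (H1_perp (two_sym_sum b d))"
proof -
  have "H1_perp (collapse (e_x_part \<mu> * e_y i)) = collapse (H1_perp (e_x_part \<mu> * e_y i))" for \<mu> i
    by (intro H1_perp_collapse_mult H1_perp_collapse_e_x_part H1_perp_collapse_e_y)
  then have "H1_perp (collapse (of_int c * (e_x_part \<mu> * e_y i))) = collapse (H1_perp (of_int c * (e_x_part \<mu> * e_y i)))" for c \<mu> i
    by (intro H1_perp_collapse_mult[of "of_int c"]) simp_all
  then show ?thesis by (simp only: two_sym_sum_def collapse_sum H1_perp_sum)
qed

lemma H1_perp_sum_e_x_part:
  "H1_perp (\<Sum>\<rho>\<in>partitions_of (Suc d). of_int (a \<rho>) * e_x_part \<rho>) =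
   (\<Sum>\<mu>\<in>partitions_of d. of_int (\<Sum>\<rho>\<in>partitions_of (Suc d). int (lower_multiplicity \<rho> \<mu>) * a \<rho>) * e_x_part \<mu>)"
proof -
  have "H1_perp (\<Sum>\<rho>\<in>partitions_of (Suc d). of_int (a \<rho>) * e_x_part \<rho>) =
      (\<Sum>\<rho>\<in>partitions_of (Suc d). \<Sum>\<mu>\<in>partitions_of d. of_int (int (lower_multiplicity \<rho> \<mu>) * a \<rho>) * e_x_part \<mu>)"
    unfolding H1_perp_sum H1_perp_of_int_mult
    by (intro sum.cong refl) (simp add: H1_perp_e_x_part' sum_distrib_left mult_ac)
  also have "\<dots> = (\<Sum>\<mu>\<in>partitions_of d. \<Sum>\<rho>\<in>partitions_of (Suc d). of_int (int (lower_multiplicity \<rho> \<mu>) * a \<rho>) * e_x_part \<mu>)"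
    by (rule sum.swap)
  finally show ?thesis by (simp only: of_int_sum sum_distrib_right)
qed

text \<open>In the coefficient matrix the lowering sum acts on the second index by deleting a part
  1, and \<open>ones_ps p n (Suc k)\<close> contains one.\<close>

lemma alpha_lower:
  assumes p: "p \<ge> 2" and \<mu>: "\<mu> \<in> partitions_of (p * n + k)"
  shows "(\<Sum>\<rho>\<in>partitions_of (Suc (p * n + k)). int (lower_multiplicity \<rho> \<mu>) * alpha p n (Suc k) \<rho>) = alpha p n k \<mu>"
proof -
  have o: "ones_ps p n (Suc k) \<in> partitions_of (Suc (p * n + k))"
    using ones_ps_in_partitions_of[of p n "Suc k"] p by simp
  have "(\<Sum>\<rho>\<in>partitions_of (Suc (p * n + k)). int (lower_multiplicity \<rho> \<mu>) * alpha p n (Suc k) \<rho>) =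
     (\<Sum>\<rho>\<in>partitions_of (Suc (p * n + k)). int (lower_multiplicity \<rho> \<mu>) * monomial_elem_coeff \<rho> (ones_ps p n (Suc k)))"
    using p by (intro sum.cong refl) (simp add: alpha_eq_monomial_elem_coeff)
  also have "\<dots> = monomial_elem_coeff \<mu> (ones_ps p n (Suc k) - {#1#})"
    unfolding sum_lower_multiplicity_monomial_elem_coeff[OF \<mu> o] by (simp add: ones_ps_def)
  also have "ones_ps p n (Suc k) - {#1#} = ones_ps p n k" by (simp add: ones_ps_def)
  finally show ?thesis using p \<mu> by (simp add: alpha_eq_monomial_elem_coeff)
qed

lemma H1_perp_sum_alpha_e_x_part:
  assumes "p \<ge> 2"
  shows "H1_perp (\<Sum>\<rho>\<in>partitions_of (Suc (p * n + k)). of_int (alpha p n (Suc k) \<rho>) * e_x_part \<rho>) =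
    (\<Sum>\<mu>\<in>partitions_of (p * n + k). of_int (alpha p n k \<mu>) * e_x_part \<mu>)"
  unfolding H1_perp_sum_e_x_part by (intro sum.cong refl) (simp add: alpha_lower[OF assms])

section \<open>Splitting off the largest part, and the coefficients of \<open>m_bar\<close>\<close>

lemma largest_part_add_mset: "largest_part (add_mset a \<mu>) = max a (largest_part \<mu>)"
proof (rule antisym)
  show "largest_part (add_mset a \<mu>) \<le> max a (largest_part \<mu>)"
    unfolding largest_part_le_iff by (auto simp: le_max_iff_disj largest_part_ge)
  have "largest_part \<mu> \<le> largest_part (add_mset a \<mu>)"
    unfolding largest_part_le_iff[of \<mu>] by (auto intro: largest_part_ge)
  then show "max a (largest_part \<mu>) \<le> largest_part (add_mset a \<mu>)"
    using largest_part_ge[of a "add_mset a \<mu>"] by simp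
qed

lemma largest_part_in: "\<mu> \<noteq> {#} \<Longrightarrow> is_partition \<mu> \<Longrightarrow> largest_part \<mu> \<in># \<mu>"
proof -
  assume \<mu>: "\<mu> \<noteq> {#}" "is_partition \<mu>"
  have "largest_part \<mu> \<in> insert 0 (set_mset \<mu>)" unfolding largest_part_def by (rule Max_in) auto
  moreover obtain x where x: "x \<in># \<mu>" using \<mu>(1) by blast
  then have "x \<noteq> 0" using \<mu>(2) unfolding is_partition_def by metis
  then have "largest_part \<mu> \<noteq> 0" using largest_part_ge[OF x] by simp
  ultimately show ?thesis by simp
qed

lemma largest_part_le_sum_mset: "largest_part \<mu> \<le> sum_mset \<mu>"
  unfolding largest_part_le_iff
proof
  fix x assume "x \<in># \<mu>"
  then obtain \<sigma> where "\<mu> = add_mset x \<sigma>" by (rule mset_add)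
  then show "x \<le> sum_mset \<mu>" by simp
qed

lemma remove_largest_part:
  assumes "\<nu> \<in> partitions_of d"
  defines "\<mu> \<equiv> remove_part \<nu> (largest_part \<nu>)"
  shows "is_partition \<mu>" "sum_mset \<mu> + largest_part \<nu> = d" "largest_part \<mu> \<le> largest_part \<nu>"
    "add_part \<mu> (largest_part \<nu>) = \<nu>"
proof -
  have \<nu>: "is_partition \<nu>" "sum_mset \<nu> = d" using assms(1) by (auto simp: partitions_of_def)
  have "is_partition \<mu> \<and> sum_mset \<mu> + largest_part \<nu> = d \<and> largest_part \<mu> \<le> largest_part \<nu> \<and> add_part \<mu> (largest_part \<nu>) = \<nu>"
  proof (cases "\<nu> = {#}")
    case True
    then show ?thesis using \<nu> by (simp add: \<mu>_def remove_part_def add_part_def largest_part_def)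
  next
    case False
    have in_\<nu>: "largest_part \<nu> \<in># \<nu>" by (rule largest_part_in[OF False \<nu>(1)])
    then have eq: "\<nu> = add_mset (largest_part \<nu>) \<mu>" by (simp add: \<mu>_def remove_part_def)
    have "largest_part \<nu> \<noteq> 0" using in_\<nu> \<nu>(1) unfolding is_partition_def by metis
    moreover have "is_partition \<mu>" using \<nu>(1) by (subst (asm) eq) (simp add: is_partition_def)
    moreover have "sum_mset \<mu> + largest_part \<nu> = d" using \<nu>(2) by (subst (asm) eq) simp
    moreover have "largest_part \<mu> \<le> largest_part \<nu>"
      unfolding largest_part_le_iff using largest_part_ge[of _ \<nu>] by (auto simp: \<mu>_def remove_part_def dest: in_diffD)
    ultimately show ?thesis using eq by (simp add: add_part_def)
  qed
  then show "is_partition \<mu>" "sum_mset \<mu> + largest_part \<nu> = d" "largest_part \<mu> \<le> largest_part \<nu>"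
    "add_part \<mu> (largest_part \<nu>) = \<nu>" by auto
qed

lemma add_largest_part:
  assumes "is_partition \<mu>" "sum_mset \<mu> + a = d" "largest_part \<mu> \<le> a"
  shows "add_part \<mu> a \<in> partitions_of d" "largest_part (add_part \<mu> a) = a" "remove_part (add_part \<mu> a) a = \<mu>"
proof -
  show "add_part \<mu> a \<in> partitions_of d" using assms by (auto simp: add_part_def partitions_of_def is_partition_def)
  have "a = 0 \<Longrightarrow> \<mu> = {#}" using assms(1,3) largest_part_in[of \<mu>] by (auto simp: is_partition_def)
  then show "largest_part (add_part \<mu> a) = a" "remove_part (add_part \<mu> a) a = \<mu>"
    using assms(3) by (auto simp: add_part_def remove_part_def largest_part_add_mset max_def largest_part_def[of "{#}"])
qed

text \<open>In fixed degree a partition is recovered from what is left after deleting its largest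
  part; the remainders are the \<mu> whose missing part pn + k - |\<mu>| is at least \<mu>_1. The
  empty partition fits in, because nothing is removed from it and no part 0 is added.\<close>

lemma m_bar_direct_eq_two_sym_sum:
  "m_bar_direct p n k = two_sym_sum (\<lambda>\<mu>. if largest_part \<mu> \<le> p * n + k - sum_mset \<mu>
     then alpha p n k (add_part \<mu> (p * n + k - sum_mset \<mu>)) else 0) (p * n + k)"
proof -
  let ?d = "p * n + k"
  let ?L = "{\<mu>. is_partition \<mu> \<and> sum_mset \<mu> \<le> ?d}"
  let ?a = "\<lambda>\<mu>. add_part \<mu> (?d - sum_mset \<mu>)"
  have "m_bar_direct p n k = (\<Sum>\<mu>\<in>{\<mu> \<in> ?L. largest_part \<mu> \<le> ?d - sum_mset \<mu>}.
      of_int (alpha p n k (?a \<mu>)) * e_x_part \<mu> * e_y (?d - sum_mset \<mu>))"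
    unfolding m_bar_direct_def
  proof (rule sum.reindex_bij_witness[where i = ?a and j = "\<lambda>\<nu>. remove_part \<nu> (largest_part \<nu>)"])
    fix \<nu> assume "\<nu> \<in> partitions_of ?d"
    note r = remove_largest_part[OF this]
    have s: "?d - sum_mset (remove_part \<nu> (largest_part \<nu>)) = largest_part \<nu>" using r(2) by simp
    show "?a (remove_part \<nu> (largest_part \<nu>)) = \<nu>" unfolding s by (rule r(4))
    show "remove_part \<nu> (largest_part \<nu>) \<in> {\<mu> \<in> ?L. largest_part \<mu> \<le> ?d - sum_mset \<mu>}"
      using r s by simp
    show "of_int (alpha p n k (?a (remove_part \<nu> (largest_part \<nu>)))) * e_x_part (remove_part \<nu> (largest_part \<nu>)) *
        e_y (?d - sum_mset (remove_part \<nu> (largest_part \<nu>))) =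
      of_int (alpha p n k \<nu>) * e_x_part (remove_part \<nu> (largest_part \<nu>)) * e_y (largest_part \<nu>)"
      unfolding s r(4) ..
  next
    fix \<mu> assume \<mu>: "\<mu> \<in> {\<mu> \<in> ?L. largest_part \<mu> \<le> ?d - sum_mset \<mu>}"
    then have "is_partition \<mu>" "sum_mset \<mu> + (?d - sum_mset \<mu>) = ?d" "largest_part \<mu> \<le> ?d - sum_mset \<mu>" by auto
    note r = add_largest_part[OF this]
    show "remove_part (?a \<mu>) (largest_part (?a \<mu>)) = \<mu>" unfolding r(2) by (rule r(3))
    show "?a \<mu> \<in> partitions_of ?d" by (rule r(1))
  qed
  also have "\<dots> = two_sym_sum (\<lambda>\<mu>. if largest_part \<mu> \<le> ?d - sum_mset \<mu> then alpha p n k (?a \<mu>) else 0) ?d"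
    unfolding two_sym_sum_eq using finite_partitions_le[of ?d] by (intro sum.mono_neutral_cong_left) auto
  finally show ?thesis .
qed

lemma two_sym_sum_cong:
  assumes "\<And>\<mu>. is_partition \<mu> \<Longrightarrow> sum_mset \<mu> \<le> d \<Longrightarrow> b \<mu> = b' \<mu>"
  shows "two_sym_sum b d = two_sym_sum b' d"
  unfolding two_sym_sum_eq using assms by (intro sum.cong refl) simp

text \<open>If the missing part is smaller than \<mu>_1, the direct sum has no such term and the
  formula has to vanish: otherwise \<mu>_1 <= |\<mu>| <= n(p - 1) <= n + k <= pn + k -
  |\<mu>|.\<close>

lemma direct_coeff_eq_beta_formula:
  assumes p: "p \<ge> 2" and part: "is_partition \<mu>" and le: "sum_mset \<mu> \<le> p * n + k"
    and k: "k \<ge> n * (p - 2)"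
    and less: "largest_part \<mu> \<le> p * n + k - sum_mset \<mu> \<Longrightarrow> largest_part \<mu> < n + k"
  shows "(if largest_part \<mu> \<le> p * n + k - sum_mset \<mu>
     then alpha p n k (add_part \<mu> (p * n + k - sum_mset \<mu>)) else 0) = beta_formula p n k \<mu>"
proof (cases "largest_part \<mu> \<le> p * n + k - sum_mset \<mu>")
  case True
  then show ?thesis using alpha_add_part_eq_beta_formula[OF p part le less[OF True]] by simp
next
  case False
  have "beta_formula p n k \<mu> = 0"
  proof (rule ccontr)
    assume "beta_formula p n k \<mu> \<noteq> 0"
    from beta_formula_nonzero(1)[OF part this] have s: "sum_mset \<mu> \<le> n * (p - 1)" .
    obtain q where "p = q + 2" using p by (metis add.commute le_Suc_ex)
    then show False using False s k largest_part_le_sum_mset[of \<mu>] by (simp add: algebra_simps)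
  qed
  then show ?thesis using False by simp
qed

lemma m_bar_direct_eq_beta_formula:
  assumes p: "p \<ge> 2" and k: "k > n * (p - 2)"
  shows "m_bar_direct p n k = two_sym_sum (beta_formula p n k) (p * n + k)"
  unfolding m_bar_direct_eq_two_sym_sum
proof (rule two_sym_sum_cong, rule direct_coeff_eq_beta_formula[OF p])
  fix \<mu> assume \<mu>: "is_partition \<mu>" "sum_mset \<mu> \<le> p * n + k" "largest_part \<mu> \<le> p * n + k - sum_mset \<mu>"
  obtain q where "p = q + 2" using p by (metis add.commute le_Suc_ex)
  then show "largest_part \<mu> < n + k"
    using \<mu> k largest_part_le_sum_mset[of \<mu>] by (simp add: algebra_simps)
qed (use k in simp_all)

lemma collapse_m_bar_direct:
  "collapse (m_bar_direct p n k) = (\<Sum>\<nu>\<in>partitions_of (p * n + k). of_int (alpha p n k \<nu>) * e_x_part \<nu>)"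
  unfolding m_bar_direct_def collapse_sum
proof (rule sum.cong[OF refl])
  fix \<nu> assume "\<nu> \<in> partitions_of (p * n + k)"
  note r = remove_largest_part(4)[OF this]
  have "collapse (of_int (alpha p n k \<nu>) * e_x_part (remove_part \<nu> (largest_part \<nu>)) * e_y (largest_part \<nu>)) =
      of_int (alpha p n k \<nu>) * (e_x (largest_part \<nu>) * e_x_part (remove_part \<nu> (largest_part \<nu>)))"
    by (simp add: collapse_mult mult_ac)
  also have "\<dots> = of_int (alpha p n k \<nu>) * e_x_part \<nu>"
    unfolding e_x_part_add_part[symmetric] r ..
  finally show "collapse (of_int (alpha p n k \<nu>) * e_x_part (remove_part \<nu> (largest_part \<nu>)) * e_y (largest_part \<nu>)) =
      of_int (alpha p n k \<nu>) * e_x_part \<nu>" .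
qed

text \<open>Induction on the distance of k below n(p - 2) + 1. From there on the formula describes
  \<open>m_bar_direct\<close>, whose collapse puts each largest part back; for smaller k both sides
  arise from k + 1 by the Hammond operator.\<close>

lemma collapse_two_sym_sum_beta_formula:
  assumes p: "p \<ge> 2"
  shows "collapse (two_sym_sum (beta_formula p n k) (p * n + k)) =
    (\<Sum>\<nu>\<in>partitions_of (p * n + k). of_int (alpha p n k \<nu>) * e_x_part \<nu>)"
proof (induction "Suc (n * (p - 2)) - k" arbitrary: k)
  case 0
  then show ?case using m_bar_direct_eq_beta_formula[OF p, of n k] collapse_m_bar_direct[of p n k] by simp
next
  case (Suc j)
  have "collapse (two_sym_sum (beta_formula p n k) (p * n + k)) =
      collapse (H1_perp (two_sym_sum (beta_formula p n (Suc k)) (p * n + Suc k)))"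
    using H1_perp_two_sym_sum_beta_formula[OF p, of n k "p * n + k"] by simp
  also have "\<dots> = H1_perp (\<Sum>\<nu>\<in>partitions_of (p * n + Suc k). of_int (alpha p n (Suc k) \<nu>) * e_x_part \<nu>)"
    unfolding H1_perp_collapse_two_sym_sum[symmetric] using Suc(1)[of "Suc k"] Suc(2) by simp
  also have "\<dots> = (\<Sum>\<nu>\<in>partitions_of (p * n + k). of_int (alpha p n k \<nu>) * e_x_part \<nu>)"
    using H1_perp_sum_alpha_e_x_part[OF p, of n k] by simp
  finally show ?case .
qed

lemma collapse_two_sym_sum:
  "collapse (two_sym_sum b d) = (\<Sum>\<nu>\<in>partitions_of d.
     of_int (\<Sum>\<mu> | is_partition \<mu> \<and> sum_mset \<mu> \<le> d \<and> add_part \<mu> (d - sum_mset \<mu>) = \<nu>. b \<mu>) * e_x_part \<nu>)"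
proof -
  let ?L = "{\<mu>. is_partition \<mu> \<and> sum_mset \<mu> \<le> d}"
  let ?a = "\<lambda>\<mu>. add_part \<mu> (d - sum_mset \<mu>)"
  have "collapse (two_sym_sum b d) = (\<Sum>\<mu>\<in>?L. of_int (b \<mu>) * e_x_part (?a \<mu>))"
    unfolding two_sym_sum_eq collapse_sum by (simp add: collapse_mult e_x_part_add_part mult_ac)
  also have "\<dots> = (\<Sum>\<nu>\<in>partitions_of d. \<Sum>\<mu> | \<mu> \<in> ?L \<and> ?a \<mu> = \<nu>. of_int (b \<mu>) * e_x_part (?a \<mu>))"
  proof (rule sum.group[symmetric])
    show "?a ` ?L \<subseteq> partitions_of d" by (auto simp: partitions_of_def add_part_def is_partition_def)
  qed (rule finite_partitions_le finite_partitions_of)+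
  also have "\<dots> = (\<Sum>\<nu>\<in>partitions_of d. of_int (\<Sum>\<mu> | \<mu> \<in> ?L \<and> ?a \<mu> = \<nu>. b \<mu>) * e_x_part \<nu>)"
    by (intro sum.cong refl) (simp add: sum_distrib_right)
  finally show ?thesis by (simp add: conj_assoc)
qed

text \<open>Coefficients of e_\<nu> are compared after the collapse. Its preimages are the
  \<open>remove_part \<nu> i\<close> and also \<nu> itself, with nothing added; the latter has size
  pn + k > n(p - 1), where the formula vanishes.\<close>

lemma alpha_eq_sum_beta_formula:
  assumes p: "p \<ge> 2" and \<nu>: "\<nu> \<in> partitions_of (p * n + k)" and pos: "p * n + k \<ge> 1"
  shows "alpha p n k \<nu> = (\<Sum>i\<in>set_mset \<nu>. beta_formula p n k (remove_part \<nu> i))"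
proof -
  let ?d = "p * n + k"
  let ?S = "{\<mu>. is_partition \<mu> \<and> sum_mset \<mu> \<le> ?d \<and> add_part \<mu> (?d - sum_mset \<mu>) = \<nu>}"
  have part: "is_partition \<nu>" and sum: "sum_mset \<nu> = ?d" using \<nu> by (auto simp: partitions_of_def)
  have sum_remove: "sum_mset (remove_part \<nu> i) + i = ?d" if "i \<in># \<nu>" for i
  proof -
    from that obtain \<sigma> where "\<nu> = add_mset i \<sigma>" by (rule mset_add)
    then show ?thesis using sum by (simp add: remove_part_def)
  qed
  have inj: "inj_on (remove_part \<nu>) (set_mset \<nu>)"
  proof (rule inj_onI)
    fix i j assume "i \<in># \<nu>" "j \<in># \<nu>" "remove_part \<nu> i = remove_part \<nu> j"
    then show "i = j" using sum_remove[of i] sum_remove[of j] by simp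
  qed
  have sub: "remove_part \<nu> ` set_mset \<nu> \<subseteq> ?S"
  proof (rule image_subsetI)
    fix i assume i: "i \<in># \<nu>"
    then have "i \<noteq> 0" using part unfolding is_partition_def by metis
    moreover have "?d - sum_mset (remove_part \<nu> i) = i" using sum_remove[OF i] by simp
    moreover have "is_partition (remove_part \<nu> i)"
      using part by (auto simp: is_partition_def remove_part_def dest: in_diffD)
    ultimately show "remove_part \<nu> i \<in> ?S"
      using i sum_remove[OF i] by (simp add: add_part_def) (simp add: remove_part_def)
  qed
  have rest: "beta_formula p n k \<mu> = 0" if "\<mu> \<in> ?S - remove_part \<nu> ` set_mset \<nu>" for \<mu>
  proof (rule ccontr)
    assume nz: "beta_formula p n k \<mu> \<noteq> 0"
    have \<mu>: "is_partition \<mu>" "add_part \<mu> (?d - sum_mset \<mu>) = \<nu>" "sum_mset \<mu> \<le> ?d" using that by auto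
    have "n * (p - 1) < ?d"
    proof -
      obtain q where "p = Suc q" using p by (cases p) auto
      then show ?thesis using pos by (cases n) auto
    qed
    then have "?d - sum_mset \<mu> \<noteq> 0" using beta_formula_nonzero(1)[OF \<mu>(1) nz] by simp
    then have "\<nu> = add_mset (?d - sum_mset \<mu>) \<mu>" using \<mu>(2) by (simp add: add_part_def)
    then have "\<mu> = remove_part \<nu> (?d - sum_mset \<mu>)" "?d - sum_mset \<mu> \<in># \<nu>"
      by (simp_all add: remove_part_def)
    then show False using that by blast
  qed
  have "(\<Sum>\<nu>\<in>partitions_of ?d. of_int (alpha p n k \<nu>) * e_x_part \<nu>) = (\<Sum>\<nu>\<in>partitions_of ?d.
      of_int (\<Sum>\<mu> | is_partition \<mu> \<and> sum_mset \<mu> \<le> ?d \<and> add_part \<mu> (?d - sum_mset \<mu>) = \<nu>. beta_formula p n k \<mu>) * e_x_part \<nu>)"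
    unfolding collapse_two_sym_sum_beta_formula[OF p, symmetric] by (rule collapse_two_sym_sum)
  from sum_e_x_part_inject[OF this \<nu>] have "alpha p n k \<nu> = (\<Sum>\<mu>\<in>?S. beta_formula p n k \<mu>)" .
  also have "\<dots> = (\<Sum>\<mu>\<in>remove_part \<nu> ` set_mset \<nu>. beta_formula p n k \<mu>)"
  proof (rule sum.mono_neutral_right[OF _ sub])
    show "finite ?S" using finite_partitions_le[of ?d] by (rule rev_finite_subset) auto
  qed (use rest in blast)
  also have "\<dots> = (\<Sum>i\<in>set_mset \<nu>. beta_formula p n k (remove_part \<nu> i))"
    by (simp add: sum.reindex[OF inj])
  finally show ?thesis .
qed

text \<open>
  For \<open>k = n(p - 2)\<close> the only coefficient that is not covered by the generic argument is the one of
  \<open>\<mu> = (n + k)\<close>; there \<open>\<mu> \<union> (n + k)\<close> has a single distinct part, so the sum formula for \<open>\<alpha>\<close> has one term.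
\<close>

lemma m_bar_direct_corner_eq_beta_formula:
  assumes p: "p \<ge> 2" and k: "k = n * (p - 2)"
  shows "m_bar_direct p n k = two_sym_sum (beta_formula p n k) (p * n + k)"
  unfolding m_bar_direct_eq_two_sym_sum
proof (rule two_sym_sum_cong)
  let ?d = "p * n + k"
  fix \<mu> assume \<mu>: "is_partition \<mu>" "sum_mset \<mu> \<le> ?d"
  let ?a = "?d - sum_mset \<mu>"
  show "(if largest_part \<mu> \<le> ?a then alpha p n k (add_part \<mu> ?a) else 0) = beta_formula p n k \<mu>"
  proof (cases "largest_part \<mu> \<le> ?a \<and> n + k \<le> largest_part \<mu>")
    case False
    then show ?thesis by (intro direct_coeff_eq_beta_formula[OF p \<mu>]) (use k in auto)
  next
    case True
    obtain q where q: "p = q + 2" using p by (metis add.commute le_Suc_ex)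
    \<comment> \<open>Both |\<mu>| and \<open>?a\<close> are at least \<mu>_1 >= n + k and they add
      up to 2(n + k), so equality holds throughout.\<close>
    have d: "?d = 2 * (n + k)" using k q by (simp add: algebra_simps)
    have "largest_part \<mu> \<le> ?a" "n + k \<le> largest_part \<mu>" using True by auto
    then have s: "sum_mset \<mu> = n + k" "?a = n + k" "largest_part \<mu> = n + k"
      using \<mu>(2) largest_part_le_sum_mset[of \<mu>] d by arith+
    show ?thesis
    proof (cases "n + k = 0")
      \<comment> \<open>With n = k = 0 the sum formula does not apply. Both sides reduce to the
        coefficient of 1 in m of the empty partition, by \<open>power_sum_coeff p 0 0\<close> =
        1.\<close>
      case True
      then have \<mu>0: "\<mu> = {#}" using size_le_sum_mset[OF \<mu>(1)] s by simp
      have "{\<nu> \<in> partitions_of 0. largest_part \<nu> < p \<and> size \<nu> = 0} = {{#}}"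
        using p by (auto simp: partitions_of_0 largest_part_def)
      then show ?thesis using True p \<mu>0
        by (simp add: largest_part_def add_part_def alpha_eq_monomial_elem_coeff partitions_of_0
            beta_formula_def bounded_coeff_sum_def ones_ps_def)
    next
      case False
      have "\<mu> \<noteq> {#}" using s False by auto
      then have "n + k \<in># \<mu>" using largest_part_in \<mu>(1) s by metis
      then obtain \<sigma> where \<sigma>: "\<mu> = add_mset (n + k) \<sigma>" by (metis mset_add)
      moreover have "is_partition \<sigma>" using \<mu>(1) \<sigma> by (simp add: is_partition_def)
      ultimately have "\<sigma> \<in> partitions_of 0" using s by (simp add: partitions_of_def)
      then have "\<sigma> = {#}" by (simp add: partitions_of_0)
      then have \<mu>_eq: "\<mu> = {#n + k#}" using \<sigma> by simp
      have "{#n + k, n + k#} \<in> partitions_of ?d"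
        unfolding d using False by (auto simp: partitions_of_def is_partition_def)
      moreover have "p * n + k \<ge> 1" using False p by (cases n) auto
      ultimately have "alpha p n k {#n + k, n + k#} = beta_formula p n k {#n + k#}"
        using alpha_eq_sum_beta_formula[OF p, of "{#n + k, n + k#}" n k]
        by (simp add: remove_part_def)
      moreover have "add_part \<mu> ?a = {#n + k, n + k#}"
        unfolding s(2) using False \<mu>_eq by (simp only: add_part_def if_False)
      moreover have "largest_part \<mu> \<le> ?a" using s by simp
      ultimately show ?thesis using \<mu>_eq by (simp only: if_True)
    qed
  qed
qed

lemma m_bar_eq_beta_formula:
  assumes p: "p \<ge> 2"
  shows "m_bar p n k = two_sym_sum (beta_formula p n k) (p * n + k)"
proof (cases "k \<ge> n * (p - 2)")
  case True
  then show ?thesis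
    using m_bar_direct_eq_beta_formula[OF p, of n k] m_bar_direct_corner_eq_beta_formula[OF p, of k n]
    by (cases "k = n * (p - 2)") (auto simp: m_bar_def)
next
  case False
  have "(H1_perp ^^ j) (two_sym_sum (beta_formula p n (k + j)) (p * n + (k + j))) =
      two_sym_sum (beta_formula p n k) (p * n + k)" for j
  proof (induction j)
    case (Suc j)
    have "(H1_perp ^^ Suc j) (two_sym_sum (beta_formula p n (k + Suc j)) (p * n + (k + Suc j))) =
        (H1_perp ^^ j) (two_sym_sum (beta_formula p n (k + j)) (p * n + (k + j)))"
      using H1_perp_two_sym_sum_beta_formula[OF p, of n "k + j" "p * n + (k + j)"]
      by (simp add: funpow_Suc_right del: funpow.simps)
    then show ?case using Suc.IH by simp
  qed simp
  from this[of "n * (p - 2) - k"] show ?thesis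
    using False m_bar_direct_corner_eq_beta_formula[OF p, of "n * (p - 2)" n] by (simp add: m_bar_def)
qed

text \<open>Independence of the products makes the definite description unique. The formula vanishes
  by itself for |\<mu>| > pn + k, so it agrees with \<open>beta\<close> on all partitions.\<close>

lemma beta_eq_beta_formula:
  assumes p: "p \<ge> 2" and part: "is_partition \<mu>"
  shows "beta p n k \<mu> = beta_formula p n k \<mu>"
proof -
  let ?d = "p * n + k"
  let ?b = "\<lambda>\<mu>. if is_partition \<mu> \<and> sum_mset \<mu> \<le> ?d then beta_formula p n k \<mu> else 0"
  have "beta p n k = ?b"
    unfolding beta_def two_sym_sum_eq[symmetric] m_bar_eq_beta_formula[OF p]
  proof (rule the_equality)
    show "(\<forall>\<mu>. \<not> (is_partition \<mu> \<and> sum_mset \<mu> \<le> ?d) \<longrightarrow> ?b \<mu> = 0) \<and>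
        two_sym_sum (beta_formula p n k) ?d = two_sym_sum ?b ?d"
      using two_sym_sum_cong[of ?d "beta_formula p n k" ?b] by auto
  next
    fix b assume b: "(\<forall>\<mu>. \<not> (is_partition \<mu> \<and> sum_mset \<mu> \<le> ?d) \<longrightarrow> b \<mu> = 0) \<and>
        two_sym_sum (beta_formula p n k) ?d = two_sym_sum b ?d"
    show "b = ?b"
    proof
      fix \<mu>
      show "b \<mu> = ?b \<mu>" using b two_sym_sum_inject[of "beta_formula p n k" ?d b \<mu>] by auto
    qed
  qed
  moreover have "beta_formula p n k \<mu> = 0" if "\<not> sum_mset \<mu> \<le> ?d"
  proof (rule ccontr)
    assume "beta_formula p n k \<mu> \<noteq> 0"
    from beta_formula_nonzero(1)[OF part this] have "sum_mset \<mu> \<le> n * p"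
      using mult_le_mono2[of "p - 1" p n] by linarith
    then show False using that by (simp add: mult.commute)
  qed
  ultimately show ?thesis using part by simp
qed

theorem theorem5:
  fixes p :: nat
  assumes "p \<ge> 2"
  shows
    "(\<forall>\<mu> n k. is_partition \<mu> \<and> n \<ge> 1 \<and> k \<ge> 1 \<longrightarrow>
        beta p n k \<mu> - beta p n (k - 1) \<mu> = (- 1) ^ (p - 1) * beta p (n - 1) k \<mu>)
   \<and> ((\<forall>\<mu> n k. is_partition \<mu> \<and> (size \<mu> > p - 1 \<or> sum_mset \<mu> > n * (p - 1)) \<longrightarrow>
        beta p n k \<mu> = 0)
      \<and> (\<forall>\<mu> n. is_partition \<mu> \<and> n > largest_part \<mu> \<longrightarrow> [beta p n 0 \<mu> = 0] (mod int p)))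
   \<and> ((\<forall>\<mu> n k. p * n + k \<ge> 1 \<and> \<mu> \<in> partitions_of (p * n + k) \<longrightarrow>
        alpha p n k \<mu> = (\<Sum>i\<in>set_mset \<mu>. beta p n k (remove_part \<mu> i)))
      \<and> (\<forall>\<mu> n k. is_partition \<mu> \<and> sum_mset \<mu> \<le> p * n + k \<and> n + k > largest_part \<mu> \<longrightarrow>
        alpha p n k (add_part \<mu> (p * n + k - sum_mset \<mu>)) = beta p n k \<mu>))"
proof (intro conjI allI impI; elim conjE)
  fix \<mu> :: "nat multiset" and n k :: nat
  assume \<mu>: "is_partition \<mu>" and "n \<ge> 1" "k \<ge> 1"
  then obtain n' k' where "n = Suc n'" "k = Suc k'" by (metis Suc_le_D One_nat_def)
  then show "beta p n k \<mu> - beta p n (k - 1) \<mu> = (- 1) ^ (p - 1) * beta p (n - 1) k \<mu>"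
    using beta_formula_rec[of p n' k' \<mu>] by (simp add: beta_eq_beta_formula[OF assms \<mu>])
next
  fix \<mu> :: "nat multiset" and n k :: nat
  assume \<mu>: "is_partition \<mu>" and "size \<mu> > p - 1 \<or> sum_mset \<mu> > n * (p - 1)"
  then show "beta p n k \<mu> = 0"
    using beta_formula_nonzero[OF \<mu>, of p n k] beta_eq_beta_formula[OF assms \<mu>, of n k]
    by (cases "beta_formula p n k \<mu> = 0") auto
next
  fix \<mu> :: "nat multiset" and n :: nat
  assume \<mu>: "is_partition \<mu>" and "n > largest_part \<mu>"
  then show "[beta p n 0 \<mu> = 0] (mod int p)"
    using dvd_beta_formula_0[OF \<mu>, of n p] by (simp add: cong_0_iff beta_eq_beta_formula[OF assms \<mu>])
next
  fix \<mu> :: "nat multiset" and n k :: nat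
  assume pos: "p * n + k \<ge> 1" and \<mu>: "\<mu> \<in> partitions_of (p * n + k)"
  have "is_partition (remove_part \<mu> i)" for i
    using \<mu> by (auto simp: partitions_of_def is_partition_def remove_part_def dest: in_diffD)
  then show "alpha p n k \<mu> = (\<Sum>i\<in>set_mset \<mu>. beta p n k (remove_part \<mu> i))"
    using alpha_eq_sum_beta_formula[OF assms \<mu> pos] by (simp add: beta_eq_beta_formula[OF assms])
next
  fix \<mu> :: "nat multiset" and n k :: nat
  assume \<mu>: "is_partition \<mu>" and "sum_mset \<mu> \<le> p * n + k" "n + k > largest_part \<mu>"
  then show "alpha p n k (add_part \<mu> (p * n + k - sum_mset \<mu>)) = beta p n k \<mu>"
    using alpha_add_part_eq_beta_formula[OF assms \<mu>] by (simp add: beta_eq_beta_formula[OF assms \<mu>])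
qed

end
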